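(* Let $\Gamma$ be a word-hyperbolic group and let $C^*_r(\Gamma)$ be its reduced group $C^*$-algebra. There exists an infinite increasing sequence $(\mathcal{A}_n\Gamma)_{n}$ of Banach subalgebras of $C^*_r(\Gamma)$, containing $\mathbb{C}\Gamma$, such that $\mathcal{A}_\omega\Gamma=\bigcup_n \mathcal{A}_n\Gamma$ has the following properties: (i) $\mathcal{A}_\omega\Gamma$ is dense and closed under holomorphic functional calculus in $C^*_r(\Gamma)$. (ii) Every tempered class function on $\Gamma$ gives rise to a bounded trace on $\mathcal{A}_\omega\Gamma$; that is, if $\tau:\Gamma\to\mathbb{C}$ is a tempered class function, then the trace on $\mathbb{C}\Gamma$ given by $\sum_g a_gu_g\mapsto\sum_g a_g\tau(g)$ extends to a bounded trace on $\mathcal{A}_\omega\Gamma$.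
   Context: $\mathbb{C}\Gamma$ is the group ring with basis $(u_g)_{g\in\Gamma}$. A dense subalgebra of a Banach algebra is called closed under holomorphic functional calculus if the spectra of its elements in both algebras agree. $\mathcal{A}_\omega\Gamma=\bigcup_n\mathcal{A}_n\Gamma$ is regarded as a bornological algebra: a subset is bounded if it is contained and bounded in some Banach algebra $\mathcal{A}_n\Gamma$; a linear functional on it is bounded if its restriction to every $\mathcal{A}_n\Gamma$ is bounded. "Increasing sequence of Banach subalgebras" means that each $\mathcal{A}_n\Gamma$ is a Banach algebra in its own norm, with $\mathcal{A}_n\Gamma\subset\mathcal{A}_{n+1}\Gamma\subset C^*_r(\Gamma)$ and bounded inclusions. A class function on $\Gamma$ is a function constant on conjugacy classes; for a class function $\tau$ write $\tau(\langle x\rangle)$ for its value on the conjugacy class $\langle x\rangle$. Fix a finite symmetric generating set $S$, let $l_S$ be the word length, and let $l_S(\langle x\rangle)$ be the minimal word length of an element of $\langle x\rangle$. A class function $\tau$ is tempered if $\sum_{\langle x\rangle}(1+l_S(\langle x\rangle))^{-2k}|\tau(\langle x\rangle)|^2<\infty$ for $k$ sufficiently large, the sum running over all conjugacy classes. This condition does not depend on the choice of $S$. *)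

theory Defs
  imports "HOL-Analysis.Analysis" "HOL-Library.Poly_Mapping"
begin

typedef 'a ell2 = "{f :: 'a \<Rightarrow> complex. (\<lambda>x. (cmod (f x))\<^sup>2) summable_on UNIV}"
  morphisms ell2_apply Abs_ell2
  by (intro exI[of _ "\<lambda>_. 0"]) simp

setup_lifting type_definition_ell2

lemma ell2_sum_summable:
  fixes f g :: "'a \<Rightarrow> complex"
  assumes f: "(\<lambda>x. (cmod (f x))\<^sup>2) summable_on UNIV"
    and g: "(\<lambda>x. (cmod (g x))\<^sup>2) summable_on UNIV"
  shows "(\<lambda>x. (cmod (f x + g x))\<^sup>2) summable_on UNIV"
proof (rule summable_on_comparison_test)
  show "(\<lambda>x. 2 * (cmod (f x))\<^sup>2 + 2 * (cmod (g x))\<^sup>2) summable_on UNIV"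
    by (intro summable_on_add summable_on_cmult_right f g)
  fix x
  have "(cmod (f x + g x))\<^sup>2 \<le> (cmod (f x) + cmod (g x))\<^sup>2"
    by (intro power_mono norm_triangle_ineq) auto
  also have "\<dots> \<le> 2 * (cmod (f x))\<^sup>2 + 2 * (cmod (g x))\<^sup>2"
    using sum_squares_bound[of "cmod (f x)" "cmod (g x)"] by (simp add: power2_sum)
  finally show "(cmod (f x + g x))\<^sup>2 \<le> 2 * (cmod (f x))\<^sup>2 + 2 * (cmod (g x))\<^sup>2" .
qed auto

lemma ell2_scale_summable:
  fixes f :: "'a \<Rightarrow> complex"
  assumes "(\<lambda>x. (cmod (f x))\<^sup>2) summable_on UNIV"
  shows "(\<lambda>x. (cmod (c * f x))\<^sup>2) summable_on UNIV"
  using summable_on_cmult_right[OF assms, of "(cmod c)\<^sup>2"]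
  by (simp add: norm_mult power_mult_distrib)

lemma ell2_inner_summable:
  fixes f g :: "'a \<Rightarrow> complex"
  assumes f: "(\<lambda>x. (cmod (f x))\<^sup>2) summable_on UNIV"
    and g: "(\<lambda>x. (cmod (g x))\<^sup>2) summable_on UNIV"
  shows "(\<lambda>x. f x \<bullet> g x) summable_on UNIV"
proof -
  have "(\<lambda>x. (cmod (f x + g x))\<^sup>2 + (-1) * (cmod (f x))\<^sup>2 + (-1) * (cmod (g x))\<^sup>2) summable_on UNIV"
    by (intro summable_on_add summable_on_cmult_right f g ell2_sum_summable)
  hence "(\<lambda>x. (1/2) * ((cmod (f x + g x))\<^sup>2 + (-1) * (cmod (f x))\<^sup>2 + (-1) * (cmod (g x))\<^sup>2)) summable_on UNIV"
    by (rule summable_on_cmult_right)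
  thus ?thesis
    by (simp add: power2_norm_eq_inner inner_add_left inner_add_right inner_commute)
qed

instantiation ell2 :: (type) real_vector
begin
lift_definition zero_ell2 :: "'a ell2" is "\<lambda>_. 0" by simp
lift_definition plus_ell2 :: "'a ell2 \<Rightarrow> 'a ell2 \<Rightarrow> 'a ell2" is "\<lambda>f g x. f x + g x"
  by (rule ell2_sum_summable)
lift_definition uminus_ell2 :: "'a ell2 \<Rightarrow> 'a ell2" is "\<lambda>f x. - f x" by simp
lift_definition minus_ell2 :: "'a ell2 \<Rightarrow> 'a ell2 \<Rightarrow> 'a ell2" is "\<lambda>f g x. f x - g x"
proof -
  fix f g :: "'a \<Rightarrow> complex"
  assume "(\<lambda>x. (cmod (f x))\<^sup>2) summable_on UNIV" "(\<lambda>x. (cmod (g x))\<^sup>2) summable_on UNIV"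
  thus "(\<lambda>x. (cmod (f x - g x))\<^sup>2) summable_on UNIV"
    using ell2_sum_summable[of f "\<lambda>x. - g x"] by simp
qed
lift_definition scaleR_ell2 :: "real \<Rightarrow> 'a ell2 \<Rightarrow> 'a ell2" is "\<lambda>r f x. complex_of_real r * f x"
  by (rule ell2_scale_summable)
instance
  by standard (transfer; simp add: algebra_simps fun_eq_iff)+
end

instantiation ell2 :: (type) real_inner
begin
text \<open>The real inner product is the real part of the usual complex one, so that the norm is
  the usual norm of \<open>\<ell>\<^sup>2\<close>.\<close>
lift_definition inner_ell2 :: "'a ell2 \<Rightarrow> 'a ell2 \<Rightarrow> real" is
  "\<lambda>f g. \<Sum>\<^sub>\<infinity>x\<in>UNIV. f x \<bullet> g x" .
definition norm_ell2 :: "'a ell2 \<Rightarrow> real" where "norm_ell2 f = sqrt (f \<bullet> f)"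
definition dist_ell2 :: "'a ell2 \<Rightarrow> 'a ell2 \<Rightarrow> real" where "dist_ell2 f g = norm (f - g)"
definition sgn_ell2 :: "'a ell2 \<Rightarrow> 'a ell2" where "sgn_ell2 f = f /\<^sub>R norm f"
definition uniformity_ell2 :: "('a ell2 \<times> 'a ell2) filter" where
  "uniformity_ell2 = (INF e\<in>{0<..}. principal {(f, g). dist f g < e})"
definition open_ell2 :: "'a ell2 set \<Rightarrow> bool" where
  "open_ell2 U \<longleftrightarrow> (\<forall>x\<in>U. eventually (\<lambda>(x', y). x' = x \<longrightarrow> y \<in> U) uniformity)"
instance
proof
  fix f g h :: "'a ell2" and r :: real
  show "f \<bullet> g = g \<bullet> f" by transfer (simp add: inner_commute)
  show "(f + g) \<bullet> h = f \<bullet> h + g \<bullet> h"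
    by transfer (simp add: inner_add_left infsum_add ell2_inner_summable)
  show "(r *\<^sub>R f) \<bullet> g = r * (f \<bullet> g)"
    by transfer (simp add: infsum_cmult_right' flip: scaleR_conv_of_real)
  show "0 \<le> f \<bullet> f" by transfer (simp add: infsum_nonneg)
  show "f \<bullet> f = 0 \<longleftrightarrow> f = 0"
  proof transfer
    fix f :: "'a \<Rightarrow> complex"
    assume f: "(\<lambda>x. (cmod (f x))\<^sup>2) summable_on UNIV"
    have s: "(\<lambda>x. f x \<bullet> f x) summable_on UNIV" using f f by (rule ell2_inner_summable)
    show "(\<Sum>\<^sub>\<infinity>x\<in>UNIV. f x \<bullet> f x) = 0 \<longleftrightarrow> f = (\<lambda>_. 0)"
    proof
      assume "(\<Sum>\<^sub>\<infinity>x\<in>UNIV. f x \<bullet> f x) = 0"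
      hence "f x \<bullet> f x = 0" for x
        using nonneg_infsum_le_0D[of "\<lambda>x. f x \<bullet> f x" UNIV x] s by simp
      thus "f = (\<lambda>_. 0)" by (simp add: fun_eq_iff)
    qed simp
  qed
qed (simp_all add: norm_ell2_def dist_ell2_def sgn_ell2_def uniformity_ell2_def open_ell2_def)
end

lemma norm_ell2_square: "(norm f)\<^sup>2 = (\<Sum>\<^sub>\<infinity>x\<in>UNIV. (cmod (ell2_apply f x))\<^sup>2)"
  unfolding power2_norm_eq_inner by transfer simp

type_synonym 'a ell2_op = "'a ell2 \<Rightarrow>\<^sub>L 'a ell2"

lift_definition ell2_scaleC :: "complex \<Rightarrow> 'a ell2 \<Rightarrow> 'a ell2" is "\<lambda>c f x. c * f x"
  by (rule ell2_scale_summable)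

lemma norm_ell2_scaleC: "norm (ell2_scaleC c f) = cmod c * norm f"
proof (rule power2_eq_imp_eq)
  show "(norm (ell2_scaleC c f))\<^sup>2 = (cmod c * norm f)\<^sup>2"
    unfolding norm_ell2_square power_mult_distrib
    by transfer (simp add: norm_mult power_mult_distrib infsum_cmult_right')
qed auto

text \<open>The type \<open>\<Rightarrow>\<^sub>L\<close> consists of bounded \<^emph>\<open>real\<close>-linear maps. Its norm is the operator norm, and
  complex multiples of operators are formed by composition with the following operator.\<close>

lift_definition scalar_op :: "complex \<Rightarrow> 'a ell2_op" is ell2_scaleC
proof (rule bounded_linear_intro)
  fix c r and f g :: "'a ell2"
  show "ell2_scaleC c (f + g) = ell2_scaleC c f + ell2_scaleC c g"
    by transfer (simp add: algebra_simps)
  show "ell2_scaleC c (r *\<^sub>R f) = r *\<^sub>R ell2_scaleC c f"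
    by transfer (simp add: algebra_simps)
  show "norm (ell2_scaleC c f) \<le> norm f * cmod c"
    by (simp add: norm_ell2_scaleC)
qed

definition scaleC_op :: "complex \<Rightarrow> 'a ell2_op \<Rightarrow> 'a ell2_op"  (infixr \<open>*\<^sub>C\<close> 75)
  where "c *\<^sub>C T = scalar_op c o\<^sub>L T"

text \<open>Groups are types of class \<open>group_add\<close>; this class does not assume commutativity, the group
  law being written \<open>+\<close>. The type \<open>'g \<Rightarrow>\<^sub>0 complex\<close> with its convolution product is the
  group ring.\<close>

lift_definition ell2_translate :: "'g::group_add \<Rightarrow> 'g ell2 \<Rightarrow> 'g ell2" is
  "\<lambda>g f x. f (- g + x)"
proof -
  fix g :: 'g and f :: "'g \<Rightarrow> complex"
  have b: "bij (\<lambda>x. - g + x)" by (rule bij_betw_byWitness[of _ "\<lambda>x. g + x"]) auto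
  assume "(\<lambda>x. (cmod (f x))\<^sup>2) summable_on UNIV"
  thus "(\<lambda>x. (cmod (f (- g + x)))\<^sup>2) summable_on UNIV"
    using summable_on_reindex_bij_betw[OF b, of "\<lambda>x. (cmod (f x))\<^sup>2"] by simp
qed

lemma norm_ell2_translate: "norm (ell2_translate g f) = norm f"
proof (rule power2_eq_imp_eq)
  have b: "bij (\<lambda>x. - g + x)" by (rule bij_betw_byWitness[of _ "\<lambda>x. g + x"]) auto
  show "(norm (ell2_translate g f))\<^sup>2 = (norm f)\<^sup>2"
    unfolding norm_ell2_square
    using infsum_reindex_bij_betw[OF b, of "\<lambda>x. (cmod (ell2_apply f x))\<^sup>2"]
    by (simp add: ell2_translate.rep_eq)
qed auto

lift_definition translation_op :: "'g::group_add \<Rightarrow> 'g ell2_op" is ell2_translate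
proof (rule bounded_linear_intro)
  fix g :: 'g and r and f h :: "'g ell2"
  show "ell2_translate g (f + h) = ell2_translate g f + ell2_translate g h"
    by transfer simp
  show "ell2_translate g (r *\<^sub>R f) = r *\<^sub>R ell2_translate g f"
    by transfer simp
  show "norm (ell2_translate g f) \<le> norm f * 1"
    by (simp add: norm_ell2_translate)
qed

definition left_regular :: "('g::group_add \<Rightarrow>\<^sub>0 complex) \<Rightarrow> 'g ell2_op" where
  "left_regular a = (\<Sum>g\<in>Poly_Mapping.keys a. Poly_Mapping.lookup a g *\<^sub>C translation_op g)"

text \<open>The closure is taken for the operator norm. It consists of complex-linear operators,
  since these form a norm-closed set.\<close>

definition reduced_cstar :: "'g::group_add ell2_op set" where
  "reduced_cstar = closure (range left_regular)"

definition subalgebra_op :: "'a ell2_op set \<Rightarrow> bool" where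
  "subalgebra_op A \<longleftrightarrow> 0 \<in> A \<and> (\<forall>a\<in>A. \<forall>b\<in>A. a + b \<in> A \<and> a o\<^sub>L b \<in> A) \<and>
     (\<forall>c. \<forall>a\<in>A. c *\<^sub>C a \<in> A)"

text \<open>\<open>N\<close> is a complete submultiplicative norm on \<open>A\<close>; it is in general not the operator norm,
  and its values outside of \<open>A\<close> are irrelevant. No normalization of the norm of the
  unit is required.\<close>

definition banach_algebra_norm :: "'a ell2_op set \<Rightarrow> ('a ell2_op \<Rightarrow> real) \<Rightarrow> bool" where
  "banach_algebra_norm A N \<longleftrightarrow>
     (\<forall>a\<in>A. 0 \<le> N a \<and> (N a = 0 \<longleftrightarrow> a = 0)) \<and>
     (\<forall>a\<in>A. \<forall>b\<in>A. N (a + b) \<le> N a + N b) \<and>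
     (\<forall>c. \<forall>a\<in>A. N (c *\<^sub>C a) = cmod c * N a) \<and>
     (\<forall>a\<in>A. \<forall>b\<in>A. N (a o\<^sub>L b) \<le> N a * N b) \<and>
     (\<forall>s. range s \<subseteq> A \<and> (\<forall>e>0. \<exists>M. \<forall>m\<ge>M. \<forall>n\<ge>M. N (s m - s n) < e) \<longrightarrow>
        (\<exists>a\<in>A. (\<lambda>n. N (s n - a)) \<longlonglongrightarrow> 0))"

definition bounded_inclusion ::
    "'a ell2_op set \<Rightarrow> ('a ell2_op \<Rightarrow> real) \<Rightarrow> 'a ell2_op set \<Rightarrow> ('a ell2_op \<Rightarrow> real) \<Rightarrow> bool" where
  "bounded_inclusion A N B N' \<longleftrightarrow> A \<subseteq> B \<and> (\<exists>C. \<forall>a\<in>A. N' a \<le> C * N a)"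

definition increasing_banach_subalgebras ::
    "'g::group_add ell2_op set \<Rightarrow> (nat \<Rightarrow> 'g ell2_op set) \<Rightarrow> (nat \<Rightarrow> 'g ell2_op \<Rightarrow> real) \<Rightarrow> bool" where
  "increasing_banach_subalgebras B A N \<longleftrightarrow>
     (\<forall>n. subalgebra_op (A n) \<and> banach_algebra_norm (A n) (N n) \<and>
          bounded_inclusion (A n) (N n) (A (Suc n)) (N (Suc n)) \<and>
          bounded_inclusion (A n) (N n) B norm)"

text \<open>All algebras considered contain the group ring, hence the identity operator.\<close>

definition spectrum_in :: "'a ell2_op set \<Rightarrow> 'a ell2_op \<Rightarrow> complex set" where
  "spectrum_in A a = {z. \<not> (\<exists>b\<in>A. b o\<^sub>L (z *\<^sub>C id_blinfun - a) = id_blinfun \<and>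
                                  (z *\<^sub>C id_blinfun - a) o\<^sub>L b = id_blinfun)}"

definition dense_in :: "'a ell2_op set \<Rightarrow> 'a ell2_op set \<Rightarrow> bool" where
  "dense_in A B \<longleftrightarrow> A \<subseteq> B \<and> B \<subseteq> closure A"

definition hol_closed_in :: "'a ell2_op set \<Rightarrow> 'a ell2_op set \<Rightarrow> bool" where
  "hol_closed_in A B \<longleftrightarrow> (\<forall>a\<in>A. spectrum_in A a = spectrum_in B a)"

definition bounded_trace ::
    "(nat \<Rightarrow> 'a ell2_op set) \<Rightarrow> (nat \<Rightarrow> 'a ell2_op \<Rightarrow> real) \<Rightarrow> ('a ell2_op \<Rightarrow> complex) \<Rightarrow> bool" where
  "bounded_trace A N t \<longleftrightarrow>
     (\<forall>a\<in>(\<Union>n. A n). \<forall>b\<in>(\<Union>n. A n). t (a + b) = t a + t b \<and> t (a o\<^sub>L b) = t (b o\<^sub>L a)) \<and>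
     (\<forall>c. \<forall>a\<in>(\<Union>n. A n). t (c *\<^sub>C a) = c * t a) \<and>
     (\<forall>n. \<exists>C. \<forall>a\<in>A n. cmod (t a) \<le> C * N n a)"

definition finite_symmetric_generating :: "'g::group_add set \<Rightarrow> bool" where
  "finite_symmetric_generating S \<longleftrightarrow> finite S \<and> (\<forall>s\<in>S. - s \<in> S) \<and>
     (\<forall>g. \<exists>ws. set ws \<subseteq> S \<and> sum_list ws = g)"

definition word_length :: "'g::group_add set \<Rightarrow> 'g \<Rightarrow> nat" where
  "word_length S g = (LEAST n. \<exists>ws. length ws = n \<and> set ws \<subseteq> S \<and> sum_list ws = g)"

definition word_dist :: "'g::group_add set \<Rightarrow> 'g \<Rightarrow> 'g \<Rightarrow> real" where
  "word_dist S x y = real (word_length S (- x + y))"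

definition gromov_product :: "'g::group_add set \<Rightarrow> 'g \<Rightarrow> 'g \<Rightarrow> 'g \<Rightarrow> real" where
  "gromov_product S w x y = (word_dist S x w + word_dist S y w - word_dist S x y) / 2"

definition word_hyperbolic :: "'g::group_add itself \<Rightarrow> bool" where
  "word_hyperbolic _ \<longleftrightarrow> (\<exists>S :: 'g set. finite_symmetric_generating S \<and>
     (\<exists>\<delta>. \<forall>w x y z. gromov_product S w x z \<ge>
        min (gromov_product S w x y) (gromov_product S w y z) - \<delta>))"

definition conj_class :: "'g::group_add \<Rightarrow> 'g set" where
  "conj_class x = {h + x - h |h. True}"

definition class_function :: "('g::group_add \<Rightarrow> complex) \<Rightarrow> bool" where
  "class_function \<tau> \<longleftrightarrow> (\<forall>x. \<forall>y\<in>conj_class x. \<tau> y = \<tau> x)"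

definition class_length :: "'g::group_add set \<Rightarrow> 'g set \<Rightarrow> nat" where
  "class_length S K = (LEAST n. \<exists>y\<in>K. word_length S y = n)"

text \<open>\<open>the_elem (\<tau> ` K)\<close> is the constant value of the class function \<open>\<tau>\<close> on the conjugacy
  class \<open>K\<close>.\<close>

definition tempered :: "'g::group_add set \<Rightarrow> ('g \<Rightarrow> complex) \<Rightarrow> bool" where
  "tempered S \<tau> \<longleftrightarrow> class_function \<tau> \<and>
     (\<forall>\<^sub>F k in sequentially.
        (\<lambda>K. (cmod (the_elem (\<tau> ` K)))\<^sup>2 / (1 + real (class_length S K)) ^ (2 * k))
          summable_on range conj_class)"

end

theory Submission
  imports Defs
begin

text \<open>
  Let \<open>l\<close> be the word length. The algebras consist of the operators \<open>T\<close> in the reduced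
  \<open>C\<^sup>*\<close>-algebra whose coefficient function \<open>a\<close> has finite norm
  \<open>\<kappa> * op_norm u + split_norm u\<close> where \<open>u g = exp (\<epsilon> * l g) * \<bar>a g\<bar>\<close>, and the sequence is
  obtained for \<open>\<epsilon> = 1, 1/2, 1/3, \<dots>\<close>. Both norms depend on absolute values only, so all estimates
  are made for functions with values in the nonnegative extended reals.

  The first norm is the norm of the convolution operator on \<open>\<ell>\<^sup>2\<close>. For this norm alone the union
  of the algebras is closed under inversion, by an argument about analytic vectors. If \<open>T\<close> lies in
  the algebra with exponent \<open>\<epsilon>\<close>, then conjugating \<open>T\<close> by multiplication with \<open>exp (t * l)\<close>
  perturbs it, for small \<open>t\<close>, by an operator of small norm. Hence the inverse \<open>b\<close> of \<open>T\<close> survives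
  the conjugation, and its coefficients remain square summable after multiplication with
  \<open>exp (t * l)\<close> (\<open>inverse_exponential_decay\<close>). In a hyperbolic group such a weighted
  \<open>\<ell>\<^sup>2\<close>-norm dominates the convolution norm (\<open>rapid_decay\<close>).

  Exponential decay does not yield traces, because the conjugates of a fixed element grow
  exponentially in number. This is repaired by \<open>split_norm\<close>. It is the norm of the image of \<open>u\<close>
  under the map \<open>\<Delta>\<close> sending \<open>g\<close> to the sum of all \<open>x \<otimes> y\<close> with \<open>x + y = g\<close> and
  \<open>l x + l y \<le> l g + C\<close>, where \<open>x \<otimes> y\<close> acts by inserting a function \<open>\<phi>\<close> of convolution norm
  at most \<open>1\<close> between \<open>y\<close> and \<open>x\<close>, and the result is measured in \<open>\<ell>\<^sup>2\<close>.
  Thin triangles say that a point near a geodesic from \<open>0\<close> to \<open>g + h\<close> is near a geodesic for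
  \<open>g\<close> or for \<open>h\<close>; therefore \<open>\<Delta> (u v)\<close> is dominated by boundedly many translates of
  \<open>\<Delta> u v + u \<Delta> v\<close>, and \<open>split_norm\<close> behaves like the graph norm of a derivation
  (\<open>split_norm_conv\<close>). As for a derivation, it does not affect invertibility: an inverse that exists
  for the convolution norm is approximated by a finitely supported \<open>b'\<close>, and the Neumann series in
  the remainder \<open>1 - T b'\<close> converges for a rescaled norm
  (\<open>smooth_inverse_of_approximate_inverse\<close>).

  Taking for \<open>\<phi>\<close> the unit mass at \<open>0\<close> sends \<open>x \<otimes> y\<close> to the rotation \<open>y + x\<close>, a conjugate of
  \<open>x + y\<close>. Every \<open>g\<close> has a rotation of this kind in a fixed subset of its conjugacy class, whose
  cardinality is linear in the minimal length of the class (\<open>conjugate_to_core\<close>). The sum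
  of \<open>\<bar>a g * \<tau> g\<bar>\<close> over the group is thus dominated by a sum over these small subsets, which the
  Cauchy-Schwarz inequality bounds for every tempered \<open>\<tau>\<close> (\<open>class_function_le_split_norm\<close>).
\<close>

section \<open>Sums of nonnegative functions and the \<open>\<ell>\<^sup>2\<close>-norm\<close>

abbreviation esum :: "('a \<Rightarrow> ennreal) \<Rightarrow> ennreal"  (binder \<open>\<Sum>\<^sup>+\<close> 10)
  where "esum f \<equiv> nn_integral (count_space UNIV) f"

lemma esum_swap: "(\<Sum>\<^sup>+x. \<Sum>\<^sup>+y. f x y) = (\<Sum>\<^sup>+y. \<Sum>\<^sup>+x. f x y)"
  using nn_integral_fst_count_space[of "\<lambda>(x, y). f x y"]
    nn_integral_snd_count_space[of "\<lambda>(x, y). f x y"] by simp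

lemma esum_bij: "bij g \<Longrightarrow> (\<Sum>\<^sup>+x. f (g x)) = (\<Sum>\<^sup>+x. f x)"
  by (rule nn_integral_bij_count_space)

lemma bij_group_maps:
  fixes a :: "'g::group_add"
  shows "bij (\<lambda>x. a + x)" "bij (\<lambda>x. x + a)" "bij (\<lambda>x. a - x)" "bij (\<lambda>x::'g. - x)"
proof -
  show "bij (\<lambda>x. a + x)" by (rule bij_betw_byWitness[of _ "\<lambda>x. - a + x"]) auto
  show "bij (\<lambda>x. x + a)" by (rule bij_betw_byWitness[of _ "\<lambda>x. x - a"]) auto
  show "bij (\<lambda>x. a - x)"
    by (rule bij_betw_byWitness[of _ "\<lambda>x. - x + a"]) (auto simp: diff_add_eq_diff_diff_swap)
  show "bij (\<lambda>x::'g. - x)" by (rule bij_betw_byWitness[of _ "\<lambda>x. - x"]) auto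
qed

lemmas esum_group_reindex = bij_group_maps[THEN esum_bij]

lemma member_le_esum: "f x \<le> (\<Sum>\<^sup>+x. f x)"
proof -
  have "f x = (\<Sum>\<^sup>+y. f y * indicator {x} y)"
    by (subst nn_integral_indicator_finite) auto
  also have "\<dots> \<le> (\<Sum>\<^sup>+x. f x)"
    by (intro nn_integral_mono) (auto simp: indicator_def)
  finally show ?thesis .
qed

lemma esum_single:
  assumes "\<And>y. y \<noteq> x \<Longrightarrow> f y = 0"
  shows "(\<Sum>\<^sup>+x. f x) = f x"
  using assms by (subst nn_integral_count_space'[of "{x}"]) auto

lemma esum_finite_support:
  assumes "finite F" "\<And>y. y \<notin> F \<Longrightarrow> f y = 0"
  shows "(\<Sum>\<^sup>+x. f x) = (\<Sum>x\<in>F. f x)"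
  using assms by (intro nn_integral_count_space') auto

lemma esum_eq_infsum:
  fixes f :: "'a \<Rightarrow> real"
  assumes "\<And>x. 0 \<le> f x" "f summable_on UNIV"
  shows "(\<Sum>\<^sup>+x. ennreal (f x)) = ennreal (\<Sum>\<^sub>\<infinity>x. f x)"
proof -
  have "Infinite_Set_Sum.abs_summable_on f UNIV"
    using assms by (simp flip: abs_summable_equivalent)
  then show ?thesis
    using nn_integral_conv_infsetsum[of f UNIV] assms(1) infsetsum_infsum
    by metis
qed

lemma summable_on_if_esum_finite:
  fixes f :: "'a \<Rightarrow> real"
  assumes "\<And>x. 0 \<le> f x" "(\<Sum>\<^sup>+x. ennreal (f x)) < \<infinity>"
  shows "f summable_on UNIV"
proof -
  have "integrable (count_space UNIV) f"
    using assms by (intro integrableI_bounded) auto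
  then have "Infinite_Set_Sum.abs_summable_on f UNIV"
    by (simp add: Infinite_Set_Sum.abs_summable_on_def)
  then show ?thesis
    using assms(1) by (simp flip: abs_summable_equivalent)
qed

definition esqrt :: "ennreal \<Rightarrow> ennreal" where
  "esqrt x = (if x = top then top else ennreal (sqrt (enn2real x)))"

lemma esqrt_power2 [simp]: "(esqrt x)\<^sup>2 = x"
proof (cases x)
  case (real r)
  then show ?thesis by (simp add: esqrt_def ennreal_power)
qed (simp add: esqrt_def)

lemma ennreal_power2_mono: "x \<le> y \<Longrightarrow> x\<^sup>2 \<le> y\<^sup>2" for x y :: ennreal
  by (simp add: power2_eq_square mult_mono)

lemma ennreal_power2_le_D: "x\<^sup>2 \<le> y\<^sup>2 \<Longrightarrow> x \<le> y" for x y :: ennreal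
proof (cases x; cases y)
  fix r s assume *: "x = ennreal r" "0 \<le> r" "y = ennreal s" "0 \<le> s" "x\<^sup>2 \<le> y\<^sup>2"
  then have "r\<^sup>2 \<le> s\<^sup>2" by (simp add: ennreal_power)
  then show "x \<le> y" using * power2_le_imp_le by (simp add: ennreal_leI)
qed (auto simp: ennreal_power top_unique)

lemma esqrt_le_iff: "esqrt x \<le> c \<longleftrightarrow> x \<le> c\<^sup>2"
  using ennreal_power2_mono[of "esqrt x" c] ennreal_power2_le_D[of "esqrt x" c] by auto

lemma esqrt_power2' [simp]: "esqrt (x\<^sup>2) = x"
  by (rule antisym) (simp add: esqrt_le_iff, rule ennreal_power2_le_D, simp)

definition nrm :: "('a \<Rightarrow> ennreal) \<Rightarrow> ennreal" where
  "nrm f = esqrt (\<Sum>\<^sup>+x. (f x)\<^sup>2)"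

lemma nrm_power2: "(nrm f)\<^sup>2 = (\<Sum>\<^sup>+x. (f x)\<^sup>2)"
  by (simp add: nrm_def)

lemma nrm_le_iff: "nrm f \<le> c \<longleftrightarrow> (\<Sum>\<^sup>+x. (f x)\<^sup>2) \<le> c\<^sup>2"
  by (simp add: nrm_def esqrt_le_iff)

lemma nrm_mono: "(\<And>x. f x \<le> g x) \<Longrightarrow> nrm f \<le> nrm g"
  by (simp add: nrm_le_iff nrm_power2 nn_integral_mono ennreal_power2_mono)

lemma nrm_cmult: "nrm (\<lambda>x. c * f x) = c * nrm f"
  by (rule antisym; rule ennreal_power2_le_D)
     (simp_all add: nrm_power2 power_mult_distrib nn_integral_cmult)

lemma esum_mult_le_nrm: "(\<Sum>\<^sup>+x. f x * g x) \<le> nrm f * nrm g"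
  by (rule ennreal_power2_le_D)
     (simp add: nrm_power2 power_mult_distrib Cauchy_Schwarz_nn_integral)

lemma nrm_triangle: "nrm (\<lambda>x. f x + g x) \<le> nrm f + nrm g"
proof -
  have "(\<Sum>\<^sup>+x. (f x + g x)\<^sup>2) = (\<Sum>\<^sup>+x. (f x)\<^sup>2 + (g x)\<^sup>2 + 2 * (f x * g x))"
    by (intro nn_integral_cong) (simp add: power2_sum mult.assoc)
  also have "\<dots> = (nrm f)\<^sup>2 + (nrm g)\<^sup>2 + 2 * (\<Sum>\<^sup>+x. f x * g x)"
    by (simp add: nn_integral_add nn_integral_cmult nrm_power2)
  also have "\<dots> \<le> (nrm f)\<^sup>2 + (nrm g)\<^sup>2 + 2 * (nrm f * nrm g)"
    by (intro add_mono mult_left_mono esum_mult_le_nrm) auto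
  also have "\<dots> = (nrm f + nrm g)\<^sup>2"
    by (simp add: power2_sum mult.assoc)
  finally show ?thesis
    by (simp add: nrm_le_iff)
qed

lemma nrm_zero [simp]: "nrm (\<lambda>_. 0) = 0"
  using nrm_le_iff[of "\<lambda>_. 0" 0] by simp

lemma nrm_sum: "finite I \<Longrightarrow> nrm (\<lambda>x. \<Sum>i\<in>I. f i x) \<le> (\<Sum>i\<in>I. nrm (f i))"
proof (induction I rule: finite_induct)
  case (insert i I)
  then show ?case
    using nrm_triangle[of "f i" "\<lambda>x. \<Sum>i\<in>I. f i x"] by (auto intro: order_trans add_left_mono)
qed simp

lemma nrm_reindex:
  assumes "bij g"
  shows "nrm (\<lambda>x. f (g x)) = nrm f"
  unfolding nrm_def esum_bij[OF assms, of "\<lambda>x. (f x)\<^sup>2"] ..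

lemma member_le_nrm: "f x \<le> nrm f"
  by (rule ennreal_power2_le_D) (simp only: nrm_power2 member_le_esum[of "\<lambda>x. (f x)\<^sup>2" x])

lemma nrm_liminf:
  assumes "\<And>n. nrm (f n) \<le> c"
  shows "nrm (\<lambda>x. liminf (\<lambda>n. f n x)) \<le> c"
proof -
  have sq: "(liminf u)\<^sup>2 = liminf (\<lambda>n. (u n)\<^sup>2)" for u :: "nat \<Rightarrow> ennreal"
  proof -
    have "continuous_on UNIV (\<lambda>x::ennreal. x\<^sup>2)"
      unfolding power2_eq_square
      by (auto simp: continuous_on_def intro!: tendsto_mult_ennreal) 
    then show ?thesis
      using Liminf_compose_continuous_mono[of "\<lambda>x. x\<^sup>2" sequentially u]
      by (simp add: mono_def ennreal_power2_mono)
  qed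
  have "(\<Sum>\<^sup>+x. (liminf (\<lambda>n. f n x))\<^sup>2) \<le> liminf (\<lambda>n. \<Sum>\<^sup>+x. (f n x)\<^sup>2)"
    unfolding sq by (rule nn_integral_liminf) auto
  also have "\<dots> \<le> liminf (\<lambda>n::nat. c\<^sup>2)"
    using assms by (intro Liminf_mono) (simp add: nrm_le_iff)
  also have "\<dots> = c\<^sup>2" by (simp add: Liminf_const)
  finally show ?thesis by (simp add: nrm_le_iff)
qed

lemma mult_liminf_le: "c * liminf u \<le> liminf (\<lambda>n. c * u n)" for c :: ennreal
  unfolding liminf_SUP_INF SUP_mult_left_ennreal
  by (intro SUP_mono bexI) (auto intro!: INF_greatest mult_left_mono INF_lower)

section \<open>Convolution operators and kernel norms\<close>

definition conv :: "('g::group_add \<Rightarrow> ennreal) \<Rightarrow> ('g \<Rightarrow> ennreal) \<Rightarrow> 'g \<Rightarrow> ennreal" where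
  "conv u v x = (\<Sum>\<^sup>+g. u g * v (- g + x))"

lemma conv_alt: "conv u v x = (\<Sum>\<^sup>+h. u (x - h) * v h)"
  unfolding conv_def using esum_group_reindex(3)[of "\<lambda>g. u g * v (- g + x)" x]
  by simp

lemma conv_assoc: "conv (conv u v) w = conv u (conv v w)"
proof
  fix x
  have "conv (conv u v) w x = (\<Sum>\<^sup>+g. \<Sum>\<^sup>+h. u h * v (- h + g) * w (- g + x))"
    by (simp add: conv_def nn_integral_multc[symmetric])
  also have "\<dots> = (\<Sum>\<^sup>+h. \<Sum>\<^sup>+g. u h * v (- h + g) * w (- g + x))"
    by (rule esum_swap)
  also have "\<dots> = (\<Sum>\<^sup>+h. \<Sum>\<^sup>+g. u h * v g * w (- g + (- h + x)))"
  proof (rule nn_integral_cong)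
    fix h
    show "(\<Sum>\<^sup>+g. u h * v (- h + g) * w (- g + x)) = (\<Sum>\<^sup>+g. u h * v g * w (- g + (- h + x)))"
      using esum_group_reindex(1)[of "\<lambda>g. u h * v (- h + g) * w (- g + x)" h]
      by (simp add: minus_add add.assoc del: add_uminus_conv_diff)
  qed
  also have "\<dots> = conv u (conv v w) x"
    by (simp add: conv_def nn_integral_cmult[symmetric] mult.assoc)
  finally show "conv (conv u v) w x = conv u (conv v w) x" .
qed

text \<open>Both norms defining the algebras are suprema of \<open>\<ell>\<^sup>2\<close>-norms of positive integral operators
  applied to the argument. Monotonicity, subadditivity and Fatou's lemma hold for all of them.\<close>

definition ker_norm :: "('b \<Rightarrow> 'a \<Rightarrow> ennreal) set \<Rightarrow> ('a \<Rightarrow> ennreal) \<Rightarrow> ennreal" where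
  "ker_norm \<K> u = (SUP K\<in>\<K>. nrm (\<lambda>h. \<Sum>\<^sup>+g. K h g * u g))"

lemma ker_norm_upper: "K \<in> \<K> \<Longrightarrow> nrm (\<lambda>h. \<Sum>\<^sup>+g. K h g * u g) \<le> ker_norm \<K> u"
  unfolding ker_norm_def by (rule SUP_upper[where f="\<lambda>K. nrm (\<lambda>h. \<Sum>\<^sup>+g. K h g * u g)"])

lemma ker_norm_mono: "(\<And>g. u g \<le> v g) \<Longrightarrow> ker_norm \<K> u \<le> ker_norm \<K> v"
  unfolding ker_norm_def
  by (auto intro!: SUP_mono' nrm_mono nn_integral_mono mult_left_mono)

lemma ker_norm_add: "ker_norm \<K> (\<lambda>g. u g + v g) \<le> ker_norm \<K> u + ker_norm \<K> v"
  unfolding ker_norm_def[of _ "\<lambda>g. u g + v g"]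
proof (rule SUP_least)
  fix K assume K: "K \<in> \<K>"
  have "nrm (\<lambda>h. \<Sum>\<^sup>+g. K h g * (u g + v g))
      = nrm (\<lambda>h. (\<Sum>\<^sup>+g. K h g * u g) + (\<Sum>\<^sup>+g. K h g * v g))"
    by (simp add: distrib_left nn_integral_add)
  also have "\<dots> \<le> ker_norm \<K> u + ker_norm \<K> v"
    by (rule order_trans[OF nrm_triangle add_mono[OF ker_norm_upper[OF K, of u] ker_norm_upper[OF K, of v]]])
  finally show "nrm (\<lambda>h. \<Sum>\<^sup>+g. K h g * (u g + v g)) \<le> ker_norm \<K> u + ker_norm \<K> v" .
qed

lemma ker_norm_cmult:
  fixes \<K> :: "('b \<Rightarrow> 'a \<Rightarrow> ennreal) set"
  shows "ker_norm \<K> (\<lambda>g. c * u g) = c * ker_norm \<K> u"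
proof -
  have "(\<Sum>\<^sup>+g. K h g * (c * u g)) = c * (\<Sum>\<^sup>+g. K h g * u g)"
    for K :: "'b \<Rightarrow> 'a \<Rightarrow> ennreal" and h
    by (simp add: nn_integral_cmult[symmetric] mult.left_commute)
  then show ?thesis
    by (simp add: ker_norm_def nrm_cmult SUP_mult_left_ennreal)
qed

lemma ker_norm_zero [simp]: "ker_norm \<K> (\<lambda>_. 0) = 0"
  using ker_norm_cmult[of \<K> 0 "\<lambda>_. 0"] by simp

lemma ker_norm_liminf:
  assumes "\<And>n. ker_norm \<K> (u n) \<le> c"
  shows "ker_norm \<K> (\<lambda>g. liminf (\<lambda>n. u n g)) \<le> c"
  unfolding ker_norm_def
proof (rule SUP_least)
  fix K assume K: "K \<in> \<K>"
  have "(\<Sum>\<^sup>+g. K h g * liminf (\<lambda>n. u n g)) \<le> liminf (\<lambda>n. \<Sum>\<^sup>+g. K h g * u n g)" for h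
  proof -
    have "(\<Sum>\<^sup>+g. K h g * liminf (\<lambda>n. u n g)) \<le> (\<Sum>\<^sup>+g. liminf (\<lambda>n. K h g * u n g))"
      by (intro nn_integral_mono mult_liminf_le)
    also have "\<dots> \<le> liminf (\<lambda>n. \<Sum>\<^sup>+g. K h g * u n g)"
      by (rule nn_integral_liminf) auto
    finally show ?thesis .
  qed
  then have "nrm (\<lambda>h. \<Sum>\<^sup>+g. K h g * liminf (\<lambda>n. u n g))
      \<le> nrm (\<lambda>h. liminf (\<lambda>n. \<Sum>\<^sup>+g. K h g * u n g))"
    by (rule nrm_mono)
  also have "\<dots> \<le> c"
    using assms ker_norm_upper[OF K] by (intro nrm_liminf) (meson order_trans)
  finally show "nrm (\<lambda>h. \<Sum>\<^sup>+g. K h g * liminf (\<lambda>n. u n g)) \<le> c" .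
qed

text \<open>The norm of \<open>f \<mapsto> conv u f\<close> on \<open>\<ell>\<^sup>2\<close>, seen as a supremum of kernels acting on \<open>u\<close>.\<close>

definition op_norm :: "('g::group_add \<Rightarrow> ennreal) \<Rightarrow> ennreal" where
  "op_norm u = ker_norm {\<lambda>x g. f (- g + x) | f. nrm f \<le> 1} u"

lemma op_norm_eq: "op_norm u = (SUP f\<in>{f. nrm f \<le> 1}. nrm (conv u f))"
proof -
  have "{\<lambda>x g. f (- g + x) | f::'a \<Rightarrow> ennreal. nrm f \<le> 1} = (\<lambda>f x g. f (- g + x)) ` {f. nrm f \<le> 1}"
    by auto
  moreover have "conv u f = (\<lambda>x. \<Sum>\<^sup>+g. f (- g + x) * u g)" for f
    by (simp add: conv_def fun_eq_iff mult.commute)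
  ultimately show ?thesis
    by (simp add: op_norm_def ker_norm_def image_image)
qed

lemma nrm_conv_le_op_norm: 
  assumes "nrm f < \<infinity>"
  shows "nrm (conv u f) \<le> op_norm u * nrm f"
proof (cases "nrm f = 0")
  case True
  then have "f x = 0" for x
    using member_le_nrm[of f x] by simp
  then have "conv u f = (\<lambda>_. 0)" by (simp add: conv_def fun_eq_iff)
  then show ?thesis by simp
next
  case False
  define r where "r = nrm f"
  have r: "r \<noteq> 0" "r \<noteq> top" using False assms by (auto simp: r_def)
  then have rr: "r * inverse r = 1" "inverse r * r = 1"
    using ennreal_divide_self[of r] by (auto simp: divide_ennreal_def mult.commute less_top)
  have "nrm (conv u (\<lambda>x. inverse r * f x)) \<le> op_norm u"
    unfolding op_norm_eq by (rule SUP_upper) (simp add: nrm_cmult rr flip: r_def)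
  moreover have "r * (a * (inverse r * b)) = (r * inverse r) * (a * b)" for a b
    by (simp add: ac_simps)
  then have "conv u f = (\<lambda>x. r * conv u (\<lambda>x. inverse r * f x) x)"
    by (simp add: conv_def fun_eq_iff nn_integral_cmult[symmetric] rr)
  then have "nrm (conv u f) = r * nrm (conv u (\<lambda>x. inverse r * f x))"
    using nrm_cmult by metis
  ultimately show ?thesis
    using mult_left_mono[of "nrm (conv u (\<lambda>x. inverse r * f x))" "op_norm u" r]
    by (simp add: mult.commute flip: r_def)
qed

lemma op_norm_conv: 
  assumes "op_norm v < \<infinity>"
  shows "op_norm (conv u v) \<le> op_norm u * op_norm v"
  unfolding op_norm_eq[of "conv u v"]
proof (rule SUP_least)
  fix f :: "'a \<Rightarrow> ennreal" assume "f \<in> {f. nrm f \<le> 1}"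
  then have f: "nrm f \<le> 1" by simp
  have v: "nrm (conv v f) \<le> op_norm v"
    unfolding op_norm_eq using f by (intro SUP_upper) simp
  then have "nrm (conv u (conv v f)) \<le> op_norm u * nrm (conv v f)"
    using assms by (intro nrm_conv_le_op_norm) (metis order_le_less_trans)
  also have "\<dots> \<le> op_norm u * op_norm v"
    using v by (intro mult_left_mono) auto
  finally show "nrm (conv (conv u v) f) \<le> op_norm u * op_norm v"
    by (simp add: conv_assoc)
qed

definition unit_mass :: "'a \<Rightarrow> 'a \<Rightarrow> ennreal" where
  "unit_mass g x = (if x = g then 1 else 0)"

lemma nrm_unit_mass [simp]: "nrm (unit_mass g) = 1"
proof -
  have "(\<Sum>\<^sup>+x. (unit_mass g x)\<^sup>2) = 1"
    by (subst esum_single[of g]) (auto simp: unit_mass_def)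
  then show ?thesis using esqrt_power2'[of 1] by (simp add: nrm_def)
qed

lemma conv_unit_mass_left: "conv (unit_mass g) f x = f (- g + x)"
  unfolding conv_def by (subst esum_single[of g]) (auto simp: unit_mass_def)

lemma conv_unit_mass_right: "conv u (unit_mass 0) x = u x"
  unfolding conv_def by (subst esum_single[of x]) (auto simp: unit_mass_def simp flip: eq_neg_iff_add_eq_0)

lemma op_norm_unit_mass: "op_norm (unit_mass g) \<le> 1"
proof -
  have "conv (unit_mass g) f = (\<lambda>x. f (- g + x))" for f
    by (simp add: fun_eq_iff conv_unit_mass_left)
  then show ?thesis
    unfolding op_norm_eq by (auto intro!: SUP_least simp: nrm_reindex[OF bij_group_maps(1)])
qed

lemma nrm_le_op_norm: "nrm u \<le> op_norm u"
proof -
  have "nrm (conv u (unit_mass 0)) \<le> op_norm u"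
    unfolding op_norm_eq by (rule SUP_upper) simp
  then show ?thesis by (simp add: conv_unit_mass_right[abs_def])
qed

section \<open>Word metrics\<close>

lemma word_length_attained:
  assumes "finite_symmetric_generating S"
  obtains ws where "length ws = word_length S g" "set ws \<subseteq> S" "sum_list ws = g"
proof -
  have "\<exists>n. \<exists>ws. length ws = n \<and> set ws \<subseteq> S \<and> sum_list ws = g"
    using assms by (auto simp: finite_symmetric_generating_def)
  from LeastI_ex[OF this] show ?thesis
    using that by (auto simp: word_length_def)
qed

lemma word_length_le: "set ws \<subseteq> S \<Longrightarrow> word_length S (sum_list ws) \<le> length ws"
  unfolding word_length_def by (rule Least_le) auto

lemma class_length_le: "y \<in> K \<Longrightarrow> class_length S K \<le> word_length S y"
  unfolding class_length_def by (rule Least_le) auto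

lemma class_length_attained: "K \<noteq> {} \<Longrightarrow> \<exists>y\<in>K. word_length S y = class_length S K"
  unfolding class_length_def by (rule LeastI_ex) auto

lemma conj_class_conjugate: "- z + g + z \<in> conj_class g"
  unfolding conj_class_def using diff_minus_eq_add[of "- z + g" z, symmetric] by blast

lemma conj_class_self: "g \<in> conj_class g"
  using conj_class_conjugate[of 0 g] by simp

lemma conj_class_eq: "h \<in> conj_class g \<Longrightarrow> conj_class h = conj_class g"
proof -
  assume "h \<in> conj_class g"
  then obtain k where k: "h = k + g - k" by (auto simp: conj_class_def)
  have "a + h - a = (a + k) + g - (a + k)" "a + g - a = (a - k) + h - (a - k)" for a
    by (simp_all only: k diff_conv_add_uminus minus_add minus_minus add.assoc minus_add_cancel
        add_minus_cancel right_minus add_0_right)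
  then show ?thesis
    unfolding conj_class_def by blast
qed

locale word_metric =
  fixes S :: "'g::group_add set"
  assumes generating: "finite_symmetric_generating S"
begin

abbreviation len :: "'g \<Rightarrow> nat" where "len \<equiv> word_length S"
abbreviation d :: "'g \<Rightarrow> 'g \<Rightarrow> real" where "d \<equiv> word_dist S"

lemma len_0 [simp]: "len 0 = 0"
  using word_length_le[of "[]" S] by simp

lemma len_add: "len (g + h) \<le> len g + len h"
proof -
  obtain us vs where "length us = len g" "set us \<subseteq> S" "sum_list us = g"
    "length vs = len h" "set vs \<subseteq> S" "sum_list vs = h"
    using word_length_attained[OF generating] by metis
  then show ?thesis
    using word_length_le[of "us @ vs" S] by simp
qed

lemma len_uminus [simp]: "len (- g) = len g"
proof -
  have "len (- g) \<le> len g" for g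
  proof -
    obtain ws where ws: "length ws = len g" "set ws \<subseteq> S" "sum_list ws = g"
      using word_length_attained[OF generating] by metis
    have "sum_list (rev (map uminus ws)) = - sum_list ws"
      by (induction ws) (simp_all add: minus_add del: add_uminus_conv_diff)
    moreover have "set (rev (map uminus ws)) \<subseteq> S"
      using ws generating by (auto simp: finite_symmetric_generating_def)
    ultimately show ?thesis
      using word_length_le[of "rev (map uminus ws)" S] ws by simp
  qed
  from this[of g] this[of "- g"] show ?thesis by simp
qed

lemma finite_len_ball: "finite {g. len g \<le> n}"
proof -
  have "{g. len g \<le> n} \<subseteq> sum_list ` {ws. set ws \<subseteq> S \<and> length ws \<le> n}"
  proof
    fix g assume "g \<in> {g. len g \<le> n}"
    moreover obtain ws where "length ws = len g" "set ws \<subseteq> S" "sum_list ws = g"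
      using word_length_attained[OF generating] by metis
    ultimately show "g \<in> sum_list ` {ws. set ws \<subseteq> S \<and> length ws \<le> n}"
      by auto
  qed
  moreover have "finite S" using generating by (simp add: finite_symmetric_generating_def)
  ultimately show ?thesis
    by (rule finite_subset[OF _ finite_imageI[OF finite_lists_length_le]])
qed

lemma d_0 [simp]: "d 0 g = len g" "d g 0 = len g"
  by (simp_all add: word_dist_def)

lemma d_self [simp]: "d x x = 0"
  by (simp add: word_dist_def)

lemma d_commute: "d x y = d y x"
  using len_uminus[of "- x + y"] by (simp add: word_dist_def minus_add)

lemma d_nonneg [simp]: "0 \<le> d x y"
  by (simp add: word_dist_def)

lemma d_triangle: "d x z \<le> d x y + d y z"
proof -
  have "len ((- x + y) + (- y + z)) \<le> len (- x + y) + len (- y + z)"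
    by (rule len_add)
  then show ?thesis by (simp add: word_dist_def add.assoc del: add_uminus_conv_diff)
qed

lemma d_translate [simp]: "d (a + x) (a + y) = d x y"
  by (simp add: word_dist_def minus_add add.assoc del: add_uminus_conv_diff)

lemma geodesic_point:
  assumes "real i \<le> d x y"
  obtains p where "d x p = i" "d p y = d x y - i"
proof -
  obtain ws where ws: "length ws = len (- x + y)" "set ws \<subseteq> S" "sum_list ws = - x + y"
    using word_length_attained[OF generating] by metis
  define p where "p = x + sum_list (take i ws)"
  have i: "i \<le> length ws" using assms ws by (simp add: word_dist_def)
  have "sum_list ws = sum_list (take i ws) + sum_list (drop i ws)"
    by (metis append_take_drop_id sum_list_append)
  then have y: "- p + y = sum_list (drop i ws)"
    using ws(3) by (simp add: p_def minus_add add.assoc del: add_uminus_conv_diff)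
  have "d x p \<le> i"
    using word_length_le[of "take i ws" S] ws(2) set_take_subset[of i ws] i
    by (simp add: word_dist_def p_def)
  moreover have "len (sum_list (drop i ws)) \<le> length ws - i"
    using word_length_le[of "drop i ws" S] ws(2) set_drop_subset[of i ws] by auto
  then have "d p y \<le> d x y - i"
    using i ws(1) unfolding word_dist_def y by linarith
  ultimately show ?thesis
    using d_triangle[of x y p] by (intro that[of p]) linarith+
qed

text \<open>The points that lie on a path from the neutral element to \<open>g\<close> with a detour of at most
  \<open>C\<close>.\<close>

definition between :: "nat \<Rightarrow> 'g \<Rightarrow> 'g set" where
  "between C g = {x. len x + len (- x + g) \<le> len g + C}"

lemma between_iff: "x \<in> between C g \<longleftrightarrow> d 0 x + d x g \<le> d 0 g + C"
  by (auto simp: between_def word_dist_def)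

lemma between_translate_iff: "- y + x \<in> between C (- y + z) \<longleftrightarrow> d y x + d x z \<le> d y z + C"
proof -
  have "d y x = d 0 (- y + x)" "d x z = d (- y + x) (- y + z)" "d y z = d 0 (- y + z)"
    by (simp_all add: word_dist_def minus_add add.assoc del: add_uminus_conv_diff)
  then show ?thesis by (simp only: between_iff)
qed

lemma finite_between: "finite (between C g)"
  by (rule finite_subset[OF _ finite_len_ball[of "len g + C"]]) (auto simp: between_def)

end

lemma word_length_change_generators:
  fixes S S' :: "'g::group_add set"
  assumes "finite_symmetric_generating S" "finite_symmetric_generating S'"
  shows "\<exists>c. \<forall>g. word_length S' g \<le> c * word_length S g"
proof -
  interpret S': word_metric S' by standard fact
  define c where "c = Max (insert 0 (word_length S' ` S))"
  have "finite S" using assms(1) by (simp add: finite_symmetric_generating_def)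
  then have c: "word_length S' s \<le> c" if "s \<in> S" for s
    using that by (simp add: c_def)
  have "word_length S' (sum_list ws) \<le> c * length ws" if "set ws \<subseteq> S" for ws
    using that
  proof (induction ws)
    case (Cons s ws)
    then show ?case
      using S'.len_add[of s "sum_list ws"] c[of s] by simp
  qed simp
  then have "word_length S' g \<le> c * word_length S g" for g
    using word_length_attained[OF assms(1), of g] by metis
  then show ?thesis by blast
qed

section \<open>Geometry of hyperbolic groups\<close>

lemma nat_half_bounds:
  assumes "0 \<le> (y::real)"
  obtains i :: nat where "2 * real i \<le> y" "y \<le> 2 * real i + 2"
proof
  show "2 * real (nat \<lfloor>y / 2\<rfloor>) \<le> y" "y \<le> 2 * real (nat \<lfloor>y / 2\<rfloor>) + 2"
    using assms by linarith+
qed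

locale hyperbolic_word_metric = word_metric S for S :: "'g::group_add set" +
  fixes \<delta> :: real
  assumes hyperbolic: "gromov_product S w x z \<ge>
    min (gromov_product S w x y) (gromov_product S w y z) - \<delta>"
begin

lemma \<delta>_nonneg: "0 \<le> \<delta>"
  using hyperbolic[of 0 0 0 0] by simp

text \<open>The hyperbolicity condition in its symmetric form: among the three sums of distances of
  opposite pairs in a quadrilateral, the two largest differ by at most \<open>2 * \<delta>\<close>.\<close>

lemma four_point: "d x z + d y w \<le> max (d x y + d z w) (d y z + d x w) + 2 * \<delta>"
  using hyperbolic[of w x y z] unfolding gromov_product_def
  by (simp add: min_def max_def field_simps split: if_splits)

text \<open>Two almost geodesic paths with the same end points fellow travel: compare the
  quadrilateral \<open>p, x, q, y\<close>.\<close>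

lemma near_same_position:
  assumes "d x p + d p y \<le> d x y + C" "d x q + d q y \<le> d x y + C" "\<bar>d x p - d x q\<bar> \<le> C"
  shows "d p q \<le> 2 * C + 2 * \<delta>"
  using four_point[of p q x y] assms by (simp add: d_commute[of _ x] max_def split: if_splits)

lemma near_geodesic_point:
  assumes "d x p + d p y \<le> d x y + C"
  obtains q where "d x q + d q y = d x y" "d p q \<le> 2 * C + 2 * \<delta>"
proof -
  define i where "i = min (word_length S (- x + p)) (word_length S (- x + y))"
  have i: "real i = min (d x p) (d x y)" by (simp add: i_def word_dist_def)
  obtain q where q: "d x q = i" "d q y = d x y - i"
    by (rule geodesic_point[of i x y]) (simp_all add: i)
  have "0 \<le> C" using d_triangle[of x y p] assms by linarith
  moreover have "\<bar>d x p - d x q\<bar> \<le> C"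
    using assms d_nonneg[of p y] d_triangle[of x y p] unfolding q(1) i
    using \<open>0 \<le> C\<close> by linarith
  ultimately show ?thesis
    using near_same_position[of x p y C q] assms q by (intro that[of q]) auto
qed

text \<open>Thin triangles. By the four point condition \<open>x\<close> lies almost between \<open>0\<close> and \<open>g\<close> or
  almost between \<open>g\<close> and \<open>g + h\<close>; a bounded correction \<open>r\<close> moves it onto a geodesic, which
  brings the detour back to the given constant \<open>C\<close>.\<close>

lemma between_product:
  obtains R where "\<And>g h x. x \<in> between C (g + h) \<Longrightarrow>
    \<exists>r. len r \<le> R \<and> (x + r \<in> between C g \<or> - g + x + r \<in> between C h)"
proof
  define R where "R = nat \<lceil>2 * (C + 2 * \<delta>) + 2 * \<delta>\<rceil>"
  fix g h x assume "x \<in> between C (g + h)"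
  then have x: "d 0 x + d x (g + h) \<le> d 0 (g + h) + C"
    by (simp add: between_iff)
  have R: "len (- x + q) \<le> R" if "d x q \<le> 2 * (C + 2 * \<delta>) + 2 * \<delta>" for q
    using that by (simp add: R_def word_dist_def) linarith
  consider "d 0 x + d x g \<le> d 0 g + (C + 2 * \<delta>)"
    | "d g x + d x (g + h) \<le> d g (g + h) + (C + 2 * \<delta>)"
    using four_point[of x g 0 "g + h"] x d_commute[of x g] d_commute[of x 0]
    unfolding max_def by (auto simp del: d_0 split: if_splits)
  then show "\<exists>r. len r \<le> R \<and> (x + r \<in> between C g \<or> - g + x + r \<in> between C h)"
  proof cases
    case 1
    then obtain q where "d 0 q + d q g = d 0 g" "d x q \<le> 2 * (C + 2 * \<delta>) + 2 * \<delta>"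
      using near_geodesic_point by metis
    then show ?thesis
      using R[of q] by (intro exI[of _ "- x + q"]) (simp add: between_iff del: d_0)
  next
    case 2
    then obtain q where q: "d g q + d q (g + h) = d g (g + h)" "d x q \<le> 2 * (C + 2 * \<delta>) + 2 * \<delta>"
      using near_geodesic_point by metis
    have "- g + q \<in> between C (- g + (g + h))"
      unfolding between_translate_iff using q by simp
    then show ?thesis
      using R[of q] q by (intro exI[of _ "- x + q"]) (simp add: add.assoc[symmetric])
  qed
qed

text \<open>The center is the point on a geodesic from \<open>0\<close> to \<open>g\<close> whose distance from \<open>0\<close> is the
  Gromov product of \<open>g\<close> and \<open>x\<close>.\<close>

lemma triangle_center:
  obtains C where "\<And>g x. \<exists>p. p \<in> between C g \<and> p \<in> between C x \<and> - g + p \<in> between C (- g + x)"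
proof
  define C where "C = nat \<lceil>2 * \<delta> + 2\<rceil>"
  have C: "2 * \<delta> + 2 \<le> C" by (simp add: C_def) linarith
  fix g x
  have "0 \<le> d 0 g + d 0 x - d g x"
    using d_triangle[of g x 0] d_commute[of g 0] by linarith
  then obtain i :: nat where i: "2 * real i \<le> d 0 g + d 0 x - d g x"
      "d 0 g + d 0 x - d g x \<le> 2 * real i + 2"
    by (rule nat_half_bounds)
  then have "real i \<le> d 0 g" using d_triangle[of 0 x g] by linarith
  then obtain p where p: "d 0 p = i" "d p g = d 0 g - i"
    using geodesic_point by metis
  have "d p x + d 0 g \<le> max (d 0 p + d x g) (d 0 x + d p g) + 2 * \<delta>"
    using four_point[of p x 0 g] by (simp add: d_commute)
  then have px: "d p x \<le> d 0 x - i + 2 * \<delta>"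
    using p i by (simp add: d_commute[of x g] max_def del: d_0 split: if_splits)
  have "p \<in> between C g" "p \<in> between C x"
    using p px C \<delta>_nonneg unfolding between_iff by linarith+
  moreover have "- g + p \<in> between C (- g + x)"
    unfolding between_translate_iff using p px C i \<delta>_nonneg d_commute[of g p] by linarith
  ultimately show "\<exists>p. p \<in> between C g \<and> p \<in> between C x \<and> - g + p \<in> between C (- g + x)"
    by blast
qed

text \<open>At each distance from \<open>0\<close> there are boundedly many points of \<open>between C g\<close>, uniformly in
  \<open>g\<close>, because any two of them are close. The sum is dominated by a geometric series.\<close>

lemma between_weighted_count:
  fixes t :: real
  assumes "0 < t"
  obtains c where "c < \<infinity>"
    "\<And>g. (\<Sum>\<^sup>+x. indicator (between C g) x * ennreal (exp (- t * len x))) \<le> c"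
proof -
  define B where "B = {g. real (len g) \<le> 2 * C + 2 * \<delta>}"
  have "B \<subseteq> {g. len g \<le> nat \<lceil>2 * C + 2 * \<delta>\<rceil>}" by (auto simp: B_def) linarith
  then have finB: "finite B" by (rule finite_subset[OF _ finite_len_ball])
  have card: "card {x \<in> between C g. len x = i} \<le> card B" for g i
  proof (cases "{x \<in> between C g. len x = i} = {}")
    case False
    then obtain x0 where x0: "x0 \<in> between C g" "len x0 = i" by auto
    have "{x \<in> between C g. len x = i} \<subseteq> (\<lambda>r. x0 + r) ` B"
    proof
      fix x assume x: "x \<in> {x \<in> between C g. len x = i}"
      have "d x0 x \<le> 2 * real C + 2 * \<delta>"
        by (rule near_same_position[of 0 _ g]) (use x x0 in \<open>auto simp: between_iff\<close>)
      then have "- x0 + x \<in> B" by (simp add: B_def word_dist_def)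
      then show "x \<in> (\<lambda>r. x0 + r) ` B" by (intro image_eqI[of _ _ "- x0 + x"]) auto
    qed
    then show ?thesis
      using surj_card_le[OF finB] by blast
  next
    case True
    then show ?thesis by (metis card.empty zero_le)
  qed
  define c where "c = of_nat (card B) * suminf (\<lambda>i. ennreal (exp (- t) ^ i))"
  have "suminf (\<lambda>i. ennreal (exp (- t) ^ i)) = ennreal (suminf (\<lambda>i. exp (- t) ^ i))"
    using assms by (intro suminf_ennreal2 summable_geometric) auto
  then have "c < \<infinity>" by (simp add: c_def ennreal_mult_less_top of_nat_less_top)
  moreover have "(\<Sum>\<^sup>+x. indicator (between C g) x * ennreal (exp (- t * len x))) \<le> c" for g
  proof -
    have "(\<Sum>\<^sup>+x. indicator (between C g) x * ennreal (exp (- t * len x)))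
        = (\<Sum>\<^sup>+x. \<Sum>\<^sup>+i. ennreal (exp (- t) ^ i) * indicator {x \<in> between C g. len x = i} x)"
    proof (rule nn_integral_cong)
      fix x
      have "(\<Sum>\<^sup>+i. ennreal (exp (- t) ^ i) * indicator {x \<in> between C g. len x = i} x)
          = ennreal (exp (- t) ^ len x) * indicator {y \<in> between C g. len y = len x} x"
        by (subst esum_single[of "len x"]) (auto simp: indicator_def)
      then show "indicator (between C g) x * ennreal (exp (- t * len x))
          = (\<Sum>\<^sup>+i. ennreal (exp (- t) ^ i) * indicator {x \<in> between C g. len x = i} x)"
        by (simp add: indicator_def exp_of_nat_mult[symmetric] mult.commute)
    qed
    also have "\<dots> = (\<Sum>\<^sup>+i. \<Sum>\<^sup>+x. ennreal (exp (- t) ^ i) * indicator {x \<in> between C g. len x = i} x)"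
      by (rule esum_swap)
    also have "\<dots> \<le> (\<Sum>\<^sup>+i. ennreal (exp (- t) ^ i) * of_nat (card B))"
    proof (rule nn_integral_mono)
      fix i
      have "finite {x \<in> between C g. len x = i}" using finite_between by simp
      then show "(\<Sum>\<^sup>+x. ennreal (exp (- t) ^ i) * indicator {x \<in> between C g. len x = i} x)
          \<le> ennreal (exp (- t) ^ i) * of_nat (card B)"
        using card[of g i] by (simp add: nn_integral_cmult mult_left_mono)
    qed
    also have "\<dots> = c"
      by (simp add: nn_integral_multc nn_integral_count_space_nat c_def mult.commute)
    finally show ?thesis .
  qed
  ultimately show ?thesis using that by blast
qed

end

section \<open>Rotating elements to short conjugates\<close>

context hyperbolic_word_metric
begin

text \<open>Displacements up to \<open>8 * \<delta>\<close> arise in \<open>between_short_conjugator\<close>; beyond \<open>5 * \<delta> + 2\<close> the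
  argument for \<open>between_long_conjugator\<close> applies.\<close>

definition short_class_bound :: nat where
  "short_class_bound = nat \<lceil>8 * \<delta>\<rceil> + 2"

lemma short_class_bound: "8 * \<delta> + 2 \<le> short_class_bound" "2 \<le> short_class_bound"
  unfolding short_class_bound_def by linarith+

definition shortest_word :: "'g set \<Rightarrow> 'g list" where
  "shortest_word K = (SOME ws. set ws \<subseteq> S \<and> sum_list ws \<in> K \<and> length ws = class_length S K)"

text \<open>If a conjugacy class contains no very short elements, an element of minimal length
  cannot be fixed in advance: along the axis of \<open>g\<close> all cyclic permutations of a shortest word occur,
  and any of them may be the one met first.\<close>

definition core :: "'g set \<Rightarrow> 'g set" where
  "core K = (if class_length S K \<le> short_class_bound then {h \<in> K. len h \<le> short_class_bound}
     else range (\<lambda>i. sum_list (rotate i (shortest_word K))))"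

lemma shortest_word:
  assumes "K \<noteq> {}"
  shows "set (shortest_word K) \<subseteq> S" "sum_list (shortest_word K) \<in> K"
    "length (shortest_word K) = class_length S K"
proof -
  obtain y where "y \<in> K" "len y = class_length S K"
    using class_length_attained[OF assms] by blast
  moreover obtain ws where "length ws = len y" "set ws \<subseteq> S" "sum_list ws = y"
    using word_length_attained[OF generating] by metis
  ultimately have "\<exists>ws. set ws \<subseteq> S \<and> sum_list ws \<in> K \<and> length ws = class_length S K"
    by auto
  from someI_ex[OF this] show "set (shortest_word K) \<subseteq> S" "sum_list (shortest_word K) \<in> K"
    "length (shortest_word K) = class_length S K"
    unfolding shortest_word_def by auto
qed

lemma sum_list_rotate_conj: "sum_list (rotate i ws) \<in> conj_class (sum_list ws)"
  for ws :: "'g list"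
proof -
  define k where "k = i mod length ws"
  define a b where "a = sum_list (take k ws)" and "b = sum_list (drop k ws)"
  have "sum_list (rotate i ws) = b + a"
    by (simp add: rotate_drop_take k_def a_def b_def)
  moreover have "sum_list ws = a + b"
    unfolding a_def b_def by (metis append_take_drop_id sum_list_append)
  ultimately show ?thesis
    using conj_class_conjugate[of a "a + b"] by (simp add: add.assoc[symmetric])
qed

lemma core_subset: "core (conj_class g) \<subseteq> conj_class g"
proof -
  have "sum_list (shortest_word (conj_class g)) \<in> conj_class g"
    using shortest_word(2)[of "conj_class g"] conj_class_self[of g] by blast
  then have "sum_list (rotate i (shortest_word (conj_class g))) \<in> conj_class g" for i
    using sum_list_rotate_conj[of i "shortest_word (conj_class g)"] by (simp add: conj_class_eq)
  then show ?thesis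
    by (auto simp: core_def)
qed

lemma card_core:
  "finite (core (conj_class g))"
  "card (core (conj_class g))
     \<le> (card {h. len h \<le> short_class_bound} + 1) * (1 + class_length S (conj_class g))"
proof -
  let ?K = "conj_class g" and ?B = "{h. len h \<le> short_class_bound}"
  have "finite (core ?K) \<and> card (core ?K) \<le> (card ?B + 1) * (1 + class_length S ?K)"
  proof (cases "class_length S ?K \<le> short_class_bound")
    case True
    then have "core ?K \<subseteq> ?B" by (auto simp: core_def)
    then have "finite (core ?K)" "card (core ?K) \<le> card ?B"
      using finite_len_ball card_mono by (auto intro: finite_subset)
    moreover have "card ?B \<le> (card ?B + 1) * (1 + class_length S ?K)" by simp
    ultimately show ?thesis by linarith
  next
    case False
    let ?w = "shortest_word ?K"
    have "?K \<noteq> {}" using conj_class_self by blast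
    then have w: "length ?w = class_length S ?K" by (rule shortest_word)
    have "core ?K \<subseteq> (\<lambda>i. sum_list (rotate i ?w)) ` {..<length ?w}"
    proof
      fix h assume "h \<in> core ?K"
      then obtain i where "h = sum_list (rotate i ?w)" using False by (auto simp: core_def)
      then have "h = sum_list (rotate (i mod length ?w) ?w)" by (simp flip: rotate_conv_mod)
      moreover have "i mod length ?w < length ?w" using False w by (intro mod_less_divisor) linarith
      ultimately show "h \<in> (\<lambda>i. sum_list (rotate i ?w)) ` {..<length ?w}" by blast
    qed
    then have "finite (core ?K)" "card (core ?K) \<le> class_length S ?K"
      using surj_card_le[of "{..<length ?w}"] w by (auto intro: finite_subset)
    then show ?thesis by (simp add: algebra_simps)
  qed
  then show "finite (core ?K)" "card (core ?K) \<le> (card ?B + 1) * (1 + class_length S ?K)"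
    by auto
qed

lemma conjugate_shift: "- (- g + z) + g + (- g + z) = - z + g + z" for g z :: 'g
  by (simp add: minus_add add.assoc del: add_uminus_conv_diff)

lemma conjugate_shift': "- (g + z) + g + (g + z) = - z + g + z" for g z :: 'g
  by (simp add: minus_add add.assoc del: add_uminus_conv_diff)

lemma displacement: "d z (g + z) = len (- z + g + z)"
  by (simp add: word_dist_def add.assoc)

text \<open>Suppose that \<open>z\<close> is far from the geodesics between \<open>0\<close> and \<open>g\<close>. Then \<open>[z, 0]\<close> and its
  translate \<open>[g + z, g]\<close> run close to each other near \<open>z\<close>. Minimality of \<open>z\<close>, applied to
  \<open>- g + z\<close> and \<open>g + z\<close>, excludes a shift along this common part, so a point \<open>s\<close> of \<open>[z, 0]\<close>
  past the first few steps is moved by at most \<open>8 * \<delta>\<close>. But \<open>s\<close> is shorter than \<open>z\<close>.\<close>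

lemma between_short_conjugator:
  assumes L: "len (- z + g + z) \<le> short_class_bound"
    and min: "\<And>z'. len (- z' + g + z') \<le> short_class_bound \<Longrightarrow> len z \<le> len z'"
  shows "z \<in> between (3 * short_class_bound) g"
proof (rule ccontr)
  \<comment> \<open>\<open>j\<close> is the distance of \<open>s\<close> from \<open>z\<close>; it has to exceed half the displacement of \<open>z\<close>.\<close>
  define j where "j = short_class_bound"
  note j = short_class_bound[folded j_def]
  define gz where "gz = g + z"
  define r q q' l where "r = d 0 z" and "q = d z g" and "q' = d 0 gz" and "l = d 0 g"
  assume "z \<notin> between (3 * short_class_bound) g"
  then have far: "l + 3 * j < r + q"
    by (simp add: between_iff r_def q_def l_def j_def)
  have r: "d g gz = r" unfolding gz_def r_def using d_translate[of g 0 z] by simp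
  have L': "d z gz \<le> j" using L unfolding gz_def displacement by (simp add: j_def)
  have "len z \<le> len (- g + z)" using L conjugate_shift by (intro min) simp
  moreover have "q = len (- g + z)" by (simp add: q_def d_commute[of z g]) (simp add: word_dist_def)
  ultimately have q: "r \<le> q" by (simp add: r_def)
  have "len z \<le> len (g + z)" using L conjugate_shift' by (intro min) simp
  then have q': "r \<le> q'" by (simp add: r_def q'_def gz_def)
  have "q \<le> r + l" using d_triangle[of z g 0] by (simp add: q_def r_def l_def)
  then have "j \<le> r" using far by linarith
  have "q \<le> r + j" using d_triangle[of z g gz] d_triangle[of z gz g] r L' d_commute[of gz g] by (simp add: q_def)
  obtain s where s: "d z s = j" "d s 0 = r - j"
    using geodesic_point[of j z 0] \<open>j \<le> r\<close> by (auto simp: r_def)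
  define gs where "gs = g + s"
  have gs: "d gz gs = j" "d gs g = r - j"
    using s d_translate[of g z s] d_translate[of g s 0] by (simp_all add: gs_def gz_def)
  have 1: "d s g \<le> q - j + 2 * \<delta>"
    using four_point[of s g 0 z] s far j d_commute[of s z] d_commute[of g z]
    unfolding r_def[symmetric] q_def[symmetric] l_def[symmetric] 
    by (simp add: max_def split: if_splits)
  have 2: "d gs 0 \<le> q' - j + 2 * \<delta>"
    using four_point[of gs 0 g gz] r gs far q' \<open>q \<le> r + j\<close> j d_commute[of gs gz] d_commute[of g 0]
    unfolding q'_def[symmetric] l_def[symmetric]
    by (simp add: max_def split: if_splits)
  have 3: "d gs z \<le> j + 4 * \<delta>"
    using four_point[of gs z gz 0] \<delta>_nonneg 2 gs q' L' j d_commute[of gs gz] d_commute[of gz 0] d_commute[of z 0] d_commute[of gz z]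
    unfolding r_def[symmetric] q'_def[symmetric]
    by (simp add: max_def split: if_splits)
  have "d s gs \<le> 8 * \<delta>"
    using four_point[of s gs z g] \<delta>_nonneg 1 3 s gs q j d_commute[of s z] d_commute[of gs z]
    unfolding q_def[symmetric]
    by (simp add: max_def split: if_splits)
  then have "len (- s + g + s) \<le> short_class_bound"
    using j unfolding gs_def displacement j_def by linarith
  then have "len z \<le> len s" by (rule min)
  then show False using s j by (simp add: r_def)
qed

text \<open>The path \<open>w\<close> with labels \<open>ws\<close> is a geodesic from \<open>z\<close> to \<open>g + z\<close>. By the minimality of \<open>z\<close> no
  point of \<open>w\<close> is closer to \<open>0\<close> than \<open>z\<close>, and none is closer to \<open>g\<close> than \<open>g + z\<close>. So \<open>w\<close>
  makes almost no angle backwards with \<open>[0, z]\<close> at \<open>z\<close> nor with \<open>[g + z, g]\<close> at \<open>g + z\<close>. As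
  \<open>w\<close> is long, the broken path from \<open>0\<close> over \<open>z\<close> and \<open>g + z\<close> to \<open>g\<close> is almost geodesic.\<close>

lemma between_long_conjugator:
  assumes ws: "set ws \<subseteq> S" "sum_list ws = - z + g + z"
    and L: "length ws = len (- z + g + z)" "short_class_bound < length ws"
    and min: "\<And>k. k \<le> length ws \<Longrightarrow> len z \<le> len (z + sum_list (take k ws))"
      "\<And>k. k \<le> length ws \<Longrightarrow> len z \<le> len (- g + (z + sum_list (take k ws)))"
  shows "z \<in> between (3 * short_class_bound) g"
proof -
  define L where "L = length ws"
  define gz where "gz = g + z"
  define w where "w k = z + sum_list (take k ws)" for k
  define r q q' l where "r = d 0 z" and "q = d z g" and "q' = d 0 gz" and "l = d 0 g"
  note j = short_class_bound
  have r: "d g gz = r" unfolding gz_def r_def using d_translate[of g 0 z] by simp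
  have zgz: "d z gz = L" unfolding gz_def displacement L_def using L by simp
  have r0: "d z 0 = r" by (simp add: r_def)
  have far0: "r \<le> d 0 (w k)" and farg: "r \<le> d g (w k)" if "k \<le> L" for k
    using min[of k] that by (simp_all add: r_def w_def L_def word_dist_def)
  have wk: "d z (w k) \<le> k" "d (w k) gz \<le> L - k" if "k \<le> L" for k
  proof -
    have len: "len (sum_list (take k ws)) \<le> k" "len (sum_list (drop k ws)) \<le> L - k"
      using word_length_le[of "take k ws" S] word_length_le[of "drop k ws" S] ws(1)
        set_take_subset[of k ws] set_drop_subset[of k ws] that by (auto simp: L_def)
    have "- z + w k = sum_list (take k ws)" by (simp add: w_def add.assoc[symmetric])
    then show "d z (w k) \<le> k" using len(1) by (simp add: word_dist_def)
    have "sum_list (take k ws) + sum_list (drop k ws) = - z + g + z"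
      unfolding ws(2)[symmetric] by (metis append_take_drop_id sum_list_append)
    then have "gz = w k + sum_list (drop k ws)"
      unfolding gz_def w_def add.assoc by (simp add: add.assoc[symmetric])
    then have "- w k + gz = sum_list (drop k ws)" by (simp add: add.assoc[symmetric])
    then show "d (w k) gz \<le> L - k" using len(2) that by (simp add: word_dist_def of_nat_diff)
  qed
  have "q' \<le> r + L" "r \<le> q' + L"
    using d_triangle[of 0 gz z] d_triangle[of 0 z gz] zgz d_commute[of gz z]
    by (simp_all add: q'_def r_def)
  \<comment> \<open>The Gromov product of \<open>0\<close> and \<open>g + z\<close> at \<open>z\<close> is small: test the point of \<open>w\<close> at
    about this distance from \<open>z\<close>.\<close>
  have "0 \<le> r + L - q'" using \<open>q' \<le> r + L\<close> by simp
  then obtain i :: nat where i: "2 * real i \<le> r + L - q'" "r + L - q' \<le> 2 * real i + 2"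
    by (rule nat_half_bounds)
  then have "real i \<le> real L" using \<open>r \<le> q' + L\<close> by linarith
  then have "i \<le> L" by simp
  have "d 0 (w i) + d z gz \<le> max (d 0 z + d (w i) gz) (d z (w i) + d 0 gz) + 2 * \<delta>"
    using four_point[of 0 "w i" z gz] by (simp add: d_commute)
  then have 1: "r + L \<le> q' + 4 * \<delta> + 2"
    using i far0[OF \<open>i \<le> L\<close>] wk[OF \<open>i \<le> L\<close>] zgz of_nat_diff[OF \<open>i \<le> L\<close>, where ?'a=real]
    unfolding r_def[symmetric] q'_def[symmetric] max_def by (simp split: if_splits)
  have "q \<le> r + L" "r \<le> q + L"
    using d_triangle[of z g gz] d_triangle[of gz g z] zgz r d_commute[of gz z] d_commute[of gz g]
    by (simp_all add: q_def)
  \<comment> \<open>The same at the other end \<open>g + z\<close>.\<close>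
  have "0 \<le> r + L - q" using \<open>q \<le> r + L\<close> by simp
  then obtain i :: nat where i: "2 * real i \<le> r + L - q" "r + L - q \<le> 2 * real i + 2"
    by (rule nat_half_bounds)
  then have "real i \<le> real L" using \<open>r \<le> q + L\<close> by linarith
  then have "i \<le> L" by simp
  then have i': "L - i \<le> L" "real (L - i) = L - real i" "L - (L - i) = i" by auto
  have "d g (w (L - i)) + d z gz \<le> max (d g gz + d (w (L - i)) z) (d gz (w (L - i)) + d g z) + 2 * \<delta>"
    using four_point[of g "w (L - i)" gz z] by (simp add: d_commute)
  then have 2: "r + L \<le> q + 4 * \<delta> + 2"
    using i farg[OF i'(1)] wk[OF i'(1)] zgz r i' d_commute[of z g] d_commute[of gz "w (L - i)"]
      d_commute[of "w (L - i)" z]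
    unfolding r_def[symmetric] q_def[symmetric] max_def by (simp split: if_splits)
  have "q' + q \<le> max (2 * r) (L + l) + 2 * \<delta>"
    using four_point[of 0 gz z g] r zgz d_commute[of gz g] d_commute[of z gz]
    by (simp add: q_def q'_def r_def l_def)
  moreover have "5 * \<delta> + 2 < L" using L(2) j \<delta>_nonneg unfolding L_def by linarith
  ultimately have "r + q \<le> l + 10 * \<delta> + 4"
    using 1 2 \<open>q \<le> r + L\<close> by (simp add: max_def split: if_splits)
  then have "r + q \<le> l + 3 * short_class_bound" using j \<delta>_nonneg by linarith
  then show ?thesis
    by (simp add: between_iff r_def q_def l_def)
qed

text \<open>The point \<open>z\<close> is a shortest element conjugating \<open>g\<close> into the core. The minimality
  conditions of the two preceding lemmas hold since the competing conjugators also lead into the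
  core; for long classes this is why the core contains all rotations of the chosen word.\<close>

lemma conjugate_to_core:
  "\<exists>z. z \<in> between (3 * short_class_bound) g \<and> - z + g + z \<in> core (conj_class g)"
proof -
  let ?K = "conj_class g" and ?b = short_class_bound
  define Z where "Z = {z. - z + g + z \<in> core ?K}"
  have K: "?K \<noteq> {}" using conj_class_self by blast
  note w = shortest_word[OF K]
  have Z_ex: "\<exists>z. - z + g + z = h" if "h \<in> ?K" for h
  proof -
    obtain k where "h = k + g - k" using \<open>h \<in> ?K\<close> by (auto simp: conj_class_def)
    then have "- (- k) + g + (- k) = h" by simp
    then show ?thesis by blast
  qed
  have "core ?K \<noteq> {}"
  proof (cases "class_length S ?K \<le> ?b")
    case True
    then show ?thesis using class_length_attained[OF K, of S] by (auto simp: core_def)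
  qed (simp add: core_def)
  then obtain z0 where "z0 \<in> Z" using Z_ex core_subset unfolding Z_def by blast
  then obtain z where z: "z \<in> Z" and min: "\<And>z'. z' \<in> Z \<Longrightarrow> len z \<le> len z'"
    using exists_least_iff[of "\<lambda>n. \<exists>z\<in>Z. len z = n"] by (metis leI)
  have "z \<in> between (3 * ?b) g"
  proof (cases "class_length S ?K \<le> ?b")
    case True
    then have "z' \<in> Z \<longleftrightarrow> len (- z' + g + z') \<le> ?b" for z'
      by (simp add: Z_def core_def conj_class_conjugate)
    then show ?thesis using z min between_short_conjugator by blast
  next
    case False
    then have core: "core ?K = range (\<lambda>i. sum_list (rotate i (shortest_word ?K)))"
      by (simp add: core_def)
    obtain i where i: "- z + g + z = sum_list (rotate i (shortest_word ?K))"
      using z by (auto simp: Z_def core)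
    define ws where "ws = rotate i (shortest_word ?K)"
    have ws: "set ws \<subseteq> S" "sum_list ws = - z + g + z" "length ws = class_length S ?K"
      using w i by (simp_all add: ws_def)
    have "class_length S ?K \<le> len (- z + g + z)"
      by (rule class_length_le) (rule conj_class_conjugate)
    moreover have "len (- z + g + z) \<le> length ws" using word_length_le[of ws S] ws by simp
    ultimately have L: "length ws = len (- z + g + z)" using ws by simp
    have in_Z: "z + sum_list (take k ws) \<in> Z" if "k \<le> length ws" for k
    proof -
      define a b where "a = sum_list (take k ws)" and "b = sum_list (drop k ws)"
      have "a + b = - z + g + z"
        unfolding a_def b_def ws(2)[symmetric] by (metis append_take_drop_id sum_list_append)
      then have "- (z + a) + g + (z + a) = - a + (a + b) + a"
        by (simp add: minus_add add.assoc del: add_uminus_conv_diff)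
      also have "\<dots> = b + a" by (simp add: add.assoc[symmetric])
      also have "\<dots> = sum_list (rotate k ws)"
        using that by (cases "k = length ws") (simp_all add: a_def b_def rotate_drop_take)
      also have "\<dots> \<in> core ?K" by (simp add: core ws_def rotate_rotate)
      finally show ?thesis by (simp add: Z_def a_def)
    qed
    then have in_Z': "- g + (z + sum_list (take k ws)) \<in> Z" if "k \<le> length ws" for k
      using that by (simp only: Z_def mem_Collect_eq conjugate_shift)
    show ?thesis
      using between_long_conjugator[OF ws(1,2) L] False ws(3) min in_Z in_Z' by simp
  qed
  then show ?thesis using z by (auto simp: Z_def)
qed

end

section \<open>Weights and rapid decay\<close>

lemmas group_normalize = diff_conv_add_uminus minus_add minus_minus add.assoc minus_add_cancel
  add_minus_cancel right_minus left_minus add_0_right add_0_left minus_zero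

lemma nrm_power2_le: "(\<Sum>\<^sup>+x. (f x)\<^sup>2) \<le> c \<Longrightarrow> nrm f \<le> esqrt c"
  by (simp add: nrm_le_iff)

lemma indicator_power2: "(indicator A x :: ennreal)\<^sup>2 = indicator A x"
  by (simp add: indicator_def)

context word_metric
begin

definition weight :: "real \<Rightarrow> 'g \<Rightarrow> ennreal" where
  "weight t g = ennreal (exp (t * len g))"

lemma weight_mult: "weight s g * weight t g = weight (s + t) g"
  by (simp add: weight_def exp_add distrib_right flip: ennreal_mult)

lemma weight_0 [simp]: "weight 0 g = 1" "weight t 0 = 1"
  by (simp_all add: weight_def)

lemma weight_mono: "s \<le> t \<Longrightarrow> weight s g \<le> weight t g"
  by (simp add: weight_def ennreal_leI mult_right_mono)

lemma weight_finite [simp]: "weight t g < top" "weight t g \<noteq> top"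
  by (simp_all add: weight_def)

lemma weight_power2: "(weight t g)\<^sup>2 = weight (2 * t) g"
  by (simp add: power2_eq_square weight_mult)

lemma weight_add_le:
  assumes "0 \<le> t"
  shows "weight t (g + h) \<le> weight t g * weight t h"
proof -
  have "exp (t * len (g + h)) \<le> exp (t * len g) * exp (t * len h)"
    using assms len_add[of g h] by (simp flip: exp_add distrib_left) (simp add: mult_left_mono)
  then show ?thesis by (simp add: weight_def ennreal_leI flip: ennreal_mult)
qed

lemma weight_cancel: "weight (- t) g * (weight t g * a) = a"
  by (simp add: mult.assoc[symmetric] weight_mult)

lemma weighted_conv_le:
  assumes "0 \<le> t"
  shows "weight t x * conv u v x \<le> conv (\<lambda>g. weight t g * u g) (\<lambda>g. weight t g * v g) x"
proof -
  have "weight t x * (u g * v (- g + x)) \<le> weight t g * u g * (weight t (- g + x) * v (- g + x))" for g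
    using mult_right_mono[OF weight_add_le[OF assms, of g "- g + x"], of "u g * v (- g + x)"]
    by (simp add: ac_simps)
  then show ?thesis
    unfolding conv_def by (simp add: nn_integral_cmult[symmetric] nn_integral_mono)
qed

text \<open>Passing to a smaller exponent makes the tails of a weighted function uniformly small.\<close>

lemma ker_norm_tail:
  "ker_norm \<K> (\<lambda>g. weight t g * (if len g \<le> n then 0 else u g))
    \<le> ennreal (exp (- (s - t) * n)) * ker_norm \<K> (\<lambda>g. weight s g * u g)" if "t \<le> s"
proof -
  have "weight t g * (if len g \<le> n then 0 else u g)
      \<le> ennreal (exp (- (s - t) * n)) * (weight s g * u g)" for g
  proof (cases "len g \<le> n")
    case False
    have "t * len g \<le> - (s - t) * n + s * len g"
      using that False mult_left_mono[of "real n" "real (len g)" "s - t"] by (simp add: algebra_simps)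
    then have "weight t g \<le> ennreal (exp (- (s - t) * n)) * weight s g"
      by (simp add: weight_def ennreal_leI flip: ennreal_mult exp_add)
    then show ?thesis using False by (simp add: mult_right_mono flip: mult.assoc)
  qed simp
  then show ?thesis
    unfolding ker_norm_cmult[symmetric] by (rule ker_norm_mono)
qed

end

context hyperbolic_word_metric
begin

text \<open>Write \<open>g = p + c\<close> and \<open>- g + x = - c + q\<close> where \<open>p\<close> is a center of the triangle
  \<open>0, g, x\<close>. Then \<open>conv u f x\<close> is dominated by a sum over \<open>p\<close> and \<open>c\<close>, to which the
  Cauchy-Schwarz inequality applies twice. Each element \<open>g\<close>, \<open>x\<close> and \<open>- g + x\<close> occurs for many
  centers, namely for all points near a geodesic; up to a constant the weight of \<open>g\<close> is at least
  that of \<open>p\<close> times that of \<open>c\<close>, which leaves a decaying factor for each of the three counts.\<close>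

lemma rapid_decay:
  assumes "0 < s"
  obtains c where "c < \<infinity>" "\<And>u. op_norm u \<le> c * nrm (\<lambda>g. weight s g * u g)"
proof -
  obtain C where C: "\<And>g x. \<exists>p. p \<in> between C g \<and> p \<in> between C x \<and> - g + p \<in> between C (- g + x)"
    using triangle_center by blast
  obtain c0 where c0: "c0 < \<infinity>"
    "\<And>g. (\<Sum>\<^sup>+x. indicator (between C g) x * ennreal (exp (- s * len x))) \<le> c0"
    using between_weighted_count[OF assms, of C] by blast
  have c0': "(\<Sum>\<^sup>+x. indicator (between C g) x * weight (- s) x) \<le> c0" for g
    using c0(2)[of g] by (simp add: weight_def)
  define a where "a = ennreal (exp (s * C))"
  define c where "c = a * (esqrt c0 * esqrt (c0 * c0))"
  have esqrt_finite: "x < top \<Longrightarrow> esqrt x < top" for x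
    by (simp add: esqrt_def)
  have "c < \<infinity>" using c0(1) by (simp add: c_def a_def ennreal_mult_less_top esqrt_finite)
  moreover have "op_norm u \<le> c * nrm (\<lambda>g. weight s g * u g)" for u
    unfolding op_norm_eq
  proof (rule SUP_least)
    fix f :: "'g \<Rightarrow> ennreal" assume "f \<in> {f. nrm f \<le> 1}"
    then have f: "nrm f \<le> 1" by simp
    define v where "v = (\<lambda>g. weight s g * u g)"
    define U where "U p = nrm (\<lambda>g. indicator (between C g) p * v g)" for p
    define F where "F p x = nrm (\<lambda>g. indicator (between C (- g + x)) (- g + p) *
      (weight (- s) (- g + p) * f (- g + x)))" for p x
    have split_weight: "u g \<le> a * (weight (- s) p * weight (- s) (- g + p) * v g)"
      if "p \<in> between C g" for g p
    proof -
      have "len (- p + g) = len (- g + p)" using len_uminus[of "- p + g"] by (simp add: minus_add)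
      then have "real (len p + len (- g + p)) \<le> len g + C" 
        using that by (simp add: between_def)
      then have "s * (len p + len (- g + p)) \<le> s * (len g + C)"
        using assms by (intro mult_left_mono) auto
      then have "0 \<le> s * C + (- s * len p) + (- s * len (- g + p)) + s * len g"
        by (simp add: algebra_simps)
      then have "1 \<le> exp (s * C + (- s * len p) + (- s * len (- g + p)) + s * len g)"
        by (simp only: one_le_exp_iff)
      then have "1 \<le> exp (s * C) * exp (- s * len p) * exp (- s * len (- g + p)) * exp (s * len g)"
        by (simp only: exp_add)
      then have "1 \<le> a * (weight (- s) p * weight (- s) (- g + p) * weight s g)"
        by (simp add: a_def weight_def ennreal_leI flip: ennreal_mult mult.assoc)
      then have "1 * u g \<le> a * (weight (- s) p * weight (- s) (- g + p) * weight s g) * u g"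
        by (rule mult_right_mono) simp
      then show ?thesis by (simp add: v_def mult.assoc)
    qed
    have conv_le: "conv u f x \<le> a * esqrt c0 * nrm (\<lambda>p. weight (- s / 2) p * (U p * F p x))" for x
    proof -
      let ?I = "\<lambda>g p. a * (indicator (between C x) p * weight (- s) p *
        ((indicator (between C g) p * v g) * (indicator (between C (- g + x)) (- g + p) *
          (weight (- s) (- g + p) * f (- g + x)))))"
      have "conv u f x \<le> (\<Sum>\<^sup>+g. \<Sum>\<^sup>+p. ?I g p)"
        unfolding conv_def
      proof (rule nn_integral_mono)
        fix g
        obtain p where p: "p \<in> between C g" "p \<in> between C x" "- g + p \<in> between C (- g + x)"
          using C by blast
        have "u g * f (- g + x) \<le> a * (weight (- s) p * weight (- s) (- g + p) * v g) * f (- g + x)"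
          using split_weight[OF p(1)] by (rule mult_right_mono) simp
        also have "\<dots> = ?I g p"
          using p by (simp add: ac_simps)
        also have "\<dots> \<le> (\<Sum>\<^sup>+p. ?I g p)"
          by (rule member_le_esum)
        finally show "u g * f (- g + x) \<le> (\<Sum>\<^sup>+p. ?I g p)" .
      qed
      also have "\<dots> = (\<Sum>\<^sup>+p. a * (indicator (between C x) p * weight (- s) p *
          (\<Sum>\<^sup>+g. (indicator (between C g) p * v g) * (indicator (between C (- g + x)) (- g + p) *
            (weight (- s) (- g + p) * f (- g + x))))))"
        by (subst esum_swap) (simp add: nn_integral_cmult)
      also have "\<dots> \<le> (\<Sum>\<^sup>+p. a * (indicator (between C x) p * weight (- s) p * (U p * F p x)))"
        unfolding U_def F_def by (intro nn_integral_mono mult_left_mono esum_mult_le_nrm) auto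
      also have "\<dots> = a * (\<Sum>\<^sup>+p. (indicator (between C x) p * weight (- s / 2) p) *
          (weight (- s / 2) p * (U p * F p x)))"
      proof -
        have "weight (- s) p = weight (- s / 2) p * weight (- s / 2) p" for p
          by (simp add: weight_mult)
        then show ?thesis by (simp add: nn_integral_cmult mult.assoc)
      qed
      also have "\<dots> \<le> a * (nrm (\<lambda>p. indicator (between C x) p * weight (- s / 2) p) *
          nrm (\<lambda>p. weight (- s / 2) p * (U p * F p x)))"
        by (intro mult_left_mono esum_mult_le_nrm) auto
      also have "\<dots> \<le> a * (esqrt c0 * nrm (\<lambda>p. weight (- s / 2) p * (U p * F p x)))"
      proof -
        have "nrm (\<lambda>p. indicator (between C x) p * weight (- s / 2) p) \<le> esqrt c0"
          by (rule nrm_power2_le)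
             (simp add: power_mult_distrib weight_power2 indicator_power2 c0')
        then show ?thesis by (intro mult_left_mono mult_right_mono) auto
      qed
      finally show ?thesis by (simp add: mult.assoc)
    qed
    have F2: "(\<Sum>\<^sup>+x. (F p x)\<^sup>2) \<le> c0" for p
    proof -
      let ?k = "\<lambda>c y. indicator (between C y) c * weight (- (2 * s)) c"
      have "(\<Sum>\<^sup>+x. (F p x)\<^sup>2) = (\<Sum>\<^sup>+x. \<Sum>\<^sup>+g. ?k (- g + p) (- g + x) * (f (- g + x))\<^sup>2)"
        by (simp add: F_def nrm_power2 power_mult_distrib indicator_power2 weight_power2 mult.assoc)
      also have "\<dots> = (\<Sum>\<^sup>+g. \<Sum>\<^sup>+x. ?k (- g + p) (- g + x) * (f (- g + x))\<^sup>2)"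
        by (rule esum_swap)
      also have "\<dots> = (\<Sum>\<^sup>+g. \<Sum>\<^sup>+y. ?k (- g + p) y * (f y)\<^sup>2)"
        by (rule nn_integral_cong) (rule esum_group_reindex(1)[of "\<lambda>y. ?k (- _ + p) y * (f y)\<^sup>2"])
      also have "\<dots> = (\<Sum>\<^sup>+y. \<Sum>\<^sup>+g. ?k (- g + p) y * (f y)\<^sup>2)"
        by (rule esum_swap)
      also have "\<dots> = (\<Sum>\<^sup>+y. (\<Sum>\<^sup>+g. ?k g y) * (f y)\<^sup>2)"
        using esum_group_reindex(4)[of "\<lambda>g. ?k (g + p) _"] esum_group_reindex(2)[of "\<lambda>g. ?k g _" p]
        by (simp add: nn_integral_multc)
      also have "\<dots> \<le> (\<Sum>\<^sup>+y. c0 * (f y)\<^sup>2)"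
      proof (intro nn_integral_mono mult_right_mono)
        fix y
        have "(\<Sum>\<^sup>+g. ?k g y) \<le> (\<Sum>\<^sup>+g. indicator (between C y) g * weight (- s) g)"
          using assms by (intro nn_integral_mono mult_left_mono weight_mono) auto
        also have "\<dots> \<le> c0" by (rule c0')
        finally show "(\<Sum>\<^sup>+g. ?k g y) \<le> c0" .
      qed simp
      also have "\<dots> = c0 * (nrm f)\<^sup>2" by (simp add: nn_integral_cmult nrm_power2)
      also have "\<dots> \<le> c0 * 1\<^sup>2" using f by (intro mult_left_mono ennreal_power2_mono) auto
      finally show ?thesis by simp
    qed
    have U2: "(\<Sum>\<^sup>+p. weight (- s) p * (U p)\<^sup>2) \<le> c0 * (nrm v)\<^sup>2"
    proof -
      have "(\<Sum>\<^sup>+p. weight (- s) p * (U p)\<^sup>2)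
          = (\<Sum>\<^sup>+p. \<Sum>\<^sup>+g. (indicator (between C g) p * weight (- s) p) * (v g)\<^sup>2)"
        by (simp add: U_def nrm_power2 power_mult_distrib indicator_power2 nn_integral_cmult[symmetric]
            ac_simps)
      also have "\<dots> = (\<Sum>\<^sup>+g. (\<Sum>\<^sup>+p. indicator (between C g) p * weight (- s) p) * (v g)\<^sup>2)"
        by (subst esum_swap) (simp add: nn_integral_multc)
      also have "\<dots> \<le> (\<Sum>\<^sup>+g. c0 * (v g)\<^sup>2)"
        by (intro nn_integral_mono mult_right_mono c0') auto
      finally show ?thesis by (simp add: nn_integral_cmult nrm_power2)
    qed
    have "(\<Sum>\<^sup>+x. (nrm (\<lambda>p. weight (- s / 2) p * (U p * F p x)))\<^sup>2)
        = (\<Sum>\<^sup>+x. \<Sum>\<^sup>+p. weight (- s) p * (U p)\<^sup>2 * (F p x)\<^sup>2)"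
      by (simp add: nrm_power2 power_mult_distrib weight_power2 mult.assoc)
    also have "\<dots> = (\<Sum>\<^sup>+p. weight (- s) p * (U p)\<^sup>2 * (\<Sum>\<^sup>+x. (F p x)\<^sup>2))"
      by (subst esum_swap) (simp add: nn_integral_cmult)
    also have "\<dots> \<le> (\<Sum>\<^sup>+p. weight (- s) p * (U p)\<^sup>2 * c0)"
      by (intro nn_integral_mono mult_left_mono F2) auto
    also have "\<dots> = (\<Sum>\<^sup>+p. weight (- s) p * (U p)\<^sup>2) * c0"
      by (simp add: nn_integral_multc)
    also have "\<dots> \<le> c0 * (nrm v)\<^sup>2 * c0"
      by (intro mult_right_mono U2) auto
    also have "\<dots> = (esqrt (c0 * c0) * nrm v)\<^sup>2"
      by (simp add: power_mult_distrib ac_simps)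
    finally have "nrm (\<lambda>x. nrm (\<lambda>p. weight (- s / 2) p * (U p * F p x))) \<le> esqrt (c0 * c0) * nrm v"
      by (simp add: nrm_le_iff)
    then have "a * esqrt c0 * nrm (\<lambda>x. nrm (\<lambda>p. weight (- s / 2) p * (U p * F p x)))
        \<le> a * esqrt c0 * (esqrt (c0 * c0) * nrm v)"
      by (rule mult_left_mono) simp
    moreover have "nrm (conv u f)
        \<le> a * esqrt c0 * nrm (\<lambda>x. nrm (\<lambda>p. weight (- s / 2) p * (U p * F p x)))"
      by (rule order_trans[OF nrm_mono[OF conv_le]]) (simp only: nrm_cmult order.refl)
    ultimately show "nrm (conv u f) \<le> c * nrm (\<lambda>g. weight s g * u g)"
      by (simp add: c_def v_def mult.assoc)
  qed
  ultimately show ?thesis using that by blast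
qed

end

section \<open>The splitting norm\<close>

lemma ker_norm_finite_support:
  assumes "finite F" "\<And>g. g \<notin> F \<Longrightarrow> u g = 0" "\<And>g. u g < \<infinity>"
    and "\<And>g. ker_norm \<K> (unit_mass g) < \<infinity>"
  shows "ker_norm \<K> u < \<infinity>"
proof -
  have "ker_norm \<K> (\<lambda>x. \<Sum>g\<in>F. u g * unit_mass g x) < \<infinity>"
    using assms(1)
  proof (induction F rule: finite_induct)
    case (insert g F)
    have "ker_norm \<K> (\<lambda>x. \<Sum>g\<in>insert g F. u g * unit_mass g x)
        \<le> u g * ker_norm \<K> (unit_mass g) + ker_norm \<K> (\<lambda>x. \<Sum>g\<in>F. u g * unit_mass g x)"
      using insert.hyps ker_norm_add[of \<K> "\<lambda>x. u g * unit_mass g x"] by (simp add: ker_norm_cmult)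
    also have "\<dots> < \<infinity>"
      using insert.IH assms(3)[of g] assms(4)[of g] by (simp add: ennreal_mult_less_top)
    finally show ?case .
  qed simp
  moreover have "(\<Sum>g\<in>F. u g * unit_mass g x) = u x" for x
    using assms(1,2) by (simp add: unit_mass_def if_distrib[of "\<lambda>a. _ * a"] sum.delta' cong: if_cong)
  ultimately show ?thesis by simp
qed

lemma op_norm_finite_support:
  assumes "finite F" "\<And>g. g \<notin> F \<Longrightarrow> u g = 0" "\<And>g. u g < \<infinity>"
  shows "op_norm u < \<infinity>"
  unfolding op_norm_def
proof (rule ker_norm_finite_support[OF assms])
  fix g :: 'a
  show "ker_norm {\<lambda>x g. f (- g + x) |f. nrm f \<le> 1} (unit_mass g) < \<infinity>"
    using op_norm_unit_mass[of g] unfolding op_norm_def by (rule le_less_trans) simp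
qed

context word_metric
begin

text \<open>A splitting \<open>g = x + y\<close> contributes to \<open>h = y + k + x\<close> the value of \<open>\<phi>\<close> at
  \<open>k = - y + h - x = - g + x + h - x\<close>. The resulting norm is bounded for multiplication by \<open>u\<close> from the
  left of \<open>x\<close> and by \<open>v\<close> from the right of \<open>y\<close>, since this replaces \<open>\<phi>\<close> by its convolution with
  \<open>u\<close> and \<open>v\<close>. Conjugation of \<open>h\<close> leaves it unchanged.\<close>

definition split_kernel :: "nat \<Rightarrow> ('g \<Rightarrow> ennreal) \<Rightarrow> 'g \<Rightarrow> 'g \<Rightarrow> ennreal" where
  "split_kernel C \<phi> h g = (\<Sum>\<^sup>+x. indicator (between C g) x * \<phi> (- g + x + h - x))"

definition splitting :: "nat \<Rightarrow> ('g \<Rightarrow> ennreal) \<Rightarrow> ('g \<Rightarrow> ennreal) \<Rightarrow> 'g \<Rightarrow> ennreal" where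
  "splitting C \<phi> u h = (\<Sum>\<^sup>+g. split_kernel C \<phi> h g * u g)"

definition split_norm :: "nat \<Rightarrow> ('g \<Rightarrow> ennreal) \<Rightarrow> ennreal" where
  "split_norm C = ker_norm {split_kernel C \<phi> | \<phi>. op_norm \<phi> \<le> 1}"

lemma split_kernel_cmult: "split_kernel C (\<lambda>x. c * \<phi> x) h g = c * split_kernel C \<phi> h g"
  by (simp add: split_kernel_def nn_integral_cmult[symmetric] mult.left_commute)

lemma nrm_splitting_le_1: "op_norm \<phi> \<le> 1 \<Longrightarrow> nrm (splitting C \<phi> u) \<le> split_norm C u"
  unfolding split_norm_def splitting_def[abs_def] by (rule ker_norm_upper) auto

lemma nrm_splitting_le:
  assumes "op_norm \<phi> < \<infinity>"
  shows "nrm (splitting C \<phi> u) \<le> op_norm \<phi> * split_norm C u"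
proof (cases "op_norm \<phi> = 0")
  case True
  then have "\<phi> x = 0" for x
    using member_le_nrm[of \<phi> x] nrm_le_op_norm[of \<phi>] by simp
  then have "splitting C \<phi> u = (\<lambda>_. 0)"
    by (simp add: splitting_def split_kernel_def fun_eq_iff)
  then show ?thesis by simp
next
  case False
  define r where "r = op_norm \<phi>"
  have r: "r \<noteq> 0" "r \<noteq> top" using False assms by (auto simp: r_def)
  then have rr: "r * inverse r = 1" "inverse r * r = 1"
    using ennreal_divide_self[of r] by (auto simp: divide_ennreal_def mult.commute less_top)
  have "op_norm (\<lambda>x. inverse r * \<phi> x) = inverse r * r"
    unfolding op_norm_def ker_norm_cmult r_def ..
  then have "nrm (splitting C (\<lambda>x. inverse r * \<phi> x) u) \<le> split_norm C u"
    by (intro nrm_splitting_le_1) (simp add: rr)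
  then have "r * nrm (splitting C (\<lambda>x. inverse r * \<phi> x) u) \<le> r * split_norm C u"
    by (rule mult_left_mono) simp
  moreover have "splitting C \<phi> u = (\<lambda>h. r * splitting C (\<lambda>x. inverse r * \<phi> x) u h)"
    by (simp add: splitting_def split_kernel_cmult fun_eq_iff nn_integral_cmult[symmetric]
        mult.assoc[symmetric] rr)
  ultimately show ?thesis
    using nrm_cmult[of r "splitting C (\<lambda>x. inverse r * \<phi> x) u"] by (simp add: r_def)
qed

lemma split_norm_finite_support:
  assumes "finite F" "\<And>g. g \<notin> F \<Longrightarrow> u g = 0" "\<And>g. u g < \<infinity>"
  shows "split_norm C u < \<infinity>"
  unfolding split_norm_def
proof (rule ker_norm_finite_support[OF assms])
  fix g :: 'g
  have "nrm (splitting C \<phi> (unit_mass g)) \<le> of_nat (card (between C g))" if "op_norm \<phi> \<le> 1" for \<phi>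
  proof -
    have "splitting C \<phi> (unit_mass g) h = split_kernel C \<phi> h g" for h
      unfolding splitting_def by (subst esum_single[of g]) (auto simp: unit_mass_def)
    moreover have "split_kernel C \<phi> h g = (\<Sum>x\<in>between C g. \<phi> (- g + x + h - x))" for h
      unfolding split_kernel_def
      by (subst esum_finite_support[OF finite_between[of C g]]) auto
    ultimately have "nrm (splitting C \<phi> (unit_mass g))
        = nrm (\<lambda>h. \<Sum>x\<in>between C g. \<phi> (- g + x + h - x))"
      by presburger
    also have "\<dots> \<le> (\<Sum>x\<in>between C g. nrm (\<lambda>h. \<phi> (- g + x + h - x)))"
      by (rule nrm_sum[OF finite_between])
    also have "\<dots> = (\<Sum>x\<in>between C g. nrm \<phi>)"
    proof (rule sum.cong[OF refl])
      fix x
      have "bij (\<lambda>h. - g + x + h - x)"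
        using bij_comp[OF bij_group_maps(1)[of "- g + x"] bij_group_maps(2)[of "- x"]]
        by (simp add: comp_def)
      then show "nrm (\<lambda>h. \<phi> (- g + x + h - x)) = nrm \<phi>" by (rule nrm_reindex)
    qed
    also have "\<dots> \<le> (\<Sum>x\<in>between C g. 1)"
      using nrm_le_op_norm[of \<phi>] that by (intro sum_mono) (rule order_trans)
    finally show ?thesis by simp
  qed
  then have "ker_norm {split_kernel C \<phi> | \<phi>. op_norm \<phi> \<le> 1} (unit_mass g)
      \<le> of_nat (card (between C g))"
    unfolding ker_norm_def splitting_def[abs_def] by (auto intro!: SUP_least)
  also have "\<dots> < \<infinity>" by (simp add: of_nat_less_top)
  finally show "ker_norm {split_kernel C \<phi> | \<phi>. op_norm \<phi> \<le> 1} (unit_mass g) < \<infinity>" .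
qed

end

context hyperbolic_word_metric
begin

text \<open>Insert \<open>g = a + b\<close> and assign every \<open>x\<close> near the geodesic of \<open>a + b\<close> to \<open>a\<close> or to \<open>b\<close> by
  \<open>between_product\<close>. If it belongs to \<open>a\<close>, then summation over \<open>b\<close> produces the convolution of
  \<open>v\<close> with \<open>\<phi>\<close>, otherwise summation over \<open>a\<close> that of \<open>\<phi>\<close> with \<open>u\<close>; the correction \<open>r\<close>
  becomes a conjugation of \<open>h\<close>.\<close>

lemma splitting_conv_le:
  assumes R: "\<And>g h x. x \<in> between C (g + h) \<Longrightarrow>
    \<exists>r. len r \<le> R \<and> (x + r \<in> between C g \<or> - g + x + r \<in> between C h)"
  shows "splitting C \<phi> (conv u v) h \<le> (\<Sum>r | len r \<le> R.
    splitting C (conv v \<phi>) u (- r + h + r) + splitting C (conv \<phi> u) v (- r + h + r))"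
proof -
  let ?B = "{r. len r \<le> R}"
  note finB = finite_len_ball[of R]
  let ?S1 = "\<lambda>r a b. \<Sum>\<^sup>+y. indicator (between C a) y * \<phi> (- b + (- a + y + (- r + h + r) - y))"
  let ?S2 = "\<lambda>r a b. \<Sum>\<^sup>+y. indicator (between C b) y * \<phi> ((- b + y + (- r + h + r) - y) - a)"
  define T where "T a b x = \<phi> (- (a + b) + x + h - x)" for a b x
  have "splitting C \<phi> (conv u v) h
      = (\<Sum>\<^sup>+g. \<Sum>\<^sup>+a. split_kernel C \<phi> h g * (u a * v (- a + g)))"
    by (simp add: splitting_def conv_def nn_integral_cmult)
  also have "\<dots> = (\<Sum>\<^sup>+a. \<Sum>\<^sup>+g. split_kernel C \<phi> h g * (u a * v (- a + g)))"
    by (rule esum_swap)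
  also have "\<dots> = (\<Sum>\<^sup>+a. \<Sum>\<^sup>+b. split_kernel C \<phi> h (a + b) * (u a * v b))"
  proof (rule nn_integral_cong)
    fix a
    show "(\<Sum>\<^sup>+g. split_kernel C \<phi> h g * (u a * v (- a + g)))
        = (\<Sum>\<^sup>+b. split_kernel C \<phi> h (a + b) * (u a * v b))"
      using esum_group_reindex(1)[of "\<lambda>g. split_kernel C \<phi> h g * (u a * v (- a + g))" a]
      by (simp add: add.assoc[symmetric])
  qed
  also have "\<dots> \<le> (\<Sum>\<^sup>+a. \<Sum>\<^sup>+b. (\<Sum>r\<in>?B.
      ?S1 r a b + ?S2 r a b) * (u a * v b))"
  proof (intro nn_integral_mono mult_right_mono)
    fix a b
    let ?G = "\<lambda>r x. (indicator (between C a) (x + r) + indicator (between C b) (- a + x + r)) * T a b x"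
    have "split_kernel C \<phi> h (a + b) \<le> (\<Sum>\<^sup>+x. \<Sum>r\<in>?B.
        ?G r x)"
      unfolding split_kernel_def
    proof (rule nn_integral_mono)
      fix x
      show "indicator (between C (a + b)) x * \<phi> (- (a + b) + x + h - x) \<le> (\<Sum>r\<in>?B.
        ?G r x)"
      proof (cases "x \<in> between C (a + b)")
        case True
        then obtain r where r: "len r \<le> R" "x + r \<in> between C a \<or> - a + x + r \<in> between C b"
          using R by blast
        then have "(1::ennreal) \<le> indicator (between C a) (x + r) + indicator (between C b) (- a + x + r)"
          by (auto simp: indicator_def)
        then have "1 * T a b x \<le>
            ?G r x"
          by (rule mult_right_mono) simp
        also have "\<dots> \<le> (\<Sum>r\<in>?B.
            ?G r x)"
          using r finB by (intro member_le_sum) auto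
        finally show ?thesis using True by (simp add: T_def)
      qed simp
    qed
    also have "\<dots> = (\<Sum>r\<in>?B. (\<Sum>\<^sup>+x. indicator (between C a) (x + r) * T a b x)
        + (\<Sum>\<^sup>+x. indicator (between C b) (- a + x + r) * T a b x))"
      by (simp add: nn_integral_sum nn_integral_add distrib_right)
    also have "\<dots> = (\<Sum>r\<in>?B.
      ?S1 r a b + ?S2 r a b)"
    proof (intro sum.cong refl arg_cong2[of _ _ _ _ "(+)"])
      fix r
      have "(\<Sum>\<^sup>+x. indicator (between C a) (x + r) * T a b x)
          = (\<Sum>\<^sup>+y. indicator (between C a) (y - r + r) * T a b (y - r))"
        using esum_group_reindex(2)[of "\<lambda>x. indicator (between C a) (x + r) * T a b x" "- r"]
        by simp
      also have "\<dots> = ?S1 r a b"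
      proof (rule nn_integral_cong)
        fix y
        have "T a b (y - r) = \<phi> (- b + (- a + y + (- r + h + r) - y))"
          by (simp only: T_def group_normalize)
        then show "indicator (between C a) (y - r + r) * T a b (y - r)
            = indicator (between C a) y * \<phi> (- b + (- a + y + (- r + h + r) - y))"
          by (simp only: diff_add_cancel)
      qed
      finally show "(\<Sum>\<^sup>+x. indicator (between C a) (x + r) * T a b x)
          = ?S1 r a b" .
      have "bij (\<lambda>y. a + y - r)"
        using bij_comp[OF bij_group_maps(1)[of a] bij_group_maps(2)[of "- r"]]
        by (simp add: comp_def)
      from esum_bij[OF this, of "\<lambda>x. indicator (between C b) (- a + x + r) * T a b x"]
      have "(\<Sum>\<^sup>+x. indicator (between C b) (- a + x + r) * T a b x)
          = (\<Sum>\<^sup>+y. indicator (between C b) (- a + (a + y - r) + r) * T a b (a + y - r))"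
        by (rule sym)
      also have "\<dots> = ?S2 r a b"
      proof (rule nn_integral_cong)
        fix y
        have "- a + (a + y - r) + r = y"
          "T a b (a + y - r) = \<phi> ((- b + y + (- r + h + r) - y) - a)"
          by (simp_all only: T_def group_normalize)
        then show "indicator (between C b) (- a + (a + y - r) + r) * T a b (a + y - r)
            = indicator (between C b) y * \<phi> ((- b + y + (- r + h + r) - y) - a)"
          by (simp only:)
      qed
      finally show "(\<Sum>\<^sup>+x. indicator (between C b) (- a + x + r) * T a b x)
          = ?S2 r a b" .
    qed
    finally show "split_kernel C \<phi> h (a + b) \<le> (\<Sum>r\<in>?B.
      ?S1 r a b + ?S2 r a b)" .
  qed simp
  also have "\<dots> = (\<Sum>r\<in>?B.
      (\<Sum>\<^sup>+a. \<Sum>\<^sup>+b. \<Sum>\<^sup>+y. indicator (between C a) y * \<phi> (- b + (- a + y + (- r + h + r) - y)) * (u a * v b)) +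
      (\<Sum>\<^sup>+a. \<Sum>\<^sup>+b. \<Sum>\<^sup>+y. indicator (between C b) y * \<phi> ((- b + y + (- r + h + r) - y) - a) * (u a * v b)))"
    by (simp add: nn_integral_sum nn_integral_add sum_distrib_right distrib_right nn_integral_multc)
  also have "\<dots> = (\<Sum>r\<in>?B.
    splitting C (conv v \<phi>) u (- r + h + r) + splitting C (conv \<phi> u) v (- r + h + r))"
  proof (intro sum.cong refl arg_cong2[of _ _ _ _ "(+)"])
    fix r
    define h' where "h' = - r + h + r"
    have "(\<Sum>\<^sup>+b. \<Sum>\<^sup>+y. indicator (between C a) y * \<phi> (- b + (- a + y + h' - y)) * (u a * v b))
        = split_kernel C (conv v \<phi>) h' a * u a" for a
    proof -
      have "(\<Sum>\<^sup>+b. \<Sum>\<^sup>+y. indicator (between C a) y * \<phi> (- b + (- a + y + h' - y)) * (u a * v b))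
          = (\<Sum>\<^sup>+y. \<Sum>\<^sup>+b. indicator (between C a) y * (v b * \<phi> (- b + (- a + y + h' - y))) * u a)"
        by (subst esum_swap) (simp add: ac_simps)
      then show ?thesis
        by (simp add: split_kernel_def conv_def nn_integral_multc nn_integral_cmult)
    qed
    then show "(\<Sum>\<^sup>+a. \<Sum>\<^sup>+b. \<Sum>\<^sup>+y. indicator (between C a) y * \<phi> (- b + (- a + y + h' - y)) * (u a * v b))
        = splitting C (conv v \<phi>) u h'"
      by (simp add: splitting_def)
    have "(\<Sum>\<^sup>+a. \<Sum>\<^sup>+y. indicator (between C b) y * \<phi> ((- b + y + h' - y) - a) * (u a * v b))
        = split_kernel C (conv \<phi> u) h' b * v b" for b
    proof -
      have "(\<Sum>\<^sup>+a. \<Sum>\<^sup>+y. indicator (between C b) y * \<phi> ((- b + y + h' - y) - a) * (u a * v b))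
          = (\<Sum>\<^sup>+y. \<Sum>\<^sup>+a. indicator (between C b) y * (\<phi> ((- b + y + h' - y) - a) * u a) * v b)"
        by (subst esum_swap) (simp add: mult.assoc)
      then show ?thesis
        by (simp add: split_kernel_def conv_alt nn_integral_multc nn_integral_cmult)
    qed
    then show "(\<Sum>\<^sup>+a. \<Sum>\<^sup>+b. \<Sum>\<^sup>+y. indicator (between C b) y * \<phi> ((- b + y + h' - y) - a) * (u a * v b))
        = splitting C (conv \<phi> u) v h'"
      by (subst esum_swap) (simp add: splitting_def)
  qed
  finally show ?thesis .
qed

text \<open>The derivation-like estimate on which the multiplicativity of the norms and their closure
  under inversion rest.\<close>

lemma split_norm_conv:
  obtains \<kappa> :: nat where "1 \<le> \<kappa>"
    "\<And>u v. op_norm u < \<infinity> \<Longrightarrow> op_norm v < \<infinity> \<Longrightarrow>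
      split_norm C (conv u v) \<le> of_nat \<kappa> * (op_norm v * split_norm C u + op_norm u * split_norm C v)"
proof -
  obtain R where R: "\<And>g h x. x \<in> between C (g + h) \<Longrightarrow>
      \<exists>r. len r \<le> R \<and> (x + r \<in> between C g \<or> - g + x + r \<in> between C h)"
    using between_product by blast
  let ?B = "{r. len r \<le> R}"
  note finB = finite_len_ball[of R]
  have "1 \<le> card ?B"
    using finB card_0_eq[of ?B] len_0 by (metis One_nat_def Suc_leI card_gt_0_iff empty_iff mem_Collect_eq zero_le)
  moreover have "split_norm C (conv u v)
      \<le> of_nat (card ?B) * (op_norm v * split_norm C u + op_norm u * split_norm C v)"
    if u: "op_norm u < \<infinity>" and v: "op_norm v < \<infinity>" for u v
  proof -
    have "nrm (splitting C \<phi> (conv u v))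
      \<le> of_nat (card ?B) * (op_norm v * split_norm C u + op_norm u * split_norm C v)"
      if \<phi>: "op_norm \<phi> \<le> 1" for \<phi>
    proof -
      have \<phi>': "op_norm \<phi> < \<infinity>" using \<phi> by (rule le_less_trans) simp
      have "op_norm (conv v \<phi>) \<le> op_norm v * op_norm \<phi>" by (rule op_norm_conv[OF \<phi>'])
      also have "\<dots> \<le> op_norm v * 1" by (intro mult_left_mono \<phi>) simp
      finally have 1: "op_norm (conv v \<phi>) \<le> op_norm v" by simp
      have "op_norm (conv \<phi> u) \<le> op_norm \<phi> * op_norm u" by (rule op_norm_conv[OF u])
      also have "\<dots> \<le> 1 * op_norm u" by (intro mult_right_mono \<phi>) simp
      finally have 2: "op_norm (conv \<phi> u) \<le> op_norm u" by simp
      have 3: "nrm (splitting C (conv v \<phi>) u) \<le> op_norm v * split_norm C u"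
        using nrm_splitting_le[of "conv v \<phi>" C u] 1 v
        by (meson le_less_trans mult_right_mono order_trans zero_le)
      have 4: "nrm (splitting C (conv \<phi> u) v) \<le> op_norm u * split_norm C v"
        using nrm_splitting_le[of "conv \<phi> u" C v] 2 u
        by (meson le_less_trans mult_right_mono order_trans zero_le)
      have bij: "bij (\<lambda>h. - r + h + r)" for r :: 'g
        using bij_comp[OF bij_group_maps(1)[of "- r"] bij_group_maps(2)[of r]] by (simp add: comp_def)
      have "nrm (splitting C \<phi> (conv u v)) \<le> nrm (\<lambda>h. \<Sum>r\<in>?B.
          splitting C (conv v \<phi>) u (- r + h + r) + splitting C (conv \<phi> u) v (- r + h + r))"
        by (rule nrm_mono) (rule splitting_conv_le[OF R])
      also have "\<dots> \<le> (\<Sum>r\<in>?B. nrm (\<lambda>h.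
          splitting C (conv v \<phi>) u (- r + h + r) + splitting C (conv \<phi> u) v (- r + h + r)))"
        by (rule nrm_sum[OF finB])
      also have "\<dots> \<le> (\<Sum>r\<in>?B. op_norm v * split_norm C u + op_norm u * split_norm C v)"
      proof (rule sum_mono)
        fix r
        have "nrm (\<lambda>h. splitting C (conv v \<phi>) u (- r + h + r)) = nrm (splitting C (conv v \<phi>) u)"
          "nrm (\<lambda>h. splitting C (conv \<phi> u) v (- r + h + r)) = nrm (splitting C (conv \<phi> u) v)"
          by (rule nrm_reindex[OF bij])+
        then show "nrm (\<lambda>h. splitting C (conv v \<phi>) u (- r + h + r) + splitting C (conv \<phi> u) v (- r + h + r))
            \<le> op_norm v * split_norm C u + op_norm u * split_norm C v"
          using nrm_triangle[of "\<lambda>h. splitting C (conv v \<phi>) u (- r + h + r)"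
              "\<lambda>h. splitting C (conv \<phi> u) v (- r + h + r)"] add_mono[OF 3 4]
          by simp
      qed
      finally show ?thesis by simp
    qed
    then show ?thesis
      unfolding split_norm_def[of C] ker_norm_def[of _ "conv u v"] splitting_def[abs_def]
      by (auto intro!: SUP_least)
  qed
  ultimately show ?thesis using that by blast
qed

end

section \<open>Square summable functions and the operators of the reduced algebra\<close>

definition ell2_abs :: "'a ell2 \<Rightarrow> 'a \<Rightarrow> ennreal" where
  "ell2_abs f x = ennreal (cmod (ell2_apply f x))"

lemma ell2_apply_summable: "(\<lambda>x. (cmod (ell2_apply f x))\<^sup>2) summable_on UNIV"
  using ell2_apply[of f] by simp

lemma nrm_ell2_abs [simp]: "nrm (ell2_abs f) = ennreal (norm f)"
proof -
  have "(\<Sum>\<^sup>+x. (ell2_abs f x)\<^sup>2) = ennreal ((norm f)\<^sup>2)"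
    using esum_eq_infsum[OF _ ell2_apply_summable[of f]]
    by (simp add: ell2_abs_def ennreal_power norm_ell2_square)
  then have "(nrm (ell2_abs f))\<^sup>2 = (ennreal (norm f))\<^sup>2"
    by (simp add: nrm_power2 ennreal_power)
  then show ?thesis
    by (metis esqrt_power2')
qed

lemma ell2_apply_add [simp]: "ell2_apply (f + g) x = ell2_apply f x + ell2_apply g x"
  by (simp add: plus_ell2.rep_eq)

lemma ell2_apply_diff [simp]: "ell2_apply (f - g) x = ell2_apply f x - ell2_apply g x"
  by (simp add: minus_ell2.rep_eq)

lemma ell2_apply_zero [simp]: "ell2_apply 0 x = 0"
  by (simp add: zero_ell2.rep_eq)

lemma ell2_apply_sum: "ell2_apply (\<Sum>i\<in>I. f i) x = (\<Sum>i\<in>I. ell2_apply (f i) x)"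
  by (induction I rule: infinite_finite_induct) auto

lemma ell2_eqI: "(\<And>x. ell2_apply f x = ell2_apply g x) \<Longrightarrow> f = g"
  by (simp add: ell2_apply_inject[symmetric] fun_eq_iff)

lemma cmod_ell2_apply_le: "cmod (ell2_apply f x) \<le> norm f"
  using member_le_nrm[of "ell2_abs f" x] by (simp add: ell2_abs_def)

lemma ell2_of_nrm_finite:
  assumes "nrm (\<lambda>x. ennreal (cmod (h x))) < \<infinity>"
  obtains f where "ell2_apply f = h"
proof -
  have "(\<Sum>\<^sup>+x. ennreal ((cmod (h x))\<^sup>2)) = (nrm (\<lambda>x. ennreal (cmod (h x))))\<^sup>2"
    by (simp add: nrm_power2 ennreal_power)
  also have "\<dots> < \<infinity>" using assms by (simp add: power2_eq_square ennreal_mult_less_top)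
  finally have "(\<lambda>x. (cmod (h x))\<^sup>2) summable_on UNIV"
    by (intro summable_on_if_esum_finite) auto
  then show ?thesis using that[of "Abs_ell2 h"] by (simp add: Abs_ell2_inverse)
qed

text \<open>Limits are formed pointwise, and Fatou's lemma controls the distance to the limit.\<close>

instance ell2 :: (type) banach
proof
  fix f :: "nat \<Rightarrow> 'a ell2"
  assume f: "Cauchy f"
  have "Cauchy (\<lambda>n. ell2_apply (f n) x)" for x
  proof (rule CauchyI)
    fix e :: real assume "0 < e"
    then obtain M where "\<And>m n. m \<ge> M \<Longrightarrow> n \<ge> M \<Longrightarrow> norm (f m - f n) < e"
      using CauchyD[OF f] by blast
    then show "\<exists>M. \<forall>m\<ge>M. \<forall>n\<ge>M. norm (ell2_apply (f m) x - ell2_apply (f n) x) < e"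
      using cmod_ell2_apply_le[of "f _ - f _" x] by (metis ell2_apply_diff le_less_trans)
  qed
  then have "\<exists>l. (\<lambda>n. ell2_apply (f n) x) \<longlonglongrightarrow> l" for x
    by (simp add: Cauchy_convergent_iff convergent_def)
  then obtain h where h: "\<And>x. (\<lambda>n. ell2_apply (f n) x) \<longlonglongrightarrow> h x" by metis
  have bound: "nrm (\<lambda>x. ennreal (cmod (ell2_apply (f n) x - h x))) \<le> ennreal e"
    if "\<And>m. M \<le> m \<Longrightarrow> norm (f n - f m) < e" for n M e
  proof -
    have "liminf (\<lambda>m. ell2_abs (f n - f (m + M)) x) = ennreal (cmod (ell2_apply (f n) x - h x))" for x
    proof (rule lim_imp_Liminf)
      have "(\<lambda>m. ell2_apply (f (m + M)) x) \<longlonglongrightarrow> h x"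
        using h[of x] by (rule LIMSEQ_ignore_initial_segment)
      then show "(\<lambda>m. ell2_abs (f n - f (m + M)) x) \<longlonglongrightarrow> ennreal (cmod (ell2_apply (f n) x - h x))"
        unfolding ell2_abs_def ell2_apply_diff by (intro tendsto_intros)
    qed simp
    moreover have "nrm (ell2_abs (f n - f (m + M))) \<le> ennreal e" for m
      using that[of "m + M"] by (simp add: ennreal_leI)
    ultimately show ?thesis using nrm_liminf[of "\<lambda>m. ell2_abs (f n - f (m + M))"] by simp
  qed
  obtain M0 where M0: "\<And>m n. m \<ge> M0 \<Longrightarrow> n \<ge> M0 \<Longrightarrow> norm (f m - f n) < 1"
    using CauchyD[OF f, of 1] by auto
  then have "nrm (\<lambda>x. ennreal (cmod (ell2_apply (f M0) x - h x))) \<le> ennreal 1"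
    by (intro bound[of M0]) auto
  then have "nrm (\<lambda>x. ennreal (cmod (ell2_apply (f M0) x - h x))) < \<infinity>"
    by (rule le_less_trans) simp
  then obtain k where k: "ell2_apply k = (\<lambda>x. ell2_apply (f M0) x - h x)"
    by (rule ell2_of_nrm_finite[of "\<lambda>x. ell2_apply (f M0) x - h x"])
  define l where "l = f M0 - k"
  have l: "ell2_apply l = h" by (simp add: l_def k fun_eq_iff)
  have "f \<longlonglongrightarrow> l"
  proof (rule LIMSEQ_I)
    fix e :: real assume "0 < e"
    then obtain M where M: "\<And>m n. m \<ge> M \<Longrightarrow> n \<ge> M \<Longrightarrow> norm (f m - f n) < e / 2"
      using CauchyD[OF f, of "e / 2"] by auto
    have "norm (f n - l) < e" if "n \<ge> M" for n
    proof -
      have "ell2_abs (f n - l) = (\<lambda>x. ennreal (cmod (ell2_apply (f n) x - h x)))"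
        by (simp add: ell2_abs_def l fun_eq_iff)
      then have "nrm (ell2_abs (f n - l)) \<le> ennreal (e / 2)"
        using bound[of M n "e / 2"] M that by simp
      then show ?thesis using \<open>0 < e\<close> by simp
    qed
    then show "\<exists>M. \<forall>n\<ge>M. norm (f n - l) < e" by blast
  qed
  then show "convergent f" by (rule convergentI)
qed

lift_definition ell2_basis :: "'a \<Rightarrow> 'a ell2" is "\<lambda>a x. if x = a then 1 else 0"
proof -
  fix a :: 'a
  have "(\<lambda>x. (cmod (if x = a then 1 else 0))\<^sup>2) summable_on UNIV \<longleftrightarrow>
      (\<lambda>x. (cmod (if x = a then 1 else 0))\<^sup>2) summable_on {a}"
    by (rule summable_on_cong_neutral) auto
  then show "(\<lambda>x. (cmod (if x = a then 1 else 0))\<^sup>2) summable_on UNIV" by simp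
qed

lemma ell2_abs_basis: "ell2_abs (ell2_basis a) = unit_mass a"
  by (simp add: ell2_abs_def ell2_basis.rep_eq unit_mass_def fun_eq_iff)

lemma norm_ell2_basis [simp]: "norm (ell2_basis a) = 1"
  using nrm_ell2_abs[of "ell2_basis a"] by (simp add: ell2_abs_basis flip: ennreal_1)

lemma translation_op_apply [simp]: "ell2_apply (translation_op g f) x = ell2_apply f (- g + x)"
  by (simp add: translation_op.rep_eq ell2_translate.rep_eq)

lemma scaleC_op_apply [simp]: "ell2_apply ((c *\<^sub>C T) f) x = c * ell2_apply (T f) x"
  by (simp add: scaleC_op_def scalar_op.rep_eq ell2_scaleC.rep_eq)

lemma ell2_op_eqI: "(\<And>f x. ell2_apply (blinfun_apply T f) x = ell2_apply (blinfun_apply U f) x) \<Longrightarrow> T = U"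
  by (intro blinfun_eqI ell2_eqI)

lemma left_regular_apply:
  assumes "finite F" "Poly_Mapping.keys a \<subseteq> F"
  shows "ell2_apply (left_regular a f) x = (\<Sum>g\<in>F. Poly_Mapping.lookup a g * ell2_apply f (- g + x))"
proof -
  have "ell2_apply (left_regular a f) x
      = (\<Sum>g\<in>Poly_Mapping.keys a. Poly_Mapping.lookup a g * ell2_apply f (- g + x))"
    by (simp add: left_regular_def blinfun.sum_left ell2_apply_sum)
  also have "\<dots> = (\<Sum>g\<in>F. Poly_Mapping.lookup a g * ell2_apply f (- g + x))"
    using assms by (intro sum.mono_neutral_left) (auto simp: in_keys_iff)
  finally show ?thesis .
qed

text \<open>The operator \<open>T\<close> acts as convolution with its coefficient function
  (\<open>reduced_cstar_apply\<close> below).\<close>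

definition coef :: "'g::group_add ell2_op \<Rightarrow> 'g \<Rightarrow> complex" where
  "coef T g = ell2_apply (T (ell2_basis 0)) g"

definition abscoef :: "'g::group_add ell2_op \<Rightarrow> 'g \<Rightarrow> ennreal" where
  "abscoef T g = ennreal (cmod (coef T g))"

lemma coef_simps [simp]:
  "coef (T + U) g = coef T g + coef U g" "coef (T - U) g = coef T g - coef U g"
  "coef (c *\<^sub>C T) g = c * coef T g" "coef 0 g = 0"
  by (simp_all add: coef_def blinfun.add_left blinfun.diff_left)

lemma coef_left_regular [simp]: "coef (left_regular a) g = Poly_Mapping.lookup a g"
proof -
  let ?F = "insert g (Poly_Mapping.keys a)"
  have "coef (left_regular a) g
      = (\<Sum>h\<in>?F. Poly_Mapping.lookup a h * (if - h + g = 0 then 1 else 0))"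
    unfolding coef_def by (subst left_regular_apply[of ?F]) (auto simp: ell2_basis.rep_eq)
  also have "\<dots> = (\<Sum>h\<in>?F. if h = g then Poly_Mapping.lookup a h else 0)"
    by (intro sum.cong refl) (auto simp flip: eq_neg_iff_add_eq_0)
  finally show ?thesis by (simp add: sum.delta')
qed

lemma abscoef_eq_ell2_abs: "abscoef T = ell2_abs (T (ell2_basis 0))"
  by (simp add: abscoef_def coef_def ell2_abs_def fun_eq_iff)

lemma cmod_coef_le: "cmod (coef T g) \<le> norm T"
  using cmod_ell2_apply_le[of "T (ell2_basis 0)" g] norm_blinfun[of T "ell2_basis 0"]
  by (simp add: coef_def)

lemma abscoef_add_le: "abscoef (T + U) g \<le> abscoef T g + abscoef U g"
  by (simp add: abscoef_def norm_triangle_ineq ennreal_leI flip: ennreal_plus)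

lemma abscoef_scaleC: "abscoef (c *\<^sub>C T) g = ennreal (cmod c) * abscoef T g"
  by (simp add: abscoef_def norm_mult ennreal_mult)

lemma convolution_summable:
  fixes v \<xi> :: "'g::group_add ell2"
  shows "(\<Sum>\<^sup>+y. ennreal (cmod (ell2_apply v (x - y) * ell2_apply \<xi> y))) \<le> ennreal (norm v * norm \<xi>)"
    and "(\<lambda>y. cmod (ell2_apply v (x - y) * ell2_apply \<xi> y)) summable_on UNIV"
proof -
  have "(\<Sum>\<^sup>+y. ennreal (cmod (ell2_apply v (x - y) * ell2_apply \<xi> y)))
      = (\<Sum>\<^sup>+y. ell2_abs v (x - y) * ell2_abs \<xi> y)"
    by (simp add: ell2_abs_def norm_mult ennreal_mult)
  also have "\<dots> \<le> nrm (\<lambda>y. ell2_abs v (x - y)) * nrm (ell2_abs \<xi>)"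
    by (rule esum_mult_le_nrm)
  also have "\<dots> = ennreal (norm v * norm \<xi>)"
    by (simp add: nrm_reindex[OF bij_group_maps(3)] ennreal_mult)
  finally show *: "(\<Sum>\<^sup>+y. ennreal (cmod (ell2_apply v (x - y) * ell2_apply \<xi> y)))
      \<le> ennreal (norm v * norm \<xi>)" .
  show "(\<lambda>y. cmod (ell2_apply v (x - y) * ell2_apply \<xi> y)) summable_on UNIV"
    by (rule summable_on_if_esum_finite) (auto intro: le_less_trans[OF *])
qed

lemma cmod_infsum_le:
  assumes "(\<lambda>y. cmod (f y)) summable_on UNIV"
  shows "ennreal (cmod (\<Sum>\<^sub>\<infinity>y. f y)) \<le> (\<Sum>\<^sup>+y. ennreal (cmod (f y)))"
  using norm_infsum_bound[OF assms] esum_eq_infsum[OF _ assms] by (simp add: ennreal_leI)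

text \<open>The formula holds on the group ring, and for fixed \<open>\<xi>\<close> and \<open>x\<close> both sides depend
  continuously on \<open>T\<close>.\<close>

lemma reduced_cstar_apply:
  assumes "T \<in> reduced_cstar"
  shows "ell2_apply (T \<xi>) x = (\<Sum>\<^sub>\<infinity>y. coef T (x - y) * ell2_apply \<xi> y)"
proof -
  define B where "B v = (\<Sum>\<^sub>\<infinity>y. ell2_apply v (x - y) * ell2_apply \<xi> y)" for v
  have B_add: "B (v + w) = B v + B w" for v w
    unfolding B_def
    by (subst infsum_add[symmetric]) (auto intro: abs_summable_summable convolution_summable(2) simp: distrib_right)
  have B_diff: "B v - B w = B (v - w)" for v w
    using B_add[of "v - w" w] by simp
  have B_le: "cmod (B v) \<le> norm v * norm \<xi>" for v
  proof -
    have "ennreal (cmod (B v)) \<le> ennreal (norm v * norm \<xi>)"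
      unfolding B_def
      by (rule order_trans[OF cmod_infsum_le convolution_summable(1)]) (rule convolution_summable(2))
    then show ?thesis by simp
  qed
  have regular: "ell2_apply (left_regular a \<xi>) x = B (left_regular a (ell2_basis 0))" for a
  proof -
    let ?F = "(\<lambda>g. - g + x) ` Poly_Mapping.keys a"
    have "B (left_regular a (ell2_basis 0)) = (\<Sum>\<^sub>\<infinity>y. Poly_Mapping.lookup a (x - y) * ell2_apply \<xi> y)"
      unfolding B_def coef_def[symmetric] coef_left_regular ..
    also have "\<dots> = (\<Sum>\<^sub>\<infinity>y\<in>?F. Poly_Mapping.lookup a (x - y) * ell2_apply \<xi> y)"
    proof (rule infsum_cong_neutral)
      fix y assume "y \<in> UNIV - ?F"
      then have "x - y \<notin> Poly_Mapping.keys a"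
        by (auto simp: image_iff dest: bspec[of _ _ "x - y"])
      then show "Poly_Mapping.lookup a (x - y) * ell2_apply \<xi> y = 0" by (simp add: in_keys_iff)
    qed auto
    also have "\<dots> = (\<Sum>y\<in>?F. Poly_Mapping.lookup a (x - y) * ell2_apply \<xi> y)"
      by simp
    also have "\<dots> = (\<Sum>g\<in>Poly_Mapping.keys a. Poly_Mapping.lookup a g * ell2_apply \<xi> (- g + x))"
      by (subst sum.reindex) (auto simp: inj_on_def diff_add_eq_diff_diff_swap)
    also have "\<dots> = ell2_apply (left_regular a \<xi>) x"
      by (rule left_regular_apply[symmetric]) auto
    finally show ?thesis by simp
  qed
  have "cmod (ell2_apply (T \<xi>) x - B (T (ell2_basis 0))) \<le> e" if "0 < e" for e
  proof -
    define e' where "e' = e / (2 * norm \<xi> + 1)"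
    have "0 < e'" using that by (simp add: e'_def add_nonneg_pos)
    then obtain a where a: "norm (left_regular a - T) < e'"
      using assms unfolding reduced_cstar_def closure_approachable by (auto simp: dist_norm)
    let ?D = "left_regular a - T"
    have "ell2_apply (T \<xi>) x - B (T (ell2_basis 0)) = B (?D (ell2_basis 0)) - ell2_apply (?D \<xi>) x"
      by (simp add: blinfun.diff_left regular flip: B_diff)
    also have "cmod \<dots> \<le> cmod (B (?D (ell2_basis 0))) + cmod (ell2_apply (?D \<xi>) x)"
      by (rule norm_triangle_ineq4)
    also have "\<dots> \<le> norm ?D * norm \<xi> + norm ?D * norm \<xi>"
    proof (rule add_mono)
      have "norm (?D (ell2_basis 0)) \<le> norm ?D"
        using norm_blinfun[of ?D "ell2_basis 0"] by simp
      then show "cmod (B (?D (ell2_basis 0))) \<le> norm ?D * norm \<xi>"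
        by (intro order_trans[OF B_le] mult_right_mono) auto
      show "cmod (ell2_apply (?D \<xi>) x) \<le> norm ?D * norm \<xi>"
        by (rule order_trans[OF cmod_ell2_apply_le norm_blinfun])
    qed
    also have "\<dots> \<le> e' * (2 * norm \<xi> + 1)"
      using a mult_right_mono[of "norm ?D" e' "norm \<xi>"] \<open>0 < e'\<close> by (simp add: algebra_simps)
    also have "\<dots> = e"
      using add_nonneg_pos[of "2 * norm \<xi>" 1] by (simp add: e'_def)
    finally show ?thesis .
  qed
  then have "cmod (ell2_apply (T \<xi>) x - B (T (ell2_basis 0))) \<le> 0"
    by (rule field_le_epsilon) simp
  then show ?thesis by (simp add: B_def coef_def)
qed

lemma ell2_abs_apply_le:
  assumes "T \<in> reduced_cstar"
  shows "ell2_abs (T \<xi>) x \<le> conv (abscoef T) (ell2_abs \<xi>) x"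
proof -
  have "ell2_abs (T \<xi>) x \<le> (\<Sum>\<^sup>+y. ennreal (cmod (coef T (x - y) * ell2_apply \<xi> y)))"
    unfolding ell2_abs_def reduced_cstar_apply[OF assms]
    by (rule cmod_infsum_le) (simp only: coef_def convolution_summable(2))
  then show ?thesis
    by (simp add: conv_alt abscoef_def ell2_abs_def norm_mult ennreal_mult)
qed

lemma abscoef_compose_le:
  assumes "T \<in> reduced_cstar"
  shows "abscoef (T o\<^sub>L U) g \<le> conv (abscoef T) (abscoef U) g"
  using ell2_abs_apply_le[OF assms, of "U (ell2_basis 0)" g] by (simp add: abscoef_eq_ell2_abs)

lemma norm_le_op_norm:
  assumes "T \<in> reduced_cstar"
  shows "ennreal (norm T) \<le> op_norm (abscoef T)"
proof (cases "op_norm (abscoef T) = \<infinity>")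
  case False
  then obtain c where c: "op_norm (abscoef T) = ennreal c" "0 \<le> c"
    by (cases "op_norm (abscoef T)") auto
  have "norm (T \<xi>) \<le> c * norm \<xi>" for \<xi>
  proof -
    have "ennreal (norm (T \<xi>)) \<le> nrm (conv (abscoef T) (ell2_abs \<xi>))"
      using nrm_mono[of "ell2_abs (T \<xi>)"] ell2_abs_apply_le[OF assms] by simp
    also have "\<dots> \<le> ennreal (c * norm \<xi>)"
      using nrm_conv_le_op_norm[of "ell2_abs \<xi>" "abscoef T"] c by (simp add: ennreal_mult)
    finally show ?thesis using c by simp
  qed
  then show ?thesis
    unfolding c by (intro ennreal_leI norm_blinfun_bound[OF c(2)])
qed simp

lemma left_regular_add: "left_regular (a + b) = left_regular a + left_regular b"
proof (rule ell2_op_eqI)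
  fix f x
  let ?F = "Poly_Mapping.keys a \<union> Poly_Mapping.keys b"
  have "ell2_apply (left_regular (a + b) f) x
      = (\<Sum>g\<in>?F. Poly_Mapping.lookup (a + b) g * ell2_apply f (- g + x))"
    by (rule left_regular_apply) (auto simp: Poly_Mapping.keys_add)
  moreover have "ell2_apply (left_regular a f) x
      = (\<Sum>g\<in>?F. Poly_Mapping.lookup a g * ell2_apply f (- g + x))"
    "ell2_apply (left_regular b f) x
      = (\<Sum>g\<in>?F. Poly_Mapping.lookup b g * ell2_apply f (- g + x))"
    by (rule left_regular_apply; simp)+
  ultimately show "ell2_apply (left_regular (a + b) f) x
      = ell2_apply ((left_regular a + left_regular b) f) x"
    by (simp add: blinfun.add_left lookup_add distrib_right sum.distrib)
qed

lemma left_regular_single: "left_regular (Poly_Mapping.single g c) = c *\<^sub>C translation_op g"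
  by (rule ell2_op_eqI) (subst left_regular_apply[of "{g}"], auto)

lemma left_regular_zero: "left_regular 0 = 0"
  by (simp add: left_regular_def)

lemma left_regular_one: "left_regular (Poly_Mapping.single 0 1) = id_blinfun"
  by (rule ell2_op_eqI) (simp add: left_regular_single del: single_one)

lemma range_left_regular_sum:
  "(\<And>i. i \<in> I \<Longrightarrow> f i \<in> range left_regular) \<Longrightarrow> (\<Sum>i\<in>I. f i) \<in> range left_regular"
proof (induction I rule: infinite_finite_induct)
  case (insert i I)
  then obtain a b where "f i = left_regular a" "(\<Sum>i\<in>I. f i) = left_regular b" by fastforce
  then show ?case using insert.hyps by (simp flip: left_regular_add)
qed (auto simp flip: left_regular_zero)

lemma left_regular_compose: "left_regular a o\<^sub>L left_regular b \<in> range left_regular"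
proof -
  have "left_regular a o\<^sub>L left_regular b = (\<Sum>g\<in>Poly_Mapping.keys a. \<Sum>h\<in>Poly_Mapping.keys b.
    left_regular (Poly_Mapping.single (g + h) (Poly_Mapping.lookup a g * Poly_Mapping.lookup b h)))"
    by (rule ell2_op_eqI)
       (simp add: left_regular_apply[OF finite_keys order.refl] left_regular_single blinfun.sum_left
        ell2_apply_sum sum_distrib_left mult.assoc minus_add add.assoc del: add_uminus_conv_diff)
  then show ?thesis by (simp add: range_left_regular_sum)
qed

lemma left_regular_scaleC: "c *\<^sub>C left_regular a \<in> range left_regular"
proof -
  have "c *\<^sub>C left_regular a
      = (\<Sum>g\<in>Poly_Mapping.keys a. left_regular (Poly_Mapping.single g (c * Poly_Mapping.lookup a g)))"
    by (rule ell2_op_eqI)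
       (simp add: left_regular_apply[OF finite_keys order.refl] left_regular_single blinfun.sum_left
        ell2_apply_sum sum_distrib_left mult.assoc)
  then show ?thesis by (simp add: range_left_regular_sum)
qed

lemma left_regular_in_reduced_cstar [simp]: "left_regular a \<in> reduced_cstar"
  unfolding reduced_cstar_def by (rule subsetD[OF closure_subset]) simp

lemma subalgebra_reduced_cstar: "subalgebra_op (reduced_cstar :: 'g::group_add ell2_op set)"
proof -
  let ?R = "range left_regular :: 'g ell2_op set"
  have limit_in_closure: "l \<in> closure ?R" if "\<And>n. x n \<in> ?R" "x \<longlonglongrightarrow> l" for x l
    unfolding closure_sequential using that by (intro exI[of _ x]) simp
  have "a + b \<in> closure ?R \<and> a o\<^sub>L b \<in> closure ?R" if "a \<in> closure ?R" "b \<in> closure ?R" for a b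
  proof -
    from that obtain s t where s: "\<And>n. s n \<in> ?R" "s \<longlonglongrightarrow> a" and t: "\<And>n. t n \<in> ?R" "t \<longlonglongrightarrow> b"
      unfolding closure_sequential by blast
    have "s n + t n \<in> ?R" "s n o\<^sub>L t n \<in> ?R" for n
    proof -
      obtain x y where "s n = left_regular x" "t n = left_regular y" using s(1)[of n] t(1)[of n] by auto
      then show "s n + t n \<in> ?R" "s n o\<^sub>L t n \<in> ?R"
        by (simp_all add: left_regular_compose flip: left_regular_add)
    qed
    moreover have "(\<lambda>n. s n + t n) \<longlonglongrightarrow> a + b" "(\<lambda>n. s n o\<^sub>L t n) \<longlonglongrightarrow> (a o\<^sub>L b)"
      using s(2) t(2)
      by (auto intro: tendsto_add bounded_bilinear.tendsto[OF bounded_bilinear_blinfun_compose])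
    ultimately show ?thesis
      using limit_in_closure[of "\<lambda>n. s n + t n"] limit_in_closure[of "\<lambda>n. s n o\<^sub>L t n"] by simp
  qed
  moreover have "c *\<^sub>C a \<in> closure ?R" if "a \<in> closure ?R" for a c
  proof -
    from that obtain s where s: "\<And>n. s n \<in> ?R" "s \<longlonglongrightarrow> a"
      unfolding closure_sequential by blast
    have "(\<lambda>n. c *\<^sub>C s n) \<longlonglongrightarrow> c *\<^sub>C a"
      unfolding scaleC_op_def
      using s(2) by (intro bounded_bilinear.tendsto[OF bounded_bilinear_blinfun_compose] tendsto_const)
    moreover have "c *\<^sub>C s n \<in> ?R" for n
      using s(1)[of n] left_regular_scaleC by auto
    ultimately show ?thesis
      using limit_in_closure[of "\<lambda>n. c *\<^sub>C s n"] by simp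
  qed
  moreover have "0 \<in> closure ?R"
    by (metis closure_subset left_regular_zero rangeI subsetD)
  ultimately show ?thesis
    unfolding subalgebra_op_def reduced_cstar_def by blast
qed

lemma reduced_cstar_closed [simp]:
  "0 \<in> reduced_cstar" "id_blinfun \<in> reduced_cstar"
  "T \<in> reduced_cstar \<Longrightarrow> U \<in> reduced_cstar \<Longrightarrow> T + U \<in> reduced_cstar"
  "T \<in> reduced_cstar \<Longrightarrow> U \<in> reduced_cstar \<Longrightarrow> T o\<^sub>L U \<in> reduced_cstar"
  "T \<in> reduced_cstar \<Longrightarrow> c *\<^sub>C T \<in> reduced_cstar"
  using subalgebra_reduced_cstar left_regular_in_reduced_cstar[of "Poly_Mapping.single 0 1"]
  unfolding left_regular_one subalgebra_op_def by auto

lemma diff_conv_scaleC: "T - U = T + (-1) *\<^sub>C U"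
  by (rule ell2_op_eqI) (simp add: blinfun.diff_left blinfun.add_left)

lemma reduced_cstar_diff [simp]:
  "T \<in> reduced_cstar \<Longrightarrow> U \<in> reduced_cstar \<Longrightarrow> T - U \<in> reduced_cstar"
  by (simp add: diff_conv_scaleC)

section \<open>The Banach algebras\<close>

locale split_algebra = hyperbolic_word_metric S \<delta> for S :: "'g::group_add set" and \<delta> +
  fixes C \<kappa> :: nat
  assumes \<kappa>_ge_1: "1 \<le> \<kappa>"
    and split_norm_conv_le: "op_norm u < \<infinity> \<Longrightarrow> op_norm v < \<infinity> \<Longrightarrow>
      split_norm C (conv u v) \<le> of_nat \<kappa> * (op_norm v * split_norm C u + op_norm u * split_norm C v)"
begin

abbreviation weighted :: "real \<Rightarrow> ('g \<Rightarrow> ennreal) \<Rightarrow> 'g \<Rightarrow> ennreal" where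
  "weighted \<epsilon> u \<equiv> \<lambda>g. weight \<epsilon> g * u g"

text \<open>The factor \<open>\<kappa>\<close> from \<open>split_norm_conv_le\<close> makes the norm submultiplicative. This holds
  for every \<open>\<theta>\<close>; the algebras are defined with \<open>\<theta> = 1\<close>, and small values serve for the Neumann
  series.\<close>

definition alg_norm :: "real \<Rightarrow> real \<Rightarrow> ('g \<Rightarrow> ennreal) \<Rightarrow> ennreal" where
  "alg_norm \<theta> \<epsilon> u = of_nat \<kappa> * op_norm (weighted \<epsilon> u) + ennreal \<theta> * split_norm C (weighted \<epsilon> u)"

lemma split_norm_mono: "(\<And>g. u g \<le> v g) \<Longrightarrow> split_norm C u \<le> split_norm C v"
  unfolding split_norm_def by (rule ker_norm_mono)

lemma op_norm_mono: "(\<And>g. u g \<le> v g) \<Longrightarrow> op_norm u \<le> op_norm v"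
  for u v :: "'g \<Rightarrow> ennreal"
  unfolding op_norm_def by (rule ker_norm_mono)

lemma alg_norm_mono: "(\<And>g. u g \<le> v g) \<Longrightarrow> alg_norm \<theta> \<epsilon> u \<le> alg_norm \<theta> \<epsilon> v"
  unfolding alg_norm_def
  by (intro add_mono mult_left_mono op_norm_mono split_norm_mono) auto

lemma alg_norm_exponent_mono: "\<epsilon> \<le> \<epsilon>' \<Longrightarrow> alg_norm \<theta> \<epsilon> u \<le> alg_norm \<theta> \<epsilon>' u"
  unfolding alg_norm_def
  by (intro add_mono mult_left_mono op_norm_mono split_norm_mono mult_right_mono weight_mono) auto

lemma alg_norm_add: "alg_norm \<theta> \<epsilon> (\<lambda>g. u g + v g) \<le> alg_norm \<theta> \<epsilon> u + alg_norm \<theta> \<epsilon> v"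
proof -
  have "weighted \<epsilon> (\<lambda>g. u g + v g) = (\<lambda>g. weight \<epsilon> g * u g + weight \<epsilon> g * v g)"
    by (simp add: distrib_left)
  then have "op_norm (weighted \<epsilon> (\<lambda>g. u g + v g)) \<le> op_norm (weighted \<epsilon> u) + op_norm (weighted \<epsilon> v)"
    "split_norm C (weighted \<epsilon> (\<lambda>g. u g + v g))
      \<le> split_norm C (weighted \<epsilon> u) + split_norm C (weighted \<epsilon> v)"
    by (simp_all add: op_norm_def[abs_def] split_norm_def ker_norm_add)
  then have "alg_norm \<theta> \<epsilon> (\<lambda>g. u g + v g)
      \<le> of_nat \<kappa> * (op_norm (weighted \<epsilon> u) + op_norm (weighted \<epsilon> v)) +
        ennreal \<theta> * (split_norm C (weighted \<epsilon> u) + split_norm C (weighted \<epsilon> v))"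
    unfolding alg_norm_def by (intro add_mono mult_left_mono) auto
  then show ?thesis by (simp add: alg_norm_def distrib_left ac_simps)
qed

lemma alg_norm_cmult: "alg_norm \<theta> \<epsilon> (\<lambda>g. c * u g) = c * alg_norm \<theta> \<epsilon> u"
proof -
  have "weighted \<epsilon> (\<lambda>g. c * u g) = (\<lambda>g. c * (weight \<epsilon> g * u g))"
    by (simp add: fun_eq_iff mult.left_commute)
  then show ?thesis
    by (simp add: alg_norm_def op_norm_def split_norm_def ker_norm_cmult distrib_left mult.left_commute)
qed

lemma op_norm_le_alg_norm: "op_norm (weighted \<epsilon> u) \<le> alg_norm \<theta> \<epsilon> u"
proof -
  have "1 * op_norm (weighted \<epsilon> u) \<le> of_nat \<kappa> * op_norm (weighted \<epsilon> u)"
    using \<kappa>_ge_1 by (intro mult_right_mono) simp_all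
  then show ?thesis by (simp add: alg_norm_def add_increasing2)
qed

lemma alg_norm_conv:
  assumes "0 \<le> \<epsilon>" "alg_norm \<theta> \<epsilon> u < \<infinity>" "alg_norm \<theta> \<epsilon> v < \<infinity>"
  shows "alg_norm \<theta> \<epsilon> (conv u v) \<le> alg_norm \<theta> \<epsilon> u * alg_norm \<theta> \<epsilon> v"
proof -
  let ?u = "weighted \<epsilon> u" and ?v = "weighted \<epsilon> v" and ?k = "of_nat \<kappa> :: ennreal"
  let ?P = op_norm and ?E = "split_norm C"
  have fin: "?P ?u < \<infinity>" "?P ?v < \<infinity>"
    using assms(2,3) op_norm_le_alg_norm by (metis le_less_trans)+
  have k: "1 \<le> ?k" using \<kappa>_ge_1 by simp
  have "alg_norm \<theta> \<epsilon> (conv u v) \<le> ?k * ?P (conv ?u ?v) + ennreal \<theta> * ?E (conv ?u ?v)"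
    unfolding alg_norm_def
    by (intro add_mono mult_left_mono op_norm_mono split_norm_mono weighted_conv_le[OF assms(1)]) auto
  also have "\<dots> \<le> ?k * (?P ?u * ?P ?v) + ennreal \<theta> * (?k * (?P ?v * ?E ?u + ?P ?u * ?E ?v))"
    by (intro add_mono mult_left_mono op_norm_conv split_norm_conv_le fin) auto
  also have "\<dots> \<le> (?k * ?k) * (?P ?u * ?P ?v) + ennreal \<theta> * (?k * (?P ?v * ?E ?u + ?P ?u * ?E ?v))"
    using mult_right_mono[OF k, of ?k] by (intro add_mono mult_right_mono) auto
  also have "\<dots> \<le> (?k * ?k) * (?P ?u * ?P ?v) + ennreal \<theta> * (?k * (?P ?v * ?E ?u + ?P ?u * ?E ?v))
      + ennreal \<theta> * ?E ?u * (ennreal \<theta> * ?E ?v)"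
    by (rule add_increasing2) auto
  also have "\<dots> = alg_norm \<theta> \<epsilon> u * alg_norm \<theta> \<epsilon> v"
    by (simp add: alg_norm_def distrib_left distrib_right ac_simps)
  finally show ?thesis .
qed

text \<open>A weak form of Fatou's lemma: the factor \<open>2\<close> arises from estimating both summands of
  \<open>alg_norm\<close> separately.\<close>

lemma alg_norm_liminf:
  assumes "\<And>n. alg_norm \<theta> \<epsilon> (u n) \<le> c"
  shows "alg_norm \<theta> \<epsilon> (\<lambda>g. liminf (\<lambda>n. u n g)) \<le> 2 * c"
proof -
  have *: "a * ker_norm \<K> (weighted \<epsilon> (\<lambda>g. liminf (\<lambda>n. u n g))) \<le> c"
    if "\<And>n. a * ker_norm \<K> (weighted \<epsilon> (u n)) \<le> c" for a and \<K> :: "('g \<Rightarrow> 'g \<Rightarrow> ennreal) set"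
  proof -
    have "a * ker_norm \<K> (weighted \<epsilon> (\<lambda>g. liminf (\<lambda>n. u n g)))
        = ker_norm \<K> (\<lambda>g. (a * weight \<epsilon> g) * liminf (\<lambda>n. u n g))"
      by (simp add: ker_norm_cmult[symmetric] mult.assoc)
    also have "\<dots> \<le> ker_norm \<K> (\<lambda>g. liminf (\<lambda>n. (a * weight \<epsilon> g) * u n g))"
      by (intro ker_norm_mono mult_liminf_le)
    also have "\<dots> \<le> c"
      using that by (intro ker_norm_liminf) (simp add: ker_norm_cmult[symmetric] mult.assoc)
    finally show ?thesis .
  qed
  have "of_nat \<kappa> * op_norm (weighted \<epsilon> (u n)) \<le> c" "ennreal \<theta> * split_norm C (weighted \<epsilon> (u n)) \<le> c" for n
    using assms[of n] unfolding alg_norm_def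
    by (rule order_trans[rotated]; simp)+
  then have "of_nat \<kappa> * op_norm (weighted \<epsilon> (\<lambda>g. liminf (\<lambda>n. u n g))) \<le> c"
    "ennreal \<theta> * split_norm C (weighted \<epsilon> (\<lambda>g. liminf (\<lambda>n. u n g))) \<le> c"
    unfolding op_norm_def split_norm_def by (intro *; simp)+
  then show ?thesis
    unfolding alg_norm_def by (simp add: add_mono mult_2)
qed

lemma alg_norm_finite_support:
  assumes "finite F" "\<And>g. g \<notin> F \<Longrightarrow> u g = 0" "\<And>g. u g < \<infinity>"
  shows "alg_norm \<theta> \<epsilon> u < \<infinity>"
proof -
  have "op_norm (weighted \<epsilon> u) < \<infinity>" "split_norm C (weighted \<epsilon> u) < \<infinity>"
    using assms(2,3)
    by (intro op_norm_finite_support[OF assms(1)] split_norm_finite_support[OF assms(1)];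
        simp add: ennreal_mult_less_top)+
  then show ?thesis
    by (simp add: alg_norm_def ennreal_mult_less_top of_nat_less_top)
qed

lemma op_norm_abscoef_le_alg_norm: "0 \<le> \<epsilon> \<Longrightarrow> op_norm u \<le> alg_norm \<theta> \<epsilon> u"
proof -
  assume "0 \<le> \<epsilon>"
  then have "u g \<le> weight \<epsilon> g * u g" for g
    using mult_right_mono[OF weight_mono[of 0 \<epsilon> g], of "u g"] by simp
  then show ?thesis
    using op_norm_mono[of u "weighted \<epsilon> u"] op_norm_le_alg_norm order_trans by blast
qed

lemma norm_le_alg_norm:
  assumes "T \<in> reduced_cstar" "0 \<le> \<epsilon>"
  shows "ennreal (norm T) \<le> alg_norm \<theta> \<epsilon> (abscoef T)"
  using norm_le_op_norm[OF assms(1)] op_norm_abscoef_le_alg_norm[OF assms(2)] by (rule order_trans)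

lemma alg_norm_left_regular: "alg_norm \<theta> \<epsilon> (abscoef (left_regular a)) < \<infinity>"
  by (rule alg_norm_finite_support[of "Poly_Mapping.keys a"]) (auto simp: abscoef_def in_keys_iff)

lemma alg_norm_compose:
  assumes "T \<in> reduced_cstar" "0 \<le> \<epsilon>"
    "alg_norm \<theta> \<epsilon> (abscoef T) < \<infinity>" "alg_norm \<theta> \<epsilon> (abscoef U) < \<infinity>"
  shows "alg_norm \<theta> \<epsilon> (abscoef (T o\<^sub>L U)) \<le> alg_norm \<theta> \<epsilon> (abscoef T) * alg_norm \<theta> \<epsilon> (abscoef U)"
  using alg_norm_mono[OF abscoef_compose_le[OF assms(1)]] alg_norm_conv[OF assms(2-4)]
  by (rule order_trans)

lemma alg_norm_limit:
  assumes "\<And>g. (\<lambda>n. coef (U n) g) \<longlonglongrightarrow> coef T g" "\<And>n. alg_norm \<theta> \<epsilon> (abscoef (U n)) \<le> c"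
  shows "alg_norm \<theta> \<epsilon> (abscoef T) \<le> 2 * c"
proof -
  have "liminf (\<lambda>n. abscoef (U n) g) = abscoef T g" for g
    unfolding abscoef_def by (intro lim_imp_Liminf tendsto_intros assms) simp
  then show ?thesis using alg_norm_liminf[of \<theta> \<epsilon> "\<lambda>n. abscoef (U n)" c, OF assms(2)] by simp
qed

definition smooth :: "real \<Rightarrow> 'g ell2_op set" where
  "smooth \<epsilon> = {T \<in> reduced_cstar. alg_norm 1 \<epsilon> (abscoef T) < \<infinity>}"

definition smooth_norm :: "real \<Rightarrow> 'g ell2_op \<Rightarrow> real" where
  "smooth_norm \<epsilon> T = enn2real (alg_norm 1 \<epsilon> (abscoef T))"

lemma smooth_norm: "T \<in> smooth \<epsilon> \<Longrightarrow> ennreal (smooth_norm \<epsilon> T) = alg_norm 1 \<epsilon> (abscoef T)"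
  by (simp add: smooth_def smooth_norm_def)

lemma smooth_norm_nonneg [simp]: "0 \<le> smooth_norm \<epsilon> T"
  by (simp add: smooth_norm_def)

lemma smooth_normI:
  assumes "T \<in> reduced_cstar" "alg_norm 1 \<epsilon> (abscoef T) \<le> ennreal c" "0 \<le> c"
  shows "T \<in> smooth \<epsilon> \<and> smooth_norm \<epsilon> T \<le> c"
proof -
  have "T \<in> smooth \<epsilon>" using assms(1,2) by (auto simp: smooth_def intro: le_less_trans)
  moreover from smooth_norm[OF this] have "smooth_norm \<epsilon> T \<le> c"
    using assms(2,3) by (metis ennreal_le_iff)
  ultimately show ?thesis ..
qed

lemma smooth_add:
  assumes "T \<in> smooth \<epsilon>" "U \<in> smooth \<epsilon>"
  shows "T + U \<in> smooth \<epsilon> \<and> smooth_norm \<epsilon> (T + U) \<le> smooth_norm \<epsilon> T + smooth_norm \<epsilon> U"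
proof (rule smooth_normI)
  have "alg_norm 1 \<epsilon> (abscoef (T + U)) \<le> alg_norm 1 \<epsilon> (abscoef T) + alg_norm 1 \<epsilon> (abscoef U)"
    by (rule order_trans[OF alg_norm_mono[OF abscoef_add_le] alg_norm_add])
  then show "alg_norm 1 \<epsilon> (abscoef (T + U)) \<le> ennreal (smooth_norm \<epsilon> T + smooth_norm \<epsilon> U)"
    using assms by (simp add: smooth_norm)
qed (use assms in \<open>auto simp: smooth_def\<close>)

lemma smooth_scaleC:
  assumes "T \<in> smooth \<epsilon>"
  shows "c *\<^sub>C T \<in> smooth \<epsilon> \<and> smooth_norm \<epsilon> (c *\<^sub>C T) = cmod c * smooth_norm \<epsilon> T"
proof -
  have "alg_norm 1 \<epsilon> (abscoef (c *\<^sub>C T)) = ennreal (cmod c) * alg_norm 1 \<epsilon> (abscoef T)"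
    by (simp add: abscoef_scaleC[abs_def] alg_norm_cmult)
  then show ?thesis
    using assms by (simp add: smooth_def smooth_norm_def ennreal_mult_less_top enn2real_mult)
qed

lemma smooth_compose:
  assumes "0 \<le> \<epsilon>" "T \<in> smooth \<epsilon>" "U \<in> smooth \<epsilon>"
  shows "T o\<^sub>L U \<in> smooth \<epsilon> \<and> smooth_norm \<epsilon> (T o\<^sub>L U) \<le> smooth_norm \<epsilon> T * smooth_norm \<epsilon> U"
proof (rule smooth_normI)
  show "alg_norm 1 \<epsilon> (abscoef (T o\<^sub>L U)) \<le> ennreal (smooth_norm \<epsilon> T * smooth_norm \<epsilon> U)"
    using assms alg_norm_compose[of T \<epsilon> 1 U] by (simp add: ennreal_mult smooth_norm) (simp add: smooth_def)
qed (use assms in \<open>auto simp: smooth_def\<close>)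

lemma smooth_diff:
  assumes "T \<in> smooth \<epsilon>" "U \<in> smooth \<epsilon>"
  shows "T - U \<in> smooth \<epsilon>"
  using assms smooth_add smooth_scaleC by (simp add: diff_conv_scaleC)

lemma left_regular_smooth [simp]: "left_regular a \<in> smooth \<epsilon>"
  using alg_norm_left_regular[of 1 \<epsilon> a] by (simp add: smooth_def)

lemma norm_le_smooth_norm: "T \<in> smooth \<epsilon> \<Longrightarrow> 0 \<le> \<epsilon> \<Longrightarrow> norm T \<le> smooth_norm \<epsilon> T"
  using norm_le_alg_norm[of T \<epsilon> 1] smooth_norm[of T \<epsilon>] ennreal_le_iff[of "smooth_norm \<epsilon> T" "norm T"]
  by (metis (mono_tags, lifting) mem_Collect_eq smooth_def smooth_norm_nonneg)

lemma smooth_antimono: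
  assumes "\<epsilon> \<le> \<epsilon>'" "T \<in> smooth \<epsilon>'"
  shows "T \<in> smooth \<epsilon> \<and> smooth_norm \<epsilon> T \<le> smooth_norm \<epsilon>' T"
  using assms alg_norm_exponent_mono[OF assms(1), of 1 "abscoef T"] smooth_norm[OF assms(2)]
  by (intro smooth_normI) (auto simp: smooth_def)

lemma subalgebra_smooth: "0 \<le> \<epsilon> \<Longrightarrow> subalgebra_op (smooth \<epsilon>)"
  using smooth_add smooth_compose smooth_scaleC left_regular_smooth[of 0]
  unfolding subalgebra_op_def left_regular_zero by blast

text \<open>A Cauchy sequence converges in the operator norm. The limit and the distances to it are
  controlled by the lower semicontinuity of the norm under convergence of coefficients.\<close>

lemma smooth_complete:
  assumes \<epsilon>: "0 \<le> \<epsilon>" and s: "range s \<subseteq> smooth \<epsilon>"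
    and Cauchy: "\<forall>e>0. \<exists>M. \<forall>m\<ge>M. \<forall>n\<ge>M. smooth_norm \<epsilon> (s m - s n) < e"
  shows "\<exists>T\<in>smooth \<epsilon>. (\<lambda>n. smooth_norm \<epsilon> (s n - T)) \<longlonglongrightarrow> 0"
proof -
  have s': "s n \<in> smooth \<epsilon>" "s n \<in> reduced_cstar" for n
    using s by (auto simp: smooth_def)
  have "Cauchy s"
  proof (rule CauchyI)
    fix e :: real assume "0 < e"
    then obtain M where "\<forall>m\<ge>M. \<forall>n\<ge>M. smooth_norm \<epsilon> (s m - s n) < e" using Cauchy by blast
    then show "\<exists>M. \<forall>m\<ge>M. \<forall>n\<ge>M. norm (s m - s n) < e"
      using norm_le_smooth_norm[OF smooth_diff[OF s'(1) s'(1)] \<epsilon>] by (meson le_less_trans)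
  qed
  then obtain T where T: "s \<longlonglongrightarrow> T"
    using Cauchy_convergent convergent_def by blast
  have "T \<in> reduced_cstar"
    using closed_sequentially[OF closed_closure _ T] s'(2) unfolding reduced_cstar_def by blast
  have coef: "(\<lambda>m. coef (s n - s (m + M)) g) \<longlonglongrightarrow> coef (s n - T) g" for n M g
  proof -
    have "(\<lambda>m. s (m + M) - T) \<longlonglongrightarrow> 0"
      using LIMSEQ_ignore_initial_segment[OF T, of M] by (simp add: LIM_zero)
    then have "(\<lambda>m. norm (s (m + M) - T)) \<longlonglongrightarrow> 0" by (rule tendsto_norm_zero)
    then have "(\<lambda>m. coef (s (m + M) - T) g) \<longlonglongrightarrow> 0"
      by (rule Lim_null_comparison[rotated]) (simp only: cmod_coef_le eventually_True)
    then have "(\<lambda>m. coef (s n) g - coef T g - coef (s (m + M) - T) g) \<longlonglongrightarrow> coef (s n) g - coef T g - 0"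
      by (intro tendsto_diff tendsto_const)
    then show ?thesis by simp
  qed
  have bound: "s n - T \<in> smooth \<epsilon> \<and> smooth_norm \<epsilon> (s n - T) \<le> 2 * e"
    if "\<And>m. M \<le> m \<Longrightarrow> smooth_norm \<epsilon> (s n - s m) < e" "0 \<le> e" for n M e
  proof (rule smooth_normI)
    have "alg_norm 1 \<epsilon> (abscoef (s n - T)) \<le> 2 * ennreal e"
    proof (rule alg_norm_limit[OF coef])
      fix m
      have "smooth_norm \<epsilon> (s n - s (m + M)) \<le> e" using that(1)[of "m + M"] by simp
      then show "alg_norm 1 \<epsilon> (abscoef (s n - s (m + M))) \<le> ennreal e"
        using smooth_norm[OF smooth_diff[OF s'(1) s'(1)], of n "m + M"] by (metis ennreal_leI)
    qed
    then show "alg_norm 1 \<epsilon> (abscoef (s n - T)) \<le> ennreal (2 * e)"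
      by (simp add: ennreal_mult that(2))
  qed (use s' \<open>T \<in> reduced_cstar\<close> that(2) in auto)
  obtain M where "\<forall>m\<ge>M. \<forall>n\<ge>M. smooth_norm \<epsilon> (s m - s n) < 1"
    using Cauchy by (meson zero_less_one)
  then have "s M - T \<in> smooth \<epsilon>" using bound[of M M 1] by simp
  from smooth_diff[OF s'(1)[of M] this] have "T \<in> smooth \<epsilon>" by simp
  moreover have "(\<lambda>n. smooth_norm \<epsilon> (s n - T)) \<longlonglongrightarrow> 0"
  proof (rule LIMSEQ_I)
    fix e :: real assume "0 < e"
    then obtain M where "\<forall>m\<ge>M. \<forall>n\<ge>M. smooth_norm \<epsilon> (s m - s n) < e / 3"
      using Cauchy by (meson divide_pos_pos zero_less_numeral)
    then have "smooth_norm \<epsilon> (s n - T) \<le> 2 * (e / 3)" if "n \<ge> M" for n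
      using bound[of M n "e / 3"] that \<open>0 < e\<close> by simp
    then have "norm (smooth_norm \<epsilon> (s n - T) - 0) < e" if "n \<ge> M" for n
      using that \<open>0 < e\<close> by fastforce
    then show "\<exists>M. \<forall>n\<ge>M. norm (smooth_norm \<epsilon> (s n - T) - 0) < e" by blast
  qed
  ultimately show ?thesis by blast
qed

lemma banach_algebra_norm_smooth:
  assumes "0 \<le> \<epsilon>"
  shows "banach_algebra_norm (smooth \<epsilon>) (smooth_norm \<epsilon>)"
proof -
  have "smooth_norm \<epsilon> T = 0 \<longleftrightarrow> T = 0" if "T \<in> smooth \<epsilon>" for T
  proof
    assume "smooth_norm \<epsilon> T = 0"
    then show "T = 0" using norm_le_smooth_norm[OF that assms] by simp
  next
    assume "T = 0"
    moreover have "smooth_norm \<epsilon> (0 *\<^sub>C T) = 0" "(0 *\<^sub>C T) = 0"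
      using smooth_scaleC[OF that, of 0] by (auto intro: ell2_op_eqI)
    ultimately show "smooth_norm \<epsilon> T = 0" by simp
  qed
  then show ?thesis
    unfolding banach_algebra_norm_def
    using smooth_add smooth_compose[OF assms] smooth_scaleC smooth_complete[OF assms]
    by (auto 0 3)
qed

end

section \<open>Inverses\<close>

lemma exp_difference_bound:
  fixes p q t \<epsilon> l :: real
  assumes "\<bar>p - q\<bar> \<le> t * l" "0 < \<epsilon>" "0 \<le> t" "t \<le> \<epsilon> / 2" "0 \<le> l"
  shows "\<bar>exp p - exp q\<bar> \<le> 2 * t / \<epsilon> * exp (\<epsilon> * l) * exp q"
proof -
  define r a where "r = p - q" and "a = t * l"
  have "\<bar>exp r - 1\<bar> \<le> a * exp a"
  proof (cases "0 \<le> r")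
    case True
    have "exp r * (1 - r) \<le> exp r * exp (- r)"
      using exp_ge_add_one_self[of "- r"] by (intro mult_left_mono) auto
    then have "exp r - 1 \<le> r * exp r" by (simp add: algebra_simps flip: exp_add)
    also have "\<dots> \<le> a * exp a" using True assms(1) by (intro mult_mono) (auto simp: r_def a_def)
    finally show ?thesis using True by simp
  next
    case False
    have "\<bar>exp r - 1\<bar> \<le> - r" using False by simp (use exp_ge_add_one_self[of r] in linarith)
    also have "\<dots> \<le> a * 1" using assms(1) by (simp add: r_def a_def)
    also have "\<dots> \<le> a * exp a" using assms by (intro mult_left_mono) (auto simp: a_def)
    finally show ?thesis .
  qed
  also have "a = 2 * t / \<epsilon> * (\<epsilon> * l / 2)" using assms by (simp add: a_def)
  also have "2 * t / \<epsilon> * (\<epsilon> * l / 2) * exp (2 * t / \<epsilon> * (\<epsilon> * l / 2))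
      \<le> 2 * t / \<epsilon> * exp (\<epsilon> * l / 2) * exp (\<epsilon> * l / 2)"
  proof -
    have "\<epsilon> * l / 2 \<le> exp (\<epsilon> * l / 2)" using exp_ge_add_one_self[of "\<epsilon> * l / 2"] by linarith
    moreover have "2 * t / \<epsilon> * (\<epsilon> * l / 2) \<le> 1 * (\<epsilon> * l / 2)"
      using assms by (intro mult_right_mono) (auto simp: field_simps)
    ultimately show ?thesis using assms by (intro mult_mono) auto
  qed
  also have "\<dots> = 2 * t / \<epsilon> * exp (\<epsilon> * l)"
    by (simp add: mult.assoc flip: exp_add)
  finally have "exp q * \<bar>exp r - 1\<bar> \<le> exp q * (2 * t / \<epsilon> * exp (\<epsilon> * l))"
    by (intro mult_left_mono) auto
  moreover have "exp p - exp q = exp q * (exp r - 1)"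
    by (simp add: r_def right_diff_distrib flip: exp_add)
  ultimately show ?thesis by (simp add: abs_mult ac_simps)
qed

context word_metric
begin

text \<open>Cutting off the weight makes multiplication by it a bounded operator on \<open>\<ell>\<^sup>2\<close>.\<close>

definition cut_weight :: "real \<Rightarrow> nat \<Rightarrow> 'g \<Rightarrow> real" where
  "cut_weight t R x = exp (t * min (real (len x)) (real R))"

lemma cut_weight_difference:
  assumes "0 < \<epsilon>" "0 \<le> t" "t \<le> \<epsilon> / 2"
  shows "\<bar>cut_weight t R x - cut_weight t R y\<bar>
    \<le> 2 * t / \<epsilon> * exp (\<epsilon> * len (x - y)) * cut_weight t R y"
proof -
  have "len x \<le> len (x - y) + len y" using len_add[of "x - y" y] by simp
  moreover have "len y \<le> len (x - y) + len x"
    using len_add[of "- (x - y)" x] len_uminus[of "x - y"] by simp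
  ultimately have "\<bar>min (real (len x)) (real R) - min (real (len y)) (real R)\<bar> \<le> len (x - y)"
    by (simp add: min_def abs_le_iff)
  then have "\<bar>t * min (real (len x)) (real R) - t * min (real (len y)) (real R)\<bar> \<le> t * len (x - y)"
    using assms(2) by (simp add: abs_mult mult_left_mono flip: right_diff_distrib)
  then show ?thesis
    unfolding cut_weight_def using assms by (intro exp_difference_bound) auto
qed

lemma ell2_cut_weight:
  assumes "0 \<le> t"
  obtains \<xi> where "\<And>x. ell2_apply \<xi> x = of_real (cut_weight t R x) * ell2_apply \<eta> x"
proof -
  have "nrm (\<lambda>x. ennreal (cmod (of_real (cut_weight t R x) * ell2_apply \<eta> x)))
      \<le> nrm (\<lambda>x. ennreal (exp (t * R)) * ell2_abs \<eta> x)"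
    using assms
    by (intro nrm_mono) (auto simp: norm_mult cut_weight_def ell2_abs_def ennreal_mult
        intro!: mult_right_mono mult_left_mono ennreal_leI)
  also have "\<dots> < \<infinity>" by (simp add: nrm_cmult ennreal_mult_less_top)
  finally show ?thesis using that by (metis ell2_of_nrm_finite)
qed

text \<open>Conjugating \<open>T\<close> by multiplication with the weight of exponent \<open>t\<close> changes it by an operator
  whose norm tends to \<open>0\<close> with \<open>t\<close>. For small \<open>t\<close> the conjugate stays invertible, and this bounds
  the weighted vector \<open>\<xi>\<close> obtained from \<open>\<eta> = b (ell2_basis 0)\<close>, the coefficient function of
  \<open>b\<close>. The bound is independent of the length \<open>R\<close> at which the weight is cut off.\<close>

lemma inverse_exponential_decay:
  assumes T: "T \<in> reduced_cstar" and inv: "b o\<^sub>L T = id_blinfun" "T o\<^sub>L b = id_blinfun"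
    and \<epsilon>: "0 < \<epsilon>" and fin: "op_norm (\<lambda>g. weight \<epsilon> g * abscoef T g) < \<infinity>"
  obtains t where "0 < t" "nrm (\<lambda>g. weight t g * abscoef b g) < \<infinity>"
proof -
  define u where "u = (\<lambda>g. weight \<epsilon> g * abscoef T g)"
  obtain A where A: "op_norm u = ennreal A" "0 \<le> A"
    using fin by (cases "op_norm u") (auto simp: u_def)
  define \<beta> where "\<beta> = norm b"
  \<comment> \<open>The perturbation is bounded by \<open>2 * t / \<epsilon> * A\<close>; multiplied by the norm \<open>\<beta>\<close> of the inverse
    this is to be at most \<open>1 / 2\<close>.\<close>
  define q where "q = A * \<beta>"
  define t where "t = \<epsilon> / (4 * q + 2)"
  have "0 \<le> q" using A by (simp add: q_def \<beta>_def)
  moreover have "2 * t / \<epsilon> = 2 / (4 * q + 2)" using \<epsilon> by (simp add: t_def)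
  ultimately have "0 < t" "t \<le> \<epsilon> / 2" "2 * t / \<epsilon> * q \<le> 1 / 2"
    using \<epsilon> by (auto simp: t_def divide_simps)
  then have t: "0 < t" "t \<le> \<epsilon> / 2" "2 * t / \<epsilon> * (A * \<beta>) \<le> 1 / 2"
    by (simp_all add: q_def)
  define \<eta> where "\<eta> = b (ell2_basis 0)"
  have T\<eta>: "T \<eta> = ell2_basis 0"
    using arg_cong[OF inv(2), of "\<lambda>U. blinfun_apply U (ell2_basis 0)"] by (simp add: \<eta>_def)
  have bT: "b (T \<xi>) = \<xi>" for \<xi>
    using arg_cong[OF inv(1), of "\<lambda>U. blinfun_apply U \<xi>"] by simp
  have norm_\<eta>: "norm \<eta> \<le> \<beta>"
    using norm_blinfun[of b "ell2_basis 0"] by (simp add: \<eta>_def \<beta>_def)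
  have bound: "nrm (\<lambda>x. ennreal (cut_weight t R x) * ell2_abs \<eta> x) \<le> ennreal (2 * \<beta>)" for R
  proof -
    let ?\<omega> = "cut_weight t R"
    obtain \<xi> where \<xi>: "\<And>x. ell2_apply \<xi> x = of_real (?\<omega> x) * ell2_apply \<eta> x"
      using ell2_cut_weight[of t R \<eta>] t by auto
    have \<omega>_nonneg: "0 \<le> ?\<omega> x" for x by (simp add: cut_weight_def)
    then have \<xi>_abs: "ell2_abs \<xi> x = ennreal (?\<omega> x) * ell2_abs \<eta> x" for x
      by (simp add: ell2_abs_def \<xi> norm_mult ennreal_mult)
    \<comment> \<open>The weight is \<open>1\<close> at \<open>0\<close>, so \<open>v\<close> is the commutator of the weight with \<open>T\<close>, applied
      to \<open>\<eta>\<close>.\<close>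
    define v where "v = ell2_basis 0 - T \<xi>"
    have v_le: "ell2_abs v x \<le> ennreal (2 * t / \<epsilon>) * conv u (ell2_abs \<xi>) x" for x
    proof -
      let ?F = "\<lambda>y. coef T (x - y) * ell2_apply \<eta> y" and ?G = "\<lambda>y. coef T (x - y) * ell2_apply \<xi> y"
      let ?H = "\<lambda>y. of_real (?\<omega> x) * ?F y - ?G y"
      have sums: "?F summable_on UNIV" "?G summable_on UNIV"
        unfolding coef_def by (rule abs_summable_summable, rule convolution_summable(2))+
      have H_le: "ennreal (cmod (?H y)) \<le> ennreal (2 * t / \<epsilon>) * (u (x - y) * ell2_abs \<xi> y)" for y
      proof -
        have "?H y = coef T (x - y) * (of_real (?\<omega> x - ?\<omega> y) * ell2_apply \<eta> y)"
          by (simp add: \<xi> algebra_simps)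
        then have "cmod (?H y) = cmod (coef T (x - y)) * (\<bar>?\<omega> x - ?\<omega> y\<bar> * cmod (ell2_apply \<eta> y))"
          by (simp add: norm_mult del: of_real_diff)
        also have "\<dots> \<le> cmod (coef T (x - y)) *
            (2 * t / \<epsilon> * exp (\<epsilon> * len (x - y)) * ?\<omega> y * cmod (ell2_apply \<eta> y))"
          using t \<epsilon> by (intro mult_left_mono mult_right_mono cut_weight_difference) auto
        also have "\<dots> = 2 * t / \<epsilon> * (exp (\<epsilon> * len (x - y)) * cmod (coef T (x - y)) *
            (?\<omega> y * cmod (ell2_apply \<eta> y)))"
          by simp
        finally have "ennreal (cmod (?H y)) \<le> ennreal (2 * t / \<epsilon> * (exp (\<epsilon> * len (x - y)) *
            cmod (coef T (x - y)) * (?\<omega> y * cmod (ell2_apply \<eta> y))))"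
          by (rule ennreal_leI)
        also have "\<dots> = ennreal (2 * t / \<epsilon>) * (ennreal (exp (\<epsilon> * len (x - y))) *
            ennreal (cmod (coef T (x - y))) * (ennreal (?\<omega> y) * ennreal (cmod (ell2_apply \<eta> y))))"
          using t \<epsilon> \<omega>_nonneg by (subst ennreal_mult; (subst ennreal_mult)?; simp add: ennreal_mult)
        also have "\<dots> = ennreal (2 * t / \<epsilon>) * (u (x - y) * ell2_abs \<xi> y)"
          by (simp only: u_def weight_def abscoef_def \<xi>_abs) (simp only: ell2_abs_def)
        finally show ?thesis .
      qed
      have esum_H: "(\<Sum>\<^sup>+y. ennreal (cmod (?H y))) \<le> ennreal (2 * t / \<epsilon>) * conv u (ell2_abs \<xi>) x"
        unfolding conv_alt using H_le by (simp add: nn_integral_cmult[symmetric] nn_integral_mono)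
      also have "\<dots> < \<infinity>"
      proof -
        have "conv u (ell2_abs \<xi>) x \<le> op_norm u * nrm (ell2_abs \<xi>)"
          by (rule order_trans[OF member_le_nrm nrm_conv_le_op_norm]) simp
        also have "\<dots> < \<infinity>" by (simp add: A ennreal_mult_less_top)
        finally show ?thesis by (simp add: ennreal_mult_less_top)
      qed
      finally have H_abs: "(\<lambda>y. cmod (?H y)) summable_on UNIV"
        by (intro summable_on_if_esum_finite) auto
      have "ell2_apply v x = of_real (?\<omega> x) * ell2_apply (T \<eta>) x - ell2_apply (T \<xi>) x"
        by (simp add: v_def T\<eta> ell2_basis.rep_eq cut_weight_def)
      also have "\<dots> = (\<Sum>\<^sub>\<infinity>y. of_real (?\<omega> x) * ?F y) - (\<Sum>\<^sub>\<infinity>y. ?G y)"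
        by (simp add: reduced_cstar_apply[OF T] infsum_cmult_right')
      also have "(\<Sum>\<^sub>\<infinity>y. of_real (?\<omega> x) * ?F y) = (\<Sum>\<^sub>\<infinity>y. ?H y + ?G y)"
        by simp
      also have "\<dots> = (\<Sum>\<^sub>\<infinity>y. ?H y) + (\<Sum>\<^sub>\<infinity>y. ?G y)"
        by (rule infsum_add[OF abs_summable_summable[OF H_abs] sums(2)])
      finally have "ell2_apply v x = (\<Sum>\<^sub>\<infinity>y. ?H y)" by simp
      then have "ell2_abs v x \<le> (\<Sum>\<^sup>+y. ennreal (cmod (?H y)))"
        unfolding ell2_abs_def using cmod_infsum_le[OF H_abs] by simp
      then show ?thesis using esum_H by (rule order_trans)
    qed
    have "ennreal (norm v) \<le> nrm (\<lambda>x. ennreal (2 * t / \<epsilon>) * conv u (ell2_abs \<xi>) x)"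
      using nrm_mono[of "ell2_abs v"] v_le by simp
    also have "\<dots> \<le> ennreal (2 * t / \<epsilon>) * (op_norm u * nrm (ell2_abs \<xi>))"
      unfolding nrm_cmult by (intro mult_left_mono nrm_conv_le_op_norm) auto
    also have "\<dots> = ennreal (2 * t / \<epsilon> * (A * norm \<xi>))"
      unfolding A nrm_ell2_abs using A(2) t(1) \<epsilon> by (subst ennreal_mult; simp add: ennreal_mult)
    finally have norm_v: "norm v \<le> 2 * t / \<epsilon> * (A * norm \<xi>)"
      using A t \<epsilon> by simp
    have "\<xi> = \<eta> - b v"
      by (simp add: v_def blinfun.diff_right bT \<eta>_def)
    then have "norm \<xi> \<le> norm \<eta> + norm (b v)" by (metis norm_triangle_ineq4)
    also have "\<dots> \<le> \<beta> + \<beta> * norm v"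
      using norm_\<eta> norm_blinfun[of b v] by (simp add: \<beta>_def add_mono)
    also have "\<dots> \<le> \<beta> + \<beta> * (2 * t / \<epsilon> * (A * norm \<xi>))"
      using norm_v by (intro add_left_mono mult_left_mono) (auto simp: \<beta>_def)
    also have "\<dots> = \<beta> + 2 * t / \<epsilon> * (A * \<beta>) * norm \<xi>" by simp
    also have "\<dots> \<le> \<beta> + 1 / 2 * norm \<xi>"
      using t by (intro add_left_mono mult_right_mono) auto
    finally have "norm \<xi> \<le> 2 * \<beta>" by simp
    then have "nrm (ell2_abs \<xi>) \<le> ennreal (2 * \<beta>)" by (simp add: ennreal_leI)
    moreover have "ell2_abs \<xi> = (\<lambda>x. ennreal (?\<omega> x) * ell2_abs \<eta> x)" using \<xi>_abs by blast
    ultimately show ?thesis by simp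
  qed
  have "liminf (\<lambda>R. ennreal (cut_weight t R g) * ell2_abs \<eta> g) = weight t g * abscoef b g" for g
  proof (rule lim_imp_Liminf)
    have "\<forall>\<^sub>F R in sequentially. ennreal (cut_weight t R g) * ell2_abs \<eta> g = weight t g * abscoef b g"
      using eventually_ge_at_top[of "len g"]
      by eventually_elim (simp add: cut_weight_def weight_def abscoef_eq_ell2_abs \<eta>_def min_def)
    then show "(\<lambda>R. ennreal (cut_weight t R g) * ell2_abs \<eta> g) \<longlonglongrightarrow> weight t g * abscoef b g"
      by (rule tendsto_eventually)
  qed simp
  then have "nrm (\<lambda>g. weight t g * abscoef b g) \<le> ennreal (2 * \<beta>)"
    using nrm_liminf[of "\<lambda>R x. ennreal (cut_weight t R x) * ell2_abs \<eta> x", OF bound] by simp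
  then have "nrm (\<lambda>g. weight t g * abscoef b g) < \<infinity>" by (rule le_less_trans) simp
  then show ?thesis using that t(1) by blast
qed

end

context split_algebra
begin

definition truncate :: "nat \<Rightarrow> 'g ell2_op \<Rightarrow> 'g ell2_op" where
  "truncate n b = left_regular (Abs_poly_mapping (\<lambda>g. if len g \<le> n then coef b g else 0))"

lemma coef_truncate: "coef (truncate n b) g = (if len g \<le> n then coef b g else 0)"
proof -
  have "finite {g. (if len g \<le> n then coef b g else 0) \<noteq> 0}"
    by (rule finite_subset[OF _ finite_len_ball[of n]]) auto
  then show ?thesis by (simp add: truncate_def)
qed

lemma truncate_smooth [simp]: "truncate n b \<in> smooth \<epsilon>"
  by (simp add: truncate_def)

lemma smooth_reduced_cstar: "T \<in> smooth \<epsilon> \<Longrightarrow> T \<in> reduced_cstar"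
  by (simp add: smooth_def)

lemma op_norm_compose:
  assumes "T \<in> reduced_cstar" "0 \<le> \<epsilon>" "op_norm (weighted \<epsilon> (abscoef U)) < \<infinity>"
  shows "op_norm (weighted \<epsilon> (abscoef (T o\<^sub>L U)))
    \<le> op_norm (weighted \<epsilon> (abscoef T)) * op_norm (weighted \<epsilon> (abscoef U))"
proof -
  have "weight \<epsilon> g * abscoef (T o\<^sub>L U) g \<le> conv (weighted \<epsilon> (abscoef T)) (weighted \<epsilon> (abscoef U)) g" for g
    by (rule order_trans[OF mult_left_mono[OF abscoef_compose_le[OF assms(1)]] weighted_conv_le[OF assms(2)]]) simp
  then show ?thesis
    using op_norm_mono op_norm_conv[OF assms(3)] by (meson order_trans)
qed

text \<open>If the remainder \<open>c = 1 - T b'\<close> is small, then \<open>b\<close> is given by the Neumann series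
  \<open>b' + b' c + b' c\<^sup>2 + \<dots>\<close>. The remainder is small for \<open>op_norm\<close> only, but its finite
  \<open>split_norm\<close> is compensated by a small \<open>\<theta>\<close>. The partial sums \<open>X m\<close> converge to \<open>b\<close> in the operator
  norm and are bounded for \<open>alg_norm \<theta> \<epsilon>\<close>.\<close>

lemma smooth_inverse_of_approximate_inverse:
  assumes \<epsilon>: "0 \<le> \<epsilon>" and T: "T \<in> smooth \<epsilon>" and b: "b \<in> reduced_cstar" "b o\<^sub>L T = id_blinfun"
    and b': "b' \<in> smooth \<epsilon>"
    and small: "of_nat \<kappa> * op_norm (weighted \<epsilon> (abscoef (id_blinfun - (T o\<^sub>L b')))) \<le> ennreal (1 / 4)"
  shows "b \<in> smooth \<epsilon>"
proof -
  define c where "c = id_blinfun - (T o\<^sub>L b')"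
  have "c \<in> smooth \<epsilon>"
    unfolding c_def left_regular_one[symmetric]
    using T b' \<epsilon> by (intro smooth_diff left_regular_smooth conjunct1[OF smooth_compose])
  then have c: "c \<in> reduced_cstar" "alg_norm 1 \<epsilon> (abscoef c) < \<infinity>" by (auto simp: smooth_def)
  have "split_norm C (weighted \<epsilon> (abscoef c)) \<le> alg_norm 1 \<epsilon> (abscoef c)"
    by (simp add: alg_norm_def)
  then have "split_norm C (weighted \<epsilon> (abscoef c)) < \<infinity>" using c(2) by (rule le_less_trans)
  then obtain E where E: "split_norm C (weighted \<epsilon> (abscoef c)) = ennreal E" "0 \<le> E"
    by (cases "split_norm C (weighted \<epsilon> (abscoef c))") auto
  define \<theta> where "\<theta> = 1 / (4 * E + 4)"
  have \<theta>: "0 < \<theta>" "\<theta> \<le> 1" "\<theta> * E \<le> 1 / 4" using E by (auto simp: \<theta>_def field_simps)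
  have "alg_norm \<theta> \<epsilon> (abscoef c) \<le> ennreal (1 / 4) + ennreal (\<theta> * E)"
    using small \<theta> E unfolding alg_norm_def c_def[symmetric] by (simp add: ennreal_mult add_right_mono)
  also have "\<dots> = ennreal (1 / 4 + \<theta> * E)"
    using \<theta> E by (intro ennreal_plus[symmetric]) auto
  also have "\<dots> \<le> ennreal (1 / 2)"
    by (rule ennreal_leI) (use \<theta> in linarith)
  finally have N_c: "alg_norm \<theta> \<epsilon> (abscoef c) \<le> ennreal (1 / 2)" .
  have finite_\<theta>: "alg_norm \<theta> \<epsilon> u < top \<longleftrightarrow> alg_norm 1 \<epsilon> u < top" for u
    using \<theta> \<kappa>_ge_1 by (auto simp: alg_norm_def ennreal_mult_less_top)
  have "alg_norm \<theta> \<epsilon> (abscoef b') < \<infinity>" using b' by (simp add: finite_\<theta> smooth_def)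
  then obtain B where B: "alg_norm \<theta> \<epsilon> (abscoef b') = ennreal B" "0 \<le> B"
    by (cases "alg_norm \<theta> \<epsilon> (abscoef b')") auto
  have b'_red: "b' \<in> reduced_cstar" using b' by (rule smooth_reduced_cstar)
  define X where "X m = ((\<lambda>x. b' + (x o\<^sub>L c)) ^^ m) b'" for m
  have X: "X 0 = b'" "X (Suc m) = b' + (X m o\<^sub>L c)" for m by (simp_all add: X_def)
  have X_red: "X m \<in> reduced_cstar" for m
    using b'_red c(1) by (induction m) (simp_all add: X)
  have N_X: "alg_norm \<theta> \<epsilon> (abscoef (X m)) \<le> ennreal (2 * B)" for m
  proof (induction m)
    case 0
    then show ?case using B by (simp add: X ennreal_leI)
  next
    case (Suc m)
    have fin: "alg_norm \<theta> \<epsilon> (abscoef (X m)) < \<infinity>" "alg_norm \<theta> \<epsilon> (abscoef c) < \<infinity>"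
      unfolding infinity_ennreal_def
      by (rule le_less_trans[OF Suc ennreal_less_top], rule le_less_trans[OF N_c ennreal_less_top])
    have "alg_norm \<theta> \<epsilon> (abscoef (X (Suc m)))
        \<le> alg_norm \<theta> \<epsilon> (abscoef b') + alg_norm \<theta> \<epsilon> (abscoef (X m o\<^sub>L c))"
      unfolding X by (rule order_trans[OF alg_norm_mono[OF abscoef_add_le] alg_norm_add])
    also have "\<dots> \<le> ennreal B + alg_norm \<theta> \<epsilon> (abscoef (X m)) * alg_norm \<theta> \<epsilon> (abscoef c)"
      unfolding B by (intro add_left_mono alg_norm_compose X_red \<epsilon> fin)
    also have "\<dots> \<le> ennreal B + ennreal (2 * B) * ennreal (1 / 2)"
      by (intro add_left_mono mult_mono Suc N_c) auto
    also have "\<dots> = ennreal (2 * B)"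
    proof -
      have "ennreal B + ennreal (2 * B) * ennreal (1 / 2) = ennreal (B + 2 * B * (1 / 2))"
        using B(2) by (subst ennreal_mult[symmetric]; (subst ennreal_plus[symmetric])?; simp)
      then show ?thesis by simp
    qed
    finally show ?case .
  qed
  have bc: "b o\<^sub>L c = b - b'"
  proof (rule blinfun_eqI)
    fix \<xi>
    have "b (T (b' \<xi>)) = b' \<xi>"
      using arg_cong[OF b(2), of "\<lambda>U. blinfun_apply U (b' \<xi>)"] by simp
    then show "(b o\<^sub>L c) \<xi> = (b - b') \<xi>"
      by (simp add: c_def blinfun.diff_left blinfun.diff_right)
  qed
  have "ennreal (norm c) \<le> ennreal (1 / 2)"
    using norm_le_alg_norm[OF c(1) \<epsilon>] N_c by (rule order_trans)
  then have norm_c: "norm c \<le> 1 / 2" by (subst (asm) ennreal_le_iff) simp_all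
  have "norm (X m - b) \<le> norm (X 0 - b) * (1 / 2) ^ m" for m
  proof (induction m)
    case (Suc m)
    have "X (Suc m) - b = (X m - b) o\<^sub>L c"
    proof (rule blinfun_eqI)
      fix \<xi>
      have "b (c \<xi>) = b \<xi> - b' \<xi>"
        using arg_cong[OF bc, of "\<lambda>U. blinfun_apply U \<xi>"] by (simp add: blinfun.diff_left)
      then show "(X (Suc m) - b) \<xi> = ((X m - b) o\<^sub>L c) \<xi>"
        by (simp add: X blinfun.diff_left blinfun.add_left)
    qed
    then have "norm (X (Suc m) - b) \<le> norm (X m - b) * norm c"
      by (simp add: norm_blinfun_compose)
    also have "\<dots> \<le> norm (X 0 - b) * (1 / 2) ^ m * (1 / 2)"
      by (intro mult_mono Suc norm_c) auto
    finally show ?case by (simp add: mult.assoc)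
  qed simp
  then have bound: "norm (X m - b) \<le> norm (X 0 - b) * (1 / 2) ^ m" for m .
  have "(\<lambda>m. coef (X m) g) \<longlonglongrightarrow> coef b g" for g
  proof (rule LIM_zero_cancel, rule Lim_null_comparison)
    have "norm (coef (X m) g - coef b g) \<le> norm (X 0 - b) * (1 / 2) ^ m" for m
      using order_trans[OF cmod_coef_le[of "X m - b" g] bound[of m]] by (simp only: coef_simps)
    then show "\<forall>\<^sub>F m in sequentially. norm (coef (X m) g - coef b g) \<le> norm (X 0 - b) * (1 / 2) ^ m"
      by (simp only: eventually_True)
    show "(\<lambda>m. norm (X 0 - b) * (1 / 2) ^ m) \<longlonglongrightarrow> 0"
      by (intro tendsto_mult_right_zero LIMSEQ_realpow_zero) auto
  qed
  then have "alg_norm \<theta> \<epsilon> (abscoef b) \<le> 2 * ennreal (2 * B)"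
    using N_X by (rule alg_norm_limit)
  also have "\<dots> < \<infinity>" by (simp add: ennreal_mult_less_top)
  finally show ?thesis
    using b(1) by (simp add: smooth_def finite_\<theta>)
qed

text \<open>Truncations of \<open>b\<close> serve as approximate inverses. Their remainders become small because \<open>b\<close> has
  finite weighted \<open>op_norm\<close> for an exponent \<open>s\<close> larger than the exponent \<open>r\<close> in use.\<close>

lemma smooth_inverse:
  assumes "0 < \<epsilon>" "T \<in> smooth \<epsilon>" and b: "b \<in> reduced_cstar" "b o\<^sub>L T = id_blinfun" "T o\<^sub>L b = id_blinfun"
  obtains \<epsilon>' where "0 < \<epsilon>'" "b \<in> smooth \<epsilon>'"
proof -
  have T: "T \<in> reduced_cstar" using assms(2) by (rule smooth_reduced_cstar)
  have finite_op: "op_norm (weighted r (abscoef T)) < \<infinity>" if "r \<le> \<epsilon>" for r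
  proof -
    have "alg_norm 1 r (abscoef T) < \<infinity>"
      using smooth_antimono[OF that assms(2)] by (simp add: smooth_def)
    then show ?thesis by (rule le_less_trans[OF op_norm_le_alg_norm])
  qed
  obtain t where t: "0 < t" "nrm (weighted t (abscoef b)) < \<infinity>"
    using inverse_exponential_decay[OF T b(2,3) assms(1) finite_op[OF order.refl]] by blast
  define s where "s = t / 2"
  have s: "0 < s" using t by (simp add: s_def)
  obtain c where c: "c < \<infinity>" "\<And>u. op_norm u \<le> c * nrm (weighted s u)"
    using rapid_decay[OF s] by blast
  have "weighted s (weighted s (abscoef b)) = weighted t (abscoef b)"
    by (simp add: mult.assoc[symmetric] weight_mult s_def)
  then have "op_norm (weighted s (abscoef b)) \<le> c * nrm (weighted t (abscoef b))"
    using c(2)[of "weighted s (abscoef b)"] by simp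
  also have "\<dots> < \<infinity>" using c(1) t(2) by (simp add: ennreal_mult_less_top)
  finally obtain B where B: "op_norm (weighted s (abscoef b)) = ennreal B" "0 \<le> B"
    by (cases "op_norm (weighted s (abscoef b))") auto
  define r where "r = min \<epsilon> (s / 2)"
  have r: "0 < r" "r \<le> \<epsilon>" "r < s" using assms(1) s by (auto simp: r_def)
  obtain A where A: "op_norm (weighted r (abscoef T)) = ennreal A" "0 \<le> A"
    using finite_op[OF r(2)] by (cases "op_norm (weighted r (abscoef T))") auto
  have "(\<lambda>n. real \<kappa> * (A * B) * exp (- (s - r)) ^ n) \<longlonglongrightarrow> 0"
    using r by (intro tendsto_mult_right_zero LIMSEQ_realpow_zero) auto
  from order_tendstoD(2)[OF this, of "1 / 4"]
  obtain n where n: "real \<kappa> * (A * B) * exp (- (s - r)) ^ n < 1 / 4"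
    by (auto simp: eventually_sequentially)
  define b' where "b' = truncate n b"
  have "abscoef (b - b') = (\<lambda>g. if len g \<le> n then 0 else abscoef b g)"
    by (simp add: fun_eq_iff abscoef_def b'_def coef_truncate)
  moreover have "op_norm (weighted r (\<lambda>g. if len g \<le> n then 0 else abscoef b g))
      \<le> ennreal (exp (- (s - r) * n)) * op_norm (weighted s (abscoef b))"
    unfolding op_norm_def using r by (intro ker_norm_tail) simp
  ultimately have tail: "op_norm (weighted r (abscoef (b - b'))) \<le> ennreal (exp (- (s - r) * n)) * ennreal B"
    by (simp add: B)
  then have tail_fin: "op_norm (weighted r (abscoef (b - b'))) < \<infinity>"
    by (rule le_less_trans) (simp add: ennreal_mult_less_top)
  have rem: "id_blinfun - (T o\<^sub>L b') = T o\<^sub>L (b - b')"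
  proof (rule blinfun_eqI)
    fix \<xi>
    have "T (b \<xi>) = \<xi>"
      using arg_cong[OF b(3), of "\<lambda>U. blinfun_apply U \<xi>"] by simp
    then show "(id_blinfun - (T o\<^sub>L b')) \<xi> = (T o\<^sub>L (b - b')) \<xi>"
      by (simp only: blinfun.diff_left blinfun.diff_right blinfun_apply_blinfun_compose
          blinfun_apply_id_blinfun id_apply)
  qed
  have "op_norm (weighted r (abscoef (T o\<^sub>L (b - b')))) \<le> ennreal A * op_norm (weighted r (abscoef (b - b')))"
    using op_norm_compose[OF T _ tail_fin] r A by simp
  also have "\<dots> \<le> ennreal A * (ennreal (exp (- (s - r) * n)) * ennreal B)"
    by (intro mult_left_mono tail) simp
  finally have "of_nat \<kappa> * op_norm (weighted r (abscoef (T o\<^sub>L (b - b'))))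
      \<le> of_nat \<kappa> * (ennreal A * (ennreal (exp (- (s - r) * n)) * ennreal B))"
    by (rule mult_left_mono) simp
  also have "\<dots> = ennreal (real \<kappa> * (A * B) * exp (- (s - r)) ^ n)"
    using A B by (simp add: ennreal_of_nat_eq_real_of_nat exp_of_nat_mult[symmetric] ac_simps flip: ennreal_mult)
  also have "\<dots> \<le> ennreal (1 / 4)" using n by (intro ennreal_leI) simp
  finally have "b \<in> smooth r"
    using smooth_antimono[OF r(2) assms(2)] b(1,2) r
    by (intro smooth_inverse_of_approximate_inverse[of r T b b']) (auto simp: b'_def rem[unfolded b'_def])
  then show ?thesis using that r(1) by blast
qed

end

section \<open>Class functions and traces\<close>

lemma class_function_conjugate: "class_function \<tau> \<Longrightarrow> \<tau> (- z + g + z) = \<tau> g"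
  unfolding class_function_def using conj_class_conjugate by blast

lemma class_function_commute: "class_function \<tau> \<Longrightarrow> \<tau> (g + h) = \<tau> (h + g)"
  using class_function_conjugate[of \<tau> g "g + h"] by (simp add: add.assoc[symmetric])

lemma the_elem_class_function:
  assumes "class_function \<tau>"
  shows "the_elem (\<tau> ` conj_class g) = \<tau> g"
proof -
  have "\<tau> ` conj_class g = {\<tau> g}"
    using assms conj_class_self[of g] unfolding class_function_def by blast
  then show ?thesis by simp
qed

lemma power_le_exp_bound:
  fixes a :: real and m :: nat
  assumes "0 < a" "0 < m"
  obtains M where "0 \<le> M" "\<And>l::nat. (1 + real l) ^ m \<le> M * exp (a * l)"
proof
  \<comment> \<open>\<open>D\<close> is chosen such that \<open>1 + l \<le> D * (1 + a * l / m)\<close>, and \<open>(1 + a * l / m) ^ m\<close> is at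
    most \<open>exp (a * l)\<close>.\<close>
  define D where "D = max 1 (m / a)"
  have D: "1 \<le> D" "m / a \<le> D" by (simp_all add: D_def)
  show "0 \<le> D ^ m" using D by simp
  fix l :: nat
  have "1 + real l \<le> D * (1 + a * l / m)"
  proof -
    have "real l = m / a * (a * l / m)" using assms by simp
    also have "\<dots> \<le> D * (a * l / m)" using D assms by (intro mult_right_mono) auto
    finally show ?thesis using D by (simp add: distrib_left)
  qed
  then have "(1 + real l) ^ m \<le> (D * (1 + a * l / m)) ^ m"
    by (intro power_mono) auto
  also have "\<dots> = D ^ m * (1 + a * l / m) ^ m" by (rule power_mult_distrib)
  also have "\<dots> \<le> D ^ m * exp (a * l)"
  proof (rule mult_left_mono)
    have "0 \<le> a * l" using assms by simp
    then have "- real m \<le> a * l" by linarith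
    from exp_ge_one_plus_x_over_n_power_n[OF this assms(2)]
    show "(1 + a * l / m) ^ m \<le> exp (a * l)" .
  qed (use D in simp)
  finally show "(1 + real l) ^ m \<le> D ^ m * exp (a * l)" .
qed

lemma class_length_change_generators:
  fixes S S' :: "'g::group_add set"
  assumes "finite_symmetric_generating S" "finite_symmetric_generating S'"
  obtains c where "\<And>g. class_length S' (conj_class g) \<le> c * class_length S (conj_class g)"
proof -
  obtain c where c: "\<And>g. word_length S' g \<le> c * word_length S g"
    using word_length_change_generators[OF assms] by blast
  have "class_length S' (conj_class g) \<le> c * class_length S (conj_class g)" for g
  proof -
    obtain y where y: "y \<in> conj_class g" "word_length S y = class_length S (conj_class g)"
      using class_length_attained[of "conj_class g" S] conj_class_self[of g] by blast
    then show ?thesis using class_length_le[OF y(1), of S'] c[of y] by simp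
  qed
  then show ?thesis using that by blast
qed

context hyperbolic_word_metric
begin

definition in_core :: "'g \<Rightarrow> ennreal" where
  "in_core h = indicator (core (conj_class h)) h"

text \<open>The core of a class of minimal length \<open>n\<close> has \<open>O(n)\<close> elements, all of length at least
  \<open>n\<close>. The exponential weight therefore absorbs the number of elements together with the
  polynomial weight in the definition of temperedness, whatever generators are used there.\<close>

lemma tempered_square_summable_on_core:
  assumes S': "finite_symmetric_generating S'" and \<tau>: "tempered S' \<tau>" and \<epsilon>: "0 < \<epsilon>"
  shows "nrm (\<lambda>h. in_core h * ennreal (cmod (\<tau> h)) * weight (- \<epsilon>) h) < \<infinity>"
proof -
  have cf: "class_function \<tau>" using \<tau> by (simp add: tempered_def)
  obtain k where "(\<lambda>K. (cmod (the_elem (\<tau> ` K)))\<^sup>2 / (1 + real (class_length S' K)) ^ (2 * k))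
      summable_on range conj_class"
    using \<tau> unfolding tempered_def by (meson eventually_sequentially order.refl)
  note summable = this
  obtain c where c: "\<And>g. class_length S' (conj_class g) \<le> c * class_length S (conj_class g)"
    using class_length_change_generators[OF generating S'] by blast
  obtain M where M: "0 \<le> M" "\<And>l::nat. (1 + real l) ^ (2 * k + 1) \<le> M * exp (2 * \<epsilon> * l)"
    using power_le_exp_bound[of "2 * \<epsilon>" "2 * k + 1"] \<epsilon> by auto
  define c1 where "c1 = card {h. len h \<le> short_class_bound} + 1"
  define D where "D = real c1 * (real (c + 1) ^ (2 * k) * M)"
  have "0 \<le> D" using M by (simp add: D_def)
  define f where "f K = (if K \<in> range conj_class
    then (cmod (the_elem (\<tau> ` K)))\<^sup>2 / (1 + real (class_length S' K)) ^ (2 * k) else 0)" for K :: "'g set"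
  have f: "f summable_on UNIV"
    using summable by (rule summable_on_cong_neutral[THEN iffD1, rotated -1]) (auto simp: f_def)
  have f_nonneg: "0 \<le> f K" for K by (simp add: f_def)
  define F where "F h = ennreal ((cmod (\<tau> h))\<^sup>2 * exp (- (2 * \<epsilon> * len h)))" for h
  have inner: "(\<Sum>\<^sup>+h. indicator {K} (conj_class h) * (in_core h * F h)) \<le> ennreal (D * f K)" for K
  proof (cases "K \<in> range conj_class")
    case False
    then have "(\<lambda>h. indicator {K} (conj_class h) * (in_core h * F h)) = (\<lambda>_. 0)"
      by (auto simp: indicator_def fun_eq_iff)
    then show ?thesis by simp
  next
    case True
    then obtain g where K: "K = conj_class g" by blast
    let ?l = "class_length S K"
    have "indicator {K} (conj_class h) * (in_core h * F h)
        \<le> ennreal ((cmod (\<tau> g))\<^sup>2 * exp (- (2 * \<epsilon> * ?l))) * indicator (core K) h" for h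
    proof (cases "conj_class h = K \<and> h \<in> core K")
      case True
      then have "h \<in> K" using core_subset K by blast
      then have "\<tau> h = \<tau> g" "?l \<le> len h"
        using cf class_length_le unfolding K class_function_def by auto
      then have "F h \<le> ennreal ((cmod (\<tau> g))\<^sup>2 * exp (- (2 * \<epsilon> * ?l)))"
        using \<epsilon> unfolding F_def by (intro ennreal_leI mult_mono) auto
      then show ?thesis using True by (simp add: in_core_def)
    qed (auto simp: in_core_def indicator_def)
    then have "(\<Sum>\<^sup>+h. indicator {K} (conj_class h) * (in_core h * F h))
        \<le> (\<Sum>\<^sup>+h. ennreal ((cmod (\<tau> g))\<^sup>2 * exp (- (2 * \<epsilon> * ?l))) * indicator (core K) h)"
      by (rule nn_integral_mono)
    also have "\<dots> = ennreal ((cmod (\<tau> g))\<^sup>2 * exp (- (2 * \<epsilon> * ?l))) * of_nat (card (core K))"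
      using card_core(1)[of g] by (simp add: nn_integral_cmult K)
    also have "\<dots> = ennreal ((cmod (\<tau> g))\<^sup>2 * exp (- (2 * \<epsilon> * ?l)) * card (core K))"
      by (simp add: ennreal_of_nat_eq_real_of_nat ennreal_mult)
    also have "\<dots> \<le> ennreal (D * f K)"
    proof (rule ennreal_leI)
      let ?l' = "class_length S' K"
      have "real (card (core K)) * (1 + real ?l') ^ (2 * k)
          \<le> (real c1 * (1 + real ?l)) * (real (c + 1) * (1 + real ?l)) ^ (2 * k)"
      proof (intro mult_mono power_mono)
        have "card (core K) \<le> c1 * (1 + ?l)"
          using card_core(2)[of g] by (simp add: K c1_def)
        then have "real (card (core K)) \<le> real (c1 * (1 + ?l))" by (rule of_nat_mono)
        then show "real (card (core K)) \<le> real c1 * (1 + real ?l)" by (simp add: distrib_left)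
        have "1 + ?l' \<le> (c + 1) * (1 + ?l)"
          using c[of g] by (simp add: K algebra_simps)
        then have "real (1 + ?l') \<le> real ((c + 1) * (1 + ?l))" by (rule of_nat_mono)
        then show "1 + real ?l' \<le> real (c + 1) * (1 + real ?l)" by (simp add: algebra_simps)
      qed auto
      also have "\<dots> = real c1 * (real (c + 1) ^ (2 * k) * (1 + real ?l) ^ (2 * k + 1))"
        by (simp only: power_mult_distrib power_add power_one_right ac_simps)
      also have "\<dots> \<le> real c1 * (real (c + 1) ^ (2 * k) * (M * exp (2 * \<epsilon> * ?l)))"
        by (intro mult_left_mono M) auto
      also have "\<dots> = D * exp (2 * \<epsilon> * ?l)" by (simp only: D_def ac_simps)
      finally have "card (core K) \<le> D * exp (2 * \<epsilon> * ?l) / (1 + real ?l') ^ (2 * k)"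
        by (simp add: pos_le_divide_eq)
      then have "(cmod (\<tau> g))\<^sup>2 * exp (- (2 * \<epsilon> * ?l)) * card (core K)
          \<le> (cmod (\<tau> g))\<^sup>2 * exp (- (2 * \<epsilon> * ?l)) * (D * exp (2 * \<epsilon> * ?l) / (1 + real ?l') ^ (2 * k))"
        by (intro mult_left_mono) auto
      also have "\<dots> = (exp (- (2 * \<epsilon> * ?l)) * exp (2 * \<epsilon> * ?l)) *
          (D * ((cmod (\<tau> g))\<^sup>2 / (1 + real ?l') ^ (2 * k)))"
        by simp
      also have "\<dots> = D * f K"
        by (simp add: f_def K the_elem_class_function[OF cf] flip: exp_add)
      finally show "(cmod (\<tau> g))\<^sup>2 * exp (- (2 * \<epsilon> * ?l)) * card (core K) \<le> D * f K" .
    qed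
    finally show ?thesis .
  qed
  have "(in_core h * ennreal (cmod (\<tau> h)) * weight (- \<epsilon>) h)\<^sup>2 = in_core h * F h" for h
  proof -
    have "(ennreal (cmod (\<tau> h)))\<^sup>2 * weight (2 * - \<epsilon>) h = F h"
      by (simp add: F_def weight_def ennreal_power ennreal_mult)
    then show ?thesis
      by (simp only: power_mult_distrib weight_power2 in_core_def indicator_power2 mult.assoc)
  qed
  then have "(\<Sum>\<^sup>+h. (in_core h * ennreal (cmod (\<tau> h)) * weight (- \<epsilon>) h)\<^sup>2) = (\<Sum>\<^sup>+h. in_core h * F h)"
    by simp
  also have "\<dots> = (\<Sum>\<^sup>+h. \<Sum>\<^sup>+K. indicator {K} (conj_class h) * (in_core h * F h))"
  proof (rule nn_integral_cong)
    fix h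
    show "in_core h * F h = (\<Sum>\<^sup>+K. indicator {K} (conj_class h) * (in_core h * F h))"
      by (subst esum_single[of "conj_class h"]) auto
  qed
  also have "\<dots> = (\<Sum>\<^sup>+K. \<Sum>\<^sup>+h. indicator {K} (conj_class h) * (in_core h * F h))"
    by (rule esum_swap)
  also have "\<dots> \<le> (\<Sum>\<^sup>+K. ennreal D * ennreal (f K))"
    using inner \<open>0 \<le> D\<close> f_nonneg by (intro nn_integral_mono) (simp add: ennreal_mult)
  also have "\<dots> < \<infinity>"
    using esum_eq_infsum[OF f_nonneg f] by (simp add: nn_integral_cmult ennreal_mult_less_top)
  finally have "(nrm (\<lambda>h. in_core h * ennreal (cmod (\<tau> h)) * weight (- \<epsilon>) h))\<^sup>2 < \<infinity>"
    by (simp only: nrm_power2)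
  then show ?thesis by (auto simp: power2_eq_square ennreal_mult_less_top)
qed

text \<open>Every \<open>g\<close> is split as \<open>x + y\<close> without essential cancellation such that the rotated element
  \<open>y + x\<close> lies in the core of the conjugacy class. The sum of \<open>u\<close> over a conjugacy class is thus
  dominated by the sum of its splitting, for \<open>\<phi>\<close> the unit mass at \<open>0\<close>, over the small set
  formed by the core, where the Cauchy-Schwarz inequality is effective.\<close>

lemma class_function_le_split_norm:
  assumes S': "finite_symmetric_generating S'" and \<tau>: "tempered S' \<tau>" and \<epsilon>: "0 < \<epsilon>"
  obtains K where "0 \<le> K" "\<And>u. (\<Sum>\<^sup>+g. u g * ennreal (cmod (\<tau> g)))
    \<le> ennreal K * split_norm (3 * short_class_bound) (\<lambda>g. weight \<epsilon> g * u g)"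
proof -
  let ?C = "3 * short_class_bound"
  have cf: "class_function \<tau>" using \<tau> by (simp add: tempered_def)
  define \<tau>' where "\<tau>' h = in_core h * ennreal (cmod (\<tau> h))" for h
  define a where "a = ennreal (exp (\<epsilon> * ?C))"
  have "nrm (\<lambda>h. \<tau>' h * weight (- \<epsilon>) h) < \<infinity>"
    using tempered_square_summable_on_core[OF assms] by (simp add: \<tau>'_def)
  then have "nrm (\<lambda>h. \<tau>' h * weight (- \<epsilon>) h) * a < \<infinity>"
    by (simp add: a_def ennreal_mult_less_top)
  then obtain K where K: "nrm (\<lambda>h. \<tau>' h * weight (- \<epsilon>) h) * a = ennreal K" "0 \<le> K"
    by (cases "nrm (\<lambda>h. \<tau>' h * weight (- \<epsilon>) h) * a") auto
  have "(\<Sum>\<^sup>+g. u g * ennreal (cmod (\<tau> g))) \<le> ennreal K * split_norm ?C (\<lambda>g. weight \<epsilon> g * u g)" for u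
  proof -
    let ?k = "split_kernel ?C (unit_mass 0)" and ?s = "splitting ?C (unit_mass 0)"
    have "u g * ennreal (cmod (\<tau> g)) \<le> (\<Sum>\<^sup>+h. \<tau>' h * (?k h g * u g))" for g
    proof -
      obtain z where z: "z \<in> between ?C g" "- z + g + z \<in> core (conj_class g)"
        using conjugate_to_core by blast
      define h where "h = - z + g + z"
      have "\<tau>' h = ennreal (cmod (\<tau> g))"
        using z(2) conj_class_eq[OF conj_class_conjugate[of z g]] class_function_conjugate[OF cf]
        by (simp add: \<tau>'_def in_core_def h_def)
      moreover have "- g + z + h - z = 0"
        by (simp only: h_def group_normalize)
      then have "1 \<le> ?k h g"
        using z(1) member_le_esum[of "\<lambda>x. indicator (between ?C g) x * unit_mass 0 (- g + x + h - x)" z]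
        by (simp add: split_kernel_def unit_mass_def)
      then have "ennreal (cmod (\<tau> g)) * (1 * u g) \<le> ennreal (cmod (\<tau> g)) * (?k h g * u g)"
        by (intro mult_left_mono mult_right_mono) auto
      ultimately show ?thesis
        using member_le_esum[of "\<lambda>h. \<tau>' h * (?k h g * u g)" h] by (simp add: mult.commute)
    qed
    then have "(\<Sum>\<^sup>+g. u g * ennreal (cmod (\<tau> g))) \<le> (\<Sum>\<^sup>+g. \<Sum>\<^sup>+h. \<tau>' h * (?k h g * u g))"
      by (rule nn_integral_mono)
    also have "\<dots> = (\<Sum>\<^sup>+h. \<tau>' h * ?s u h)"
      by (subst esum_swap) (simp add: nn_integral_cmult splitting_def)
    also have "\<dots> = (\<Sum>\<^sup>+h. (\<tau>' h * weight (- \<epsilon>) h) * (weight \<epsilon> h * ?s u h))"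
      by (simp add: mult.assoc weight_cancel)
    also have "\<dots> \<le> nrm (\<lambda>h. \<tau>' h * weight (- \<epsilon>) h) * nrm (\<lambda>h. weight \<epsilon> h * ?s u h)"
      by (rule esum_mult_le_nrm)
    also have "nrm (\<lambda>h. weight \<epsilon> h * ?s u h) \<le> nrm (\<lambda>h. a * ?s (\<lambda>g. weight \<epsilon> g * u g) h)"
    proof (rule nrm_mono)
      fix h
      have "weight \<epsilon> h * ?k h g \<le> a * (weight \<epsilon> g * ?k h g)" for g
      proof -
        have "weight \<epsilon> h * (indicator (between ?C g) x * unit_mass 0 (- g + x + h - x))
          \<le> a * (weight \<epsilon> g * (indicator (between ?C g) x * unit_mass 0 (- g + x + h - x)))" for x
        proof (cases "x \<in> between ?C g \<and> - g + x + h - x = 0")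
          case True
          have "h = - x + (g + (- g + x + h - x)) + x"
            by (simp only: group_normalize)
          then have "h = (- x + g) + x" using True by simp
          then have "len h \<le> len (- x + g) + len x" using len_add by metis
          also have "\<dots> \<le> len g + ?C" using True by (simp add: between_def)
          finally have "real (len h) \<le> real (len g + ?C)" by (rule of_nat_mono)
          then have "\<epsilon> * len h \<le> \<epsilon> * ?C + \<epsilon> * len g"
            using mult_left_mono[of "real (len h)" "real (len g + ?C)" \<epsilon>] \<epsilon> by (simp add: algebra_simps)
          then have "weight \<epsilon> h \<le> a * weight \<epsilon> g"
            by (simp add: weight_def a_def ennreal_leI flip: ennreal_mult exp_add)
          then show ?thesis using True by (simp add: unit_mass_def)
        qed (auto simp: unit_mass_def)
        then show ?thesis
          unfolding split_kernel_def by (simp add: nn_integral_cmult[symmetric] nn_integral_mono)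
      qed
      from mult_right_mono[OF this, of "u _"] 
      have "weight \<epsilon> h * (?k h g * u g) \<le> a * (?k h g * (weight \<epsilon> g * u g))" for g
        by (simp add: ac_simps)
      then show "weight \<epsilon> h * ?s u h \<le> a * ?s (\<lambda>g. weight \<epsilon> g * u g) h"
        unfolding splitting_def by (simp add: nn_integral_cmult[symmetric] nn_integral_mono)
    qed
    also have "\<dots> \<le> a * split_norm ?C (\<lambda>g. weight \<epsilon> g * u g)"
      unfolding nrm_cmult by (intro mult_left_mono nrm_splitting_le_1 op_norm_unit_mass) simp
    finally show ?thesis
      by (simp add: mult_left_mono K(1)[symmetric] mult.assoc)
  qed
  then show ?thesis using that K(2) by blast
qed

end

definition extended_trace :: "('g::group_add \<Rightarrow> complex) \<Rightarrow> 'g ell2_op \<Rightarrow> complex" where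
  "extended_trace \<tau> T = (\<Sum>\<^sub>\<infinity>g. coef T g * \<tau> g)"

lemma extended_trace_left_regular:
  "extended_trace \<tau> (left_regular a)
    = (\<Sum>g\<in>Poly_Mapping.keys a. Poly_Mapping.lookup a g * \<tau> g)"
proof -
  have "extended_trace \<tau> (left_regular a)
      = (\<Sum>\<^sub>\<infinity>g\<in>Poly_Mapping.keys a. Poly_Mapping.lookup a g * \<tau> g)"
    unfolding extended_trace_def by (rule infsum_cong_neutral) (auto simp: in_keys_iff)
  then show ?thesis by simp
qed

lemma extended_trace_scaleC: "extended_trace \<tau> (c *\<^sub>C T) = c * extended_trace \<tau> T"
  by (simp add: extended_trace_def mult.assoc infsum_cmult_right')

lemma extended_trace_add:
  assumes "(\<lambda>g. cmod (coef T g * \<tau> g)) summable_on UNIV" "(\<lambda>g. cmod (coef U g * \<tau> g)) summable_on UNIV"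
  shows "extended_trace \<tau> (T + U) = extended_trace \<tau> T + extended_trace \<tau> U"
  unfolding extended_trace_def
  by (subst infsum_add[symmetric]) (auto intro: abs_summable_summable assms simp: distrib_right)

text \<open>Absolute convergence over all pairs permits the substitution \<open>h = g - y\<close>.\<close>

lemma extended_trace_compose:
  assumes T: "T \<in> reduced_cstar" and fin: "(\<Sum>\<^sup>+g. conv (abscoef T) (abscoef U) g * ennreal (cmod (\<tau> g))) < \<infinity>"
  shows "extended_trace \<tau> (T o\<^sub>L U) = (\<Sum>\<^sub>\<infinity>(h, y). coef T h * coef U y * \<tau> (h + y))"
proof -
  let ?F = "\<lambda>(h, y). coef T h * coef U y * \<tau> (h + y)"
  let ?G = "\<lambda>(g, y). coef T (g - y) * coef U y * \<tau> g"
  have bij: "bij (\<lambda>(g, y). (g - y, y :: 'a))"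
    by (rule bij_betw_byWitness[of _ "\<lambda>(h, y). (h + y, y)"]) auto
  have "(\<Sum>\<^sup>+p. ennreal (cmod (?G p))) = (\<Sum>\<^sup>+g. \<Sum>\<^sup>+y. ennreal (cmod (?G (g, y))))"
    by (rule nn_integral_fst_count_space[symmetric])
  also have "\<dots> = (\<Sum>\<^sup>+g. conv (abscoef T) (abscoef U) g * ennreal (cmod (\<tau> g)))"
    by (simp add: conv_alt abscoef_def norm_mult ennreal_mult nn_integral_multc)
  finally have "(\<lambda>p. cmod (?G p)) summable_on UNIV"
    using fin by (intro summable_on_if_esum_finite) auto
  then have G: "?G summable_on UNIV \<times> UNIV" by (simp add: abs_summable_summable)
  have "extended_trace \<tau> (T o\<^sub>L U) = (\<Sum>\<^sub>\<infinity>g. \<Sum>\<^sub>\<infinity>y. coef T (g - y) * coef U y * \<tau> g)"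
    unfolding extended_trace_def
    by (simp add: infsum_cmult_left' coef_def[of "T o\<^sub>L U"] reduced_cstar_apply[OF T] coef_def[of U])
  also have "\<dots> = infsum ?G (UNIV \<times> UNIV)"
    by (rule infsum_Sigma'_banach[OF G])
  also have "\<dots> = (\<Sum>\<^sub>\<infinity>p. ?F ((\<lambda>(g, y). (g - y, y)) p))"
    by (auto intro!: infsum_cong)
  also have "\<dots> = infsum ?F UNIV"
    by (rule infsum_reindex_bij_betw[OF bij])
  finally show ?thesis .
qed

text \<open>Exchanging \<open>h\<close> and \<open>y\<close> turns one double sum into the other.\<close>

lemma extended_trace_commute:
  assumes "class_function \<tau>" and "T \<in> reduced_cstar" "U \<in> reduced_cstar"
    and "(\<Sum>\<^sup>+g. conv (abscoef T) (abscoef U) g * ennreal (cmod (\<tau> g))) < \<infinity>"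
    and "(\<Sum>\<^sup>+g. conv (abscoef U) (abscoef T) g * ennreal (cmod (\<tau> g))) < \<infinity>"
  shows "extended_trace \<tau> (T o\<^sub>L U) = extended_trace \<tau> (U o\<^sub>L T)"
proof -
  let ?F = "\<lambda>(h, y). coef T h * coef U y * \<tau> (h + y)"
  have "extended_trace \<tau> (U o\<^sub>L T) = (\<Sum>\<^sub>\<infinity>(h, y). coef U h * coef T y * \<tau> (h + y))"
    by (rule extended_trace_compose[OF assms(3,5)])
  also have "\<dots> = (\<Sum>\<^sub>\<infinity>p. ?F (prod.swap p))"
    by (intro infsum_cong) (auto simp: class_function_commute[OF assms(1)])
  also have "\<dots> = infsum ?F UNIV"
    by (rule infsum_reindex_bij_betw) simp
  also have "\<dots> = extended_trace \<tau> (T o\<^sub>L U)"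
    by (rule extended_trace_compose[OF assms(2,4), symmetric])
  finally show ?thesis by simp
qed

text \<open>The detour admitted in splittings is the one that occurs when an element is rotated
  into the core of its conjugacy class.\<close>

locale conjugation_split_algebra =
  split_algebra S \<delta> "3 * hyperbolic_word_metric.short_class_bound \<delta>" \<kappa>
  for S :: "'g::group_add set" and \<delta> \<kappa>
begin

lemma tempered_sum_bound:
  assumes "finite_symmetric_generating S'" "tempered S' \<tau>" "0 < \<epsilon>"
  obtains K where "0 \<le> K"
    "\<And>u. (\<Sum>\<^sup>+g. u g * ennreal (cmod (\<tau> g))) \<le> ennreal K * alg_norm 1 \<epsilon> u"
proof -
  obtain K where K: "0 \<le> K" "\<And>u. (\<Sum>\<^sup>+g. u g * ennreal (cmod (\<tau> g)))
      \<le> ennreal K * split_norm (3 * short_class_bound) (weighted \<epsilon> u)"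
    using class_function_le_split_norm[OF assms] by blast
  have "split_norm (3 * short_class_bound) (weighted \<epsilon> u) \<le> alg_norm 1 \<epsilon> u" for u
    by (simp add: alg_norm_def)
  then have "(\<Sum>\<^sup>+g. u g * ennreal (cmod (\<tau> g))) \<le> ennreal K * alg_norm 1 \<epsilon> u" for u
    using K(2)[of u] by (meson mult_left_mono order_trans zero_le)
  then show ?thesis using that K(1) by blast
qed

lemma extended_trace_bound:
  assumes "finite_symmetric_generating S'" "tempered S' \<tau>" "0 < \<epsilon>"
  obtains K where "\<And>T. T \<in> smooth \<epsilon> \<Longrightarrow>
    (\<lambda>g. cmod (coef T g * \<tau> g)) summable_on UNIV \<and> cmod (extended_trace \<tau> T) \<le> K * smooth_norm \<epsilon> T"
proof -
  obtain K where K: "0 \<le> K" "\<And>u. (\<Sum>\<^sup>+g. u g * ennreal (cmod (\<tau> g))) \<le> ennreal K * alg_norm 1 \<epsilon> u"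
    using tempered_sum_bound[OF assms] by blast
  have "(\<lambda>g. cmod (coef T g * \<tau> g)) summable_on UNIV \<and> cmod (extended_trace \<tau> T) \<le> K * smooth_norm \<epsilon> T"
    if T: "T \<in> smooth \<epsilon>" for T
  proof -
    have "(\<Sum>\<^sup>+g. ennreal (cmod (coef T g * \<tau> g))) \<le> ennreal K * alg_norm 1 \<epsilon> (abscoef T)"
      using K(2)[of "abscoef T"] by (simp add: abscoef_def norm_mult ennreal_mult)
    also have "\<dots> = ennreal (K * smooth_norm \<epsilon> T)"
      using K(1) by (simp add: ennreal_mult smooth_norm[OF T])
    finally have le: "(\<Sum>\<^sup>+g. ennreal (cmod (coef T g * \<tau> g))) \<le> ennreal (K * smooth_norm \<epsilon> T)" .
    then have s: "(\<lambda>g. cmod (coef T g * \<tau> g)) summable_on UNIV"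
      by (intro summable_on_if_esum_finite) (auto intro: le_less_trans)
    have "ennreal (cmod (extended_trace \<tau> T)) \<le> ennreal (K * smooth_norm \<epsilon> T)"
      unfolding extended_trace_def by (rule order_trans[OF cmod_infsum_le[OF s] le])
    then show ?thesis using s K(1) by simp
  qed
  then show ?thesis using that by blast
qed

lemma extended_trace_commute_smooth:
  assumes "finite_symmetric_generating S'" "tempered S' \<tau>" "0 < \<epsilon>" "T \<in> smooth \<epsilon>" "U \<in> smooth \<epsilon>"
  shows "extended_trace \<tau> (T o\<^sub>L U) = extended_trace \<tau> (U o\<^sub>L T)"
proof -
  obtain K where K: "\<And>u. (\<Sum>\<^sup>+g. u g * ennreal (cmod (\<tau> g))) \<le> ennreal K * alg_norm 1 \<epsilon> u"
    using tempered_sum_bound[OF assms(1-3)] by blast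
  have "(\<Sum>\<^sup>+g. conv (abscoef T) (abscoef U) g * ennreal (cmod (\<tau> g))) < \<infinity>"
    if "T \<in> smooth \<epsilon>" "U \<in> smooth \<epsilon>" for T U
  proof -
    have "alg_norm 1 \<epsilon> (conv (abscoef T) (abscoef U)) \<le> alg_norm 1 \<epsilon> (abscoef T) * alg_norm 1 \<epsilon> (abscoef U)"
      using that assms(3) by (intro alg_norm_conv) (auto simp: smooth_def)
    also have "\<dots> < \<infinity>" using that by (simp add: smooth_def ennreal_mult_less_top)
    finally have "ennreal K * alg_norm 1 \<epsilon> (conv (abscoef T) (abscoef U)) < \<infinity>"
      by (simp add: ennreal_mult_less_top)
    then show ?thesis using K by (rule le_less_trans[rotated])
  qed
  then show ?thesis
    using assms by (intro extended_trace_commute) (auto simp: tempered_def smooth_def)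
qed

end

section \<open>The increasing sequence of algebras\<close>

theorem theorem6p2:
  assumes "word_hyperbolic TYPE('g::group_add)"
  shows "\<exists>(A :: nat \<Rightarrow> 'g ell2_op set) (N :: nat \<Rightarrow> 'g ell2_op \<Rightarrow> real).
    increasing_banach_subalgebras reduced_cstar A N \<and>
    (\<forall>n. range left_regular \<subseteq> A n) \<and>
    dense_in (\<Union>n. A n) reduced_cstar \<and>
    hol_closed_in (\<Union>n. A n) reduced_cstar \<and>
    (\<forall>S \<tau>. finite_symmetric_generating S \<and> tempered S \<tau> \<longrightarrow>
      (\<exists>t. bounded_trace A N t \<and>
        (\<forall>a. t (left_regular a) =
          (\<Sum>g\<in>Poly_Mapping.keys a. Poly_Mapping.lookup a g * \<tau> g))))"
proof -
  obtain S :: "'g set" and \<delta> where "finite_symmetric_generating S"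
    "\<And>w x y z. gromov_product S w x z \<ge> min (gromov_product S w x y) (gromov_product S w y z) - \<delta>"
    using assms unfolding word_hyperbolic_def by blast
  then interpret hyperbolic_word_metric S \<delta> by unfold_locales
  let ?E = "split_norm (3 * short_class_bound)"
  obtain \<kappa> :: nat where "1 \<le> \<kappa>"
    "\<And>u v. op_norm u < \<infinity> \<Longrightarrow> op_norm v < \<infinity> \<Longrightarrow>
      ?E (conv u v) \<le> of_nat \<kappa> * (op_norm v * ?E u + op_norm u * ?E v)"
    using split_norm_conv[of "3 * short_class_bound"] by blast
  then interpret conjugation_split_algebra S \<delta> \<kappa> by unfold_locales
  define e where "e n = 1 / real (Suc n)" for n
  have e_pos: "0 < e n" for n by (simp add: e_def)
  have e_mono: "e n \<le> e m" if "m \<le> n" for m n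
    unfolding e_def using that by (intro divide_left_mono) auto
  define A N where "A n = smooth (e n)" and "N n = smooth_norm (e n)" for n
  let ?A = "\<Union>n. A n"
  have A_mono: "A m \<subseteq> A n" if "m \<le> n" for m n
    using smooth_antimono[OF e_mono[OF that]] by (auto simp: A_def)
  have regular: "range left_regular \<subseteq> A n" for n
    by (auto simp: A_def)
  have sub: "A n \<subseteq> reduced_cstar" for n
    by (auto simp: A_def smooth_def)
  have common: "\<exists>n. T \<in> A n \<and> U \<in> A n" if TU: "T \<in> ?A" "U \<in> ?A" for T U
  proof -
    obtain m n where "T \<in> A m" "U \<in> A n" using TU by blast
    then show ?thesis
      using A_mono[of m "max m n"] A_mono[of n "max m n"] by auto
  qed
  have increasing: "increasing_banach_subalgebras reduced_cstar A N"
    unfolding increasing_banach_subalgebras_def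
  proof (intro allI conjI)
    fix n
    have n: "0 \<le> e n" using e_pos[of n] by simp
    show "subalgebra_op (A n)" "banach_algebra_norm (A n) (N n)"
      unfolding A_def N_def by (rule subalgebra_smooth[OF n], rule banach_algebra_norm_smooth[OF n])
    have "N (Suc n) T \<le> 1 * N n T" if "T \<in> A n" for T
      using smooth_antimono[OF e_mono[of n "Suc n"], of T] that by (simp add: A_def N_def)
    then show "bounded_inclusion (A n) (N n) (A (Suc n)) (N (Suc n))"
      unfolding bounded_inclusion_def using A_mono[of n "Suc n"]
      by (intro conjI exI[of _ 1] ballI) auto
    have "norm T \<le> 1 * N n T" if "T \<in> A n" for T
      using norm_le_smooth_norm[of T "e n"] that n by (simp add: A_def N_def)
    then show "bounded_inclusion (A n) (N n) reduced_cstar norm"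
      unfolding bounded_inclusion_def using sub by blast
  qed
  have dense: "dense_in ?A reduced_cstar"
    unfolding dense_in_def
  proof
    show "?A \<subseteq> reduced_cstar" using sub by blast
    have "range left_regular \<subseteq> ?A" using regular by blast
    then show "reduced_cstar \<subseteq> closure ?A"
      unfolding reduced_cstar_def by (rule closure_mono)
  qed
  have inverse: "b \<in> ?A"
    if T: "T \<in> ?A" and b: "b \<in> reduced_cstar" "b o\<^sub>L T = id_blinfun" "T o\<^sub>L b = id_blinfun" for T b
  proof -
    obtain n where "T \<in> smooth (e n)" using T by (auto simp: A_def)
    then obtain \<epsilon> where \<epsilon>: "0 < \<epsilon>" "b \<in> smooth \<epsilon>"
      using smooth_inverse[OF e_pos _ b] by blast
    obtain m where "inverse (real (Suc m)) < \<epsilon>"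
      using reals_Archimedean[OF \<epsilon>(1)] by blast
    then have "e m \<le> \<epsilon>" by (simp add: e_def inverse_eq_divide)
    then show ?thesis using smooth_antimono[OF _ \<epsilon>(2)] by (auto simp: A_def)
  qed
  have hol: "hol_closed_in ?A reduced_cstar"
    unfolding hol_closed_in_def
  proof
    fix a assume a: "a \<in> ?A"
    have shift: "z *\<^sub>C id_blinfun - a \<in> ?A" for z
    proof -
      obtain n where n: "a \<in> smooth (e n)" using a by (auto simp: A_def)
      have "z *\<^sub>C id_blinfun \<in> smooth (e n)"
        unfolding left_regular_one[symmetric] by (rule smooth_scaleC[THEN conjunct1]) simp
      then show ?thesis using smooth_diff[OF _ n] by (auto simp: A_def)
    qed
    have "?A \<subseteq> reduced_cstar" using sub by blast
    then have "(\<exists>b\<in>?A. b o\<^sub>L (z *\<^sub>C id_blinfun - a) = id_blinfun \<and>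
          (z *\<^sub>C id_blinfun - a) o\<^sub>L b = id_blinfun) \<longleftrightarrow>
        (\<exists>b\<in>reduced_cstar. b o\<^sub>L (z *\<^sub>C id_blinfun - a) = id_blinfun \<and>
          (z *\<^sub>C id_blinfun - a) o\<^sub>L b = id_blinfun)" for z
      using inverse[OF shift[of z]] by (meson subsetD)
    then show "spectrum_in ?A a = spectrum_in reduced_cstar a"
      unfolding spectrum_in_def by (simp only:)
  qed
  have trace: "\<exists>t. bounded_trace A N t \<and>
      (\<forall>a. t (left_regular a) = (\<Sum>g\<in>Poly_Mapping.keys a. Poly_Mapping.lookup a g * \<tau> g))"
    if S': "finite_symmetric_generating S'" and \<tau>: "tempered S' \<tau>" for S' and \<tau> :: "'g \<Rightarrow> complex"
  proof (intro exI conjI allI)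
    have bound: "\<exists>K. \<forall>T\<in>smooth (e n). (\<lambda>g. cmod (coef T g * \<tau> g)) summable_on UNIV
        \<and> cmod (extended_trace \<tau> T) \<le> K * smooth_norm (e n) T" for n
      using extended_trace_bound[OF S' \<tau> e_pos] by metis
    show "extended_trace \<tau> (left_regular a)
        = (\<Sum>g\<in>Poly_Mapping.keys a. Poly_Mapping.lookup a g * \<tau> g)" for a
      by (rule extended_trace_left_regular)
    show "bounded_trace A N (extended_trace \<tau>)"
      unfolding bounded_trace_def
    proof (intro conjI ballI allI)
      fix T U assume "T \<in> ?A" "U \<in> ?A"
      then obtain n where n: "T \<in> smooth (e n)" "U \<in> smooth (e n)"
        using common unfolding A_def by blast
      then show "extended_trace \<tau> (T + U) = extended_trace \<tau> T + extended_trace \<tau> U"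
        using bound[of n] by (intro extended_trace_add) auto
      show "extended_trace \<tau> (T o\<^sub>L U) = extended_trace \<tau> (U o\<^sub>L T)"
        by (rule extended_trace_commute_smooth[OF S' \<tau> e_pos n])
    next
      show "extended_trace \<tau> (c *\<^sub>C T) = c * extended_trace \<tau> T" for c T
        by (rule extended_trace_scaleC)
    next
      fix n
      show "\<exists>C. \<forall>a\<in>A n. cmod (extended_trace \<tau> a) \<le> C * N n a"
        unfolding A_def N_def using bound[of n] by blast
    qed
  qed
  show ?thesis
    using increasing regular dense hol trace by blast
qed

end
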